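(* Let $n\ge 1$, let $(M,\mathcal{D},g)$ be a contact sub-Riemannian manifold of dimension $2n+1$ with global contact form $\omega$ normalised by $(\mathrm{d}\omega)^n|_{\mathcal{D}}=n!\,\mathrm{vol}_g$ and associated Reeb vector field $X_0$, and let $S$ be a smooth orientable hypersurface embedded in $M$ with set of characteristic points $C(S)$. Let $\Delta$ be the intrinsic sub-Laplacian on $S\setminus C(S)$ and, for $\varepsilon>0$, let $\Delta^\varepsilon$ be the Laplace--Beltrami operator of the Riemannian manifold $(S,i^*\overline{g}^\varepsilon)$, where $i\colon S\to M$ is the inclusion and $\overline{g}^\varepsilon$ is the Riemannian approximation of $(\mathcal{D},g)$ built with $X_0$. Then for any smooth function $f\in C_c^\infty(S\setminus C(S))$ compactly supported in $S\setminus C(S)$, the functions $\Delta^\varepsilon f$ converge uniformly on $S\setminus C(S)$ to $\Delta f$ as $\varepsilon\to 0$.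
   Context: Contact sub-Riemannian manifold: $M$ is a smooth manifold of dimension $2n+1$, $\mathcal{D}=\ker\omega$ for a global one-form $\omega$ with $\omega\wedge(\mathrm{d}\omega)^n\neq 0$ everywhere (contact form), and $g$ is a smooth fibre inner product on $\mathcal{D}$. The form $\omega$ is normalised so that $(\mathrm{d}\omega)^n|_{\mathcal{D}}=n!\,\mathrm{vol}_g$, where $\mathrm{vol}_g$ is the volume form on $\mathcal{D}$ induced by $g$. $M$ is oriented by $\Omega=\omega\wedge(\mathrm{d}\omega)^n$. The Reeb vector field $X_0$ is the unique vector field with $\omega(X_0)=1$, $\mathrm{d}\omega(X_0,\cdot)=0$. Hypersurface: $S$ is an oriented embedded hypersurface; $C(S)=\{x\in S: T_xS=\mathcal{D}_x\}$ is the (closed) set of characteristic points. On $S\setminus C(S)$ set $\mathcal{F}=\mathcal{D}\cap TS$, a distribution of rank $2n-1$. Sub-Riemannian normal: $N$ is the vector field along $S\setminus C(S)$ with $\omega(N)=0$, $g(N,N)=1$, $g(N,Y)=0$ for every vector field $Y$ in $\mathcal{F}$, and such that $(N,Z_1,\dots,Z_{2n})$ is a positively oriented frame for $M$ whenever $(Z_1,\dots,Z_{2n})$ is a positively oriented local frame for $S\setminus C(S)$. Volume form on the hypersurface: $\mu=\iota_N\Omega$ restricted to $S\setminus C(S)$. Horizontal gradient: for smooth $f\colon S\setminus C(S)\to\mathbb{R}$, $\nabla_S f$ is the unique vector field in $\mathcal{F}$ with $g(\nabla_S f,Y)=\mathrm{d}f(Y)$ for all vector fields $Y$ in $\mathcal{F}$.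 Intrinsic sub-Laplacian: $\Delta f=\operatorname{div}_\mu(\nabla_S f)$ on $S\setminus C(S)$. Riemannian approximation: let $\theta_0\colon TM\to\mathbb{R}$ be the fibrewise linear map with $\theta_0(X_0)=1$ and $\theta_0(X)=0$ for all $X$ in $\mathcal{D}$. For $\varepsilon>0$, $\overline{g}^\varepsilon=g\oplus\frac{1}{\varepsilon^2}(\theta_0\otimes\theta_0)$; that is, $X_0$ is $\overline{g}^\varepsilon$-orthogonal to $\mathcal{D}$, $\overline{g}^\varepsilon|_{\mathcal{D}}=g$ and $\overline{g}^\varepsilon(X_0,X_0)=\varepsilon^{-2}$. *)

theory Defs
  imports "HOL-Analysis.Analysis"
begin

section \<open>Smooth maps between open subsets of Euclidean spaces\<close>

text \<open>Both notions are meant for open sets.\<close>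

primrec Ck_on :: "nat \<Rightarrow> ('a::real_normed_vector \<Rightarrow> 'b::real_normed_vector) \<Rightarrow> 'a set \<Rightarrow> bool" where
  "Ck_on 0 f U \<longleftrightarrow> continuous_on U f"
| "Ck_on (Suc k) f U \<longleftrightarrow> (\<forall>x\<in>U. f differentiable (at x)) \<and>
     (\<forall>v. Ck_on k (\<lambda>x. frechet_derivative f (at x) v) U)"

definition smooth_on :: "'a::real_normed_vector set \<Rightarrow> ('a \<Rightarrow> 'b::real_normed_vector) \<Rightarrow> bool" where
  "smooth_on U f \<longleftrightarrow> (\<forall>k. Ck_on k f U)"


section \<open>Smooth manifolds\<close>

text \<open>
  A manifold is a subset \<open>X\<close> of a topological space, with the subspace topology, together with
  a (not necessarily maximal) smooth atlas \<open>A\<close>. A chart is a pair of its domain and its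
  coordinate map. The Hausdorff property and second countability are imposed through the
  classes of the ambient type.
\<close>

type_synonym ('m, 'e) chart = "'m set \<times> ('m \<Rightarrow> 'e)"

abbreviation cdom :: "('m, 'e) chart \<Rightarrow> 'm set" where "cdom c \<equiv> fst c"
abbreviation cmap :: "('m, 'e) chart \<Rightarrow> 'm \<Rightarrow> 'e" where "cmap c \<equiv> snd c"
abbreviation cinv :: "('m, 'e) chart \<Rightarrow> 'e \<Rightarrow> 'm" where "cinv c \<equiv> inv_into (fst c) (snd c)"

definition is_chart :: "'m::topological_space set \<Rightarrow> ('m, 'e::euclidean_space) chart \<Rightarrow> bool" where
  "is_chart X c \<longleftrightarrow> openin (top_of_set X) (cdom c) \<and> open (cmap c ` cdom c) \<and>
     homeomorphism (cdom c) (cmap c ` cdom c) (cmap c) (cinv c)"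

definition smooth_manifold ::
    "'m::{t2_space,second_countable_topology} set \<Rightarrow> ('m, 'e::euclidean_space) chart set \<Rightarrow> bool" where
  "smooth_manifold X A \<longleftrightarrow> (\<forall>c\<in>A. is_chart X c) \<and> (\<Union>c\<in>A. cdom c) = X \<and>
     (\<forall>c\<in>A. \<forall>c'\<in>A. smooth_on (cmap c ` (cdom c \<inter> cdom c')) (cmap c' \<circ> cinv c))"

text \<open>
  The tangent space at \<open>p\<close> is the model space \<open>'e\<close>: a tangent vector at \<open>p\<close> is identified with its
  coordinates in the chart \<open>chart_at A p\<close>, which is chosen once and for all for each point \<open>p\<close>.
  In general this choice varies discontinuously with \<open>p\<close>; smoothness of tensor fields is always
  expressed in the coordinates of one chart, by means of the following two maps.
\<close>

definition chart_at :: "('m, 'e) chart set \<Rightarrow> 'm \<Rightarrow> ('m, 'e) chart" where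
  "chart_at A p = (SOME c. c \<in> A \<and> p \<in> cdom c)"

text \<open>Differential at \<open>p\<close> of the coordinate map of \<open>c\<close>, and of its inverse at \<open>cmap c p\<close>:\<close>

definition to_coords ::
    "('m, 'e::euclidean_space) chart set \<Rightarrow> ('m, 'e) chart \<Rightarrow> 'm \<Rightarrow> 'e \<Rightarrow> 'e" where
  "to_coords A c p =
     frechet_derivative (cmap c \<circ> cinv (chart_at A p)) (at (cmap (chart_at A p) p))"

definition from_coords ::
    "('m, 'e::euclidean_space) chart set \<Rightarrow> ('m, 'e) chart \<Rightarrow> 'm \<Rightarrow> 'e \<Rightarrow> 'e" where
  "from_coords A c p = frechet_derivative (cmap (chart_at A p) \<circ> cinv c) (at (cmap c p))"

definition smooth_map ::
    "'m::topological_space set \<Rightarrow> ('m, 'e::euclidean_space) chart set \<Rightarrow>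
     'k::topological_space set \<Rightarrow> ('k, 'f::euclidean_space) chart set \<Rightarrow> ('m \<Rightarrow> 'k) \<Rightarrow> bool" where
  "smooth_map X A Y B \<phi> \<longleftrightarrow> continuous_on X \<phi> \<and> \<phi> ` X \<subseteq> Y \<and>
     (\<forall>a\<in>A. \<forall>b\<in>B. smooth_on (cmap a ` {x \<in> cdom a. \<phi> x \<in> cdom b}) (cmap b \<circ> \<phi> \<circ> cinv a))"

definition differential ::
    "('m, 'e::euclidean_space) chart set \<Rightarrow> ('k, 'f::euclidean_space) chart set \<Rightarrow>
     ('m \<Rightarrow> 'k) \<Rightarrow> 'm \<Rightarrow> 'e \<Rightarrow> 'f" where
  "differential A B \<phi> p = frechet_derivative (cmap (chart_at B (\<phi> p)) \<circ> \<phi> \<circ> cinv (chart_at A p))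
     (at (cmap (chart_at A p) p))"

definition smooth_fun ::
    "('m, 'e::euclidean_space) chart set \<Rightarrow> 'm set \<Rightarrow> ('m \<Rightarrow> real) \<Rightarrow> bool" where
  "smooth_fun A W f \<longleftrightarrow> (\<forall>c\<in>A. smooth_on (cmap c ` (W \<inter> cdom c)) (f \<circ> cinv c))"

definition dfun ::
    "('m, 'e::euclidean_space) chart set \<Rightarrow> ('m \<Rightarrow> real) \<Rightarrow> 'm \<Rightarrow> 'e \<Rightarrow> real" where
  "dfun A f p = frechet_derivative (f \<circ> cinv (chart_at A p)) (at (cmap (chart_at A p) p))"

definition smooth_vector_field ::
    "('m, 'e::euclidean_space) chart set \<Rightarrow> 'm set \<Rightarrow> ('m \<Rightarrow> 'e) \<Rightarrow> bool" where
  "smooth_vector_field A W X \<longleftrightarrow>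
     (\<forall>c\<in>A. smooth_on (cmap c ` (W \<inter> cdom c)) (\<lambda>x. to_coords A c (cinv c x) (X (cinv c x))))"


section \<open>Differential forms\<close>

text \<open>
  A \<open>k\<close>-form assigns to each point a function on lists of tangent vectors, of which only the values
  on lists of length \<open>k\<close> are relevant. The normalisations are those for which
  \<open>(\<alpha> \<and> \<beta>)(u, v) = \<alpha>(u) \<beta>(v) - \<alpha>(v) \<beta>(u)\<close> and
  \<open>d\<alpha>(X, Y) = X(\<alpha>(Y)) - Y(\<alpha>(X)) - \<alpha>([X, Y])\<close> for one-forms.
\<close>

type_synonym ('m, 'e) form = "'m \<Rightarrow> 'e list \<Rightarrow> real"

definition alternating :: "nat \<Rightarrow> ('e::real_vector list \<Rightarrow> real) \<Rightarrow> bool" where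
  "alternating k a \<longleftrightarrow> (\<forall>vs. length vs = k \<longrightarrow>
     (\<forall>i<k. linear (\<lambda>x. a (vs[i := x]))) \<and>
     (\<forall>i<k. \<forall>j<k. i \<noteq> j \<and> vs ! i = vs ! j \<longrightarrow> a vs = 0))"

definition smooth_form ::
    "'m set \<Rightarrow> ('m, 'e::euclidean_space) chart set \<Rightarrow> nat \<Rightarrow> ('m, 'e) form \<Rightarrow> bool" where
  "smooth_form X A k \<alpha> \<longleftrightarrow> (\<forall>p\<in>X. alternating k (\<alpha> p)) \<and>
     (\<forall>c\<in>A. \<forall>ws. length ws = k \<longrightarrow>
        smooth_on (cmap c ` cdom c) (\<lambda>x. \<alpha> (cinv c x) (map (from_coords A c (cinv c x)) ws)))"

text \<open>The first factor of \<open>wedge\<close> is a \<open>k\<close>-form; \<open>wedge_power\<close> is for two-forms.\<close>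

definition wedge :: "nat \<Rightarrow> ('m, 'e) form \<Rightarrow> ('m, 'e) form \<Rightarrow> ('m, 'e) form" where
  "wedge k \<alpha> \<beta> p vs =
     (\<Sum>\<sigma> | \<sigma> permutes {..<length vs}. of_int (sign \<sigma>) *
        \<alpha> p (take k (permute_list \<sigma> vs)) * \<beta> p (drop k (permute_list \<sigma> vs)))
     / (fact k * fact (length vs - k))"

primrec wedge_power :: "('m, 'e) form \<Rightarrow> nat \<Rightarrow> ('m, 'e) form" where
  "wedge_power \<beta> 0 = (\<lambda>p vs. 1)"
| "wedge_power \<beta> (Suc m) = wedge 2 \<beta> (wedge_power \<beta> m)"

text \<open>
  The exterior derivative at \<open>p\<close> is computed in the chart \<open>chart_at A p\<close>, in which tangent vectors
  at \<open>p\<close> are their own coordinates: the arguments are extended to vector fields with constant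
  coordinates, whose brackets vanish.
\<close>

definition ext_deriv ::
    "('m, 'e::euclidean_space) chart set \<Rightarrow> ('m, 'e) form \<Rightarrow> ('m, 'e) form" where
  "ext_deriv A \<alpha> p vs = (let c = chart_at A p in
     \<Sum>i<length vs. (-1) ^ i *
       frechet_derivative
         (\<lambda>x. \<alpha> (cinv c x) (map (from_coords A c (cinv c x)) (take i vs @ drop (Suc i) vs)))
         (at (cmap c p)) (vs ! i))"

definition interior_product :: "('m \<Rightarrow> 'e) \<Rightarrow> ('m, 'e) form \<Rightarrow> ('m, 'e) form" where
  "interior_product X \<alpha> p vs = \<alpha> p (X p # vs)"

text \<open>
  An orientation is represented by a nowhere vanishing smooth form of top degree; a frame is
  positively oriented if the form is positive on it.
\<close>

definition orientation_form ::
    "'m set \<Rightarrow> ('m, 'e::euclidean_space) chart set \<Rightarrow> ('m, 'e) form \<Rightarrow> bool" where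
  "orientation_form X A \<eta> \<longleftrightarrow> smooth_form X A DIM('e) \<eta> \<and>
     (\<forall>p\<in>X. \<exists>vs. length vs = DIM('e) \<and> \<eta> p vs \<noteq> 0)"

definition gram_det :: "('e \<Rightarrow> 'e \<Rightarrow> real) \<Rightarrow> 'e list \<Rightarrow> real" where
  "gram_det h vs = (\<Sum>\<sigma> | \<sigma> permutes {..<length vs}. of_int (sign \<sigma>) *
     (\<Prod>i<length vs. h (vs ! i) (vs ! \<sigma> i)))"

text \<open>Volume form of the (fibre) metric \<open>h\<close> for the orientation given by the form \<open>\<eta>\<close>:\<close>

definition volume_form :: "('m \<Rightarrow> 'e \<Rightarrow> 'e \<Rightarrow> real) \<Rightarrow> ('m, 'e) form \<Rightarrow> ('m, 'e) form" where
  "volume_form h \<eta> p vs = sgn (\<eta> p vs) * sqrt (gram_det (h p) vs)"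

text \<open>
  The divergence is characterised by \<open>d(\<iota>\<^sub>X \<mu>) = div\<^sub>\<mu>(X) \<mu>\<close>; the left-hand side
  is the Lie derivative of the top-degree form \<open>\<mu>\<close> along \<open>X\<close>.
\<close>

definition divergence ::
    "('m, 'e::euclidean_space) chart set \<Rightarrow> ('m, 'e) form \<Rightarrow> ('m \<Rightarrow> 'e) \<Rightarrow> 'm \<Rightarrow> real" where
  "divergence A \<mu> X p = (THE r. \<forall>vs. length vs = DIM('e) \<longrightarrow>
     ext_deriv A (interior_product X \<mu>) p vs = r * \<mu> p vs)"

definition riem_gradient ::
    "('m, 'e::euclidean_space) chart set \<Rightarrow> ('m \<Rightarrow> 'e \<Rightarrow> 'e \<Rightarrow> real) \<Rightarrow> ('m \<Rightarrow> real) \<Rightarrow> 'm \<Rightarrow> 'e" where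
  "riem_gradient A h f p = (THE v. \<forall>w. h p v w = dfun A f p w)"

definition laplace_beltrami ::
    "('m, 'e::euclidean_space) chart set \<Rightarrow> ('m, 'e) form \<Rightarrow> ('m \<Rightarrow> 'e \<Rightarrow> 'e \<Rightarrow> real) \<Rightarrow>
     ('m \<Rightarrow> real) \<Rightarrow> 'm \<Rightarrow> real" where
  "laplace_beltrami A \<eta> h f = divergence A (volume_form h \<eta>) (riem_gradient A h f)"


section \<open>Contact sub-Riemannian manifolds\<close>

definition distribution :: "('m, 'e) form \<Rightarrow> 'm \<Rightarrow> 'e set" where
  "distribution \<omega> p = {v. \<omega> p [v] = 0}"

definition inner_product_on :: "'e::real_vector set \<Rightarrow> ('e \<Rightarrow> 'e \<Rightarrow> real) \<Rightarrow> bool" where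
  "inner_product_on V b \<longleftrightarrow>
     (\<forall>u\<in>V. \<forall>v\<in>V. \<forall>w\<in>V. b (u + v) w = b u w + b v w) \<and>
     (\<forall>r. \<forall>u\<in>V. \<forall>v\<in>V. b (r *\<^sub>R u) v = r * b u v) \<and>
     (\<forall>u\<in>V. \<forall>v\<in>V. b u v = b v u) \<and>
     (\<forall>u\<in>V. u \<noteq> 0 \<longrightarrow> b u u > 0)"

text \<open>Only the values of \<open>g p\<close> on \<open>distribution \<omega> p\<close> are relevant.\<close>

definition smooth_fibre_inner_product ::
    "'m::topological_space set \<Rightarrow> ('m, 'e::euclidean_space) chart set \<Rightarrow> ('m, 'e) form \<Rightarrow>
     ('m \<Rightarrow> 'e \<Rightarrow> 'e \<Rightarrow> real) \<Rightarrow> bool" where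
  "smooth_fibre_inner_product M A \<omega> g \<longleftrightarrow>
     (\<forall>p\<in>M. inner_product_on (distribution \<omega> p) (g p)) \<and>
     (\<forall>W X Y. openin (top_of_set M) W \<and>
        smooth_vector_field A W X \<and> (\<forall>p\<in>W. X p \<in> distribution \<omega> p) \<and>
        smooth_vector_field A W Y \<and> (\<forall>p\<in>W. Y p \<in> distribution \<omega> p) \<longrightarrow>
        smooth_fun A W (\<lambda>p. g p (X p) (Y p)))"

definition contact_volume ::
    "('m, 'e::euclidean_space) chart set \<Rightarrow> nat \<Rightarrow> ('m, 'e) form \<Rightarrow> ('m, 'e) form" where
  "contact_volume A n \<omega> = wedge 1 \<omega> (wedge_power (ext_deriv A \<omega>) n)"

text \<open>
  In the last condition \<open>distribution \<omega>\<close> carries the orientation given by the restriction of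
  \<open>(d\<omega>)\<^sup>n\<close>, the only one for which the identity can hold.
\<close>

definition contact_sub_riemannian ::
    "'m::{t2_space,second_countable_topology} set \<Rightarrow> ('m, 'e::euclidean_space) chart set \<Rightarrow> nat \<Rightarrow>
     ('m, 'e) form \<Rightarrow> ('m \<Rightarrow> 'e \<Rightarrow> 'e \<Rightarrow> real) \<Rightarrow> bool" where
  "contact_sub_riemannian M A n \<omega> g \<longleftrightarrow>
     DIM('e) = 2 * n + 1 \<and>
     smooth_manifold M A \<and>
     smooth_form M A 1 \<omega> \<and>
     (\<forall>p\<in>M. \<exists>vs. length vs = 2 * n + 1 \<and> contact_volume A n \<omega> p vs \<noteq> 0) \<and>
     smooth_fibre_inner_product M A \<omega> g \<and>
     (\<forall>p\<in>M. \<forall>vs. length vs = 2 * n \<and> set vs \<subseteq> distribution \<omega> p \<longrightarrow>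
        wedge_power (ext_deriv A \<omega>) n p vs =
          fact n * volume_form g (wedge_power (ext_deriv A \<omega>) n) p vs)"

definition reeb ::
    "('m, 'e::euclidean_space) chart set \<Rightarrow> ('m, 'e) form \<Rightarrow> 'm \<Rightarrow> 'e" where
  "reeb A \<omega> p = (THE v. \<omega> p [v] = 1 \<and> (\<forall>w. ext_deriv A \<omega> p [v, w] = 0))"

definition theta0 ::
    "('m, 'e::euclidean_space) chart set \<Rightarrow> ('m, 'e) form \<Rightarrow> 'm \<Rightarrow> 'e \<Rightarrow> real" where
  "theta0 A \<omega> p = (THE t. linear t \<and> t (reeb A \<omega> p) = 1 \<and> (\<forall>v\<in>distribution \<omega> p. t v = 0))"

text \<open>
  The first summand is \<open>g\<close> applied to the components in \<open>distribution \<omega> p\<close> along the Reeb field.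
\<close>

definition riem_approx ::
    "('m, 'e::euclidean_space) chart set \<Rightarrow> ('m, 'e) form \<Rightarrow> ('m \<Rightarrow> 'e \<Rightarrow> 'e \<Rightarrow> real) \<Rightarrow> real \<Rightarrow>
     'm \<Rightarrow> 'e \<Rightarrow> 'e \<Rightarrow> real" where
  "riem_approx A \<omega> g \<epsilon> p u v =
     g p (u - theta0 A \<omega> p u *\<^sub>R reeb A \<omega> p) (v - theta0 A \<omega> p v *\<^sub>R reeb A \<omega> p)
     + 1 / \<epsilon>\<^sup>2 * (theta0 A \<omega> p u * theta0 A \<omega> p v)"


section \<open>Hypersurfaces\<close>

text \<open>
  In what follows \<open>(S, B)\<close> is a hypersurface of \<open>(M, A)\<close>, and \<open>incl\<close> is the differential of
  the inclusion, which identifies tangent vectors of \<open>S\<close> with tangent vectors of \<open>M\<close>.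
\<close>

abbreviation incl ::
    "('m, 's::euclidean_space) chart set \<Rightarrow> ('m, 'e::euclidean_space) chart set \<Rightarrow> 'm \<Rightarrow> 's \<Rightarrow> 'e" where
  "incl B A p \<equiv> differential B A (\<lambda>x. x) p"

definition embedded_hypersurface ::
    "'m::{t2_space,second_countable_topology} set \<Rightarrow> ('m, 'e::euclidean_space) chart set \<Rightarrow>
     'm set \<Rightarrow> ('m, 's::euclidean_space) chart set \<Rightarrow> bool" where
  "embedded_hypersurface M A S B \<longleftrightarrow>
     DIM('s) + 1 = DIM('e) \<and> S \<subseteq> M \<and> smooth_manifold S B \<and>
     smooth_map S B M A (\<lambda>x. x) \<and> (\<forall>p\<in>S. inj (incl B A p))"

definition characteristic_points ::
    "('m, 'e::euclidean_space) chart set \<Rightarrow> ('m, 'e) form \<Rightarrow>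
     'm set \<Rightarrow> ('m, 's::euclidean_space) chart set \<Rightarrow> 'm set" where
  "characteristic_points A \<omega> S B = {p \<in> S. range (incl B A p) = distribution \<omega> p}"

text \<open>The distribution \<open>F = D \<inter> TS\<close>, as a subspace of the tangent space of \<open>S\<close>:\<close>

definition hyp_distribution ::
    "('m, 'e::euclidean_space) chart set \<Rightarrow> ('m, 'e) form \<Rightarrow>
     ('m, 's::euclidean_space) chart set \<Rightarrow> 'm \<Rightarrow> 's set" where
  "hyp_distribution A \<omega> B p = {v. incl B A p v \<in> distribution \<omega> p}"

definition sub_normal ::
    "('m, 'e::euclidean_space) chart set \<Rightarrow> nat \<Rightarrow> ('m, 'e) form \<Rightarrow> ('m \<Rightarrow> 'e \<Rightarrow> 'e \<Rightarrow> real) \<Rightarrow>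
     ('m, 's::euclidean_space) chart set \<Rightarrow> ('m, 's) form \<Rightarrow> 'm \<Rightarrow> 'e" where
  "sub_normal A n \<omega> g B \<eta> p = (THE N. \<omega> p [N] = 0 \<and> g p N N = 1 \<and>
     (\<forall>y\<in>hyp_distribution A \<omega> B p. g p N (incl B A p y) = 0) \<and>
     (\<forall>zs. length zs = 2 * n \<and> \<eta> p zs > 0 \<longrightarrow>
        contact_volume A n \<omega> p (N # map (incl B A p) zs) > 0))"

definition hyp_volume ::
    "('m, 'e::euclidean_space) chart set \<Rightarrow> nat \<Rightarrow> ('m, 'e) form \<Rightarrow> ('m \<Rightarrow> 'e \<Rightarrow> 'e \<Rightarrow> real) \<Rightarrow>
     ('m, 's::euclidean_space) chart set \<Rightarrow> ('m, 's) form \<Rightarrow> ('m, 's) form" where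
  "hyp_volume A n \<omega> g B \<eta> p zs =
     interior_product (sub_normal A n \<omega> g B \<eta>) (contact_volume A n \<omega>) p (map (incl B A p) zs)"

definition horizontal_gradient ::
    "('m, 'e::euclidean_space) chart set \<Rightarrow> ('m, 'e) form \<Rightarrow> ('m \<Rightarrow> 'e \<Rightarrow> 'e \<Rightarrow> real) \<Rightarrow>
     ('m, 's::euclidean_space) chart set \<Rightarrow> ('m \<Rightarrow> real) \<Rightarrow> 'm \<Rightarrow> 's" where
  "horizontal_gradient A \<omega> g B f p = (THE v. v \<in> hyp_distribution A \<omega> B p \<and>
     (\<forall>y\<in>hyp_distribution A \<omega> B p. g p (incl B A p v) (incl B A p y) = dfun B f p y))"

definition sub_laplacian ::
    "('m, 'e::euclidean_space) chart set \<Rightarrow> nat \<Rightarrow> ('m, 'e) form \<Rightarrow> ('m \<Rightarrow> 'e \<Rightarrow> 'e \<Rightarrow> real) \<Rightarrow>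
     ('m, 's::euclidean_space) chart set \<Rightarrow> ('m, 's) form \<Rightarrow> ('m \<Rightarrow> real) \<Rightarrow> 'm \<Rightarrow> real" where
  "sub_laplacian A n \<omega> g B \<eta> f =
     divergence B (hyp_volume A n \<omega> g B \<eta>) (horizontal_gradient A \<omega> g B f)"

definition induced_metric ::
    "('m, 'e::euclidean_space) chart set \<Rightarrow> ('m, 's::euclidean_space) chart set \<Rightarrow>
     ('m \<Rightarrow> 'e \<Rightarrow> 'e \<Rightarrow> real) \<Rightarrow> 'm \<Rightarrow> 's \<Rightarrow> 's \<Rightarrow> real" where
  "induced_metric A B h p u v = h p (incl B A p u) (incl B A p v)"

text \<open>
  Smooth functions with compact support in the open subset \<open>W\<close> of \<open>S\<close>, extended by zero to \<open>S\<close>.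
  The set \<open>W \<inter> closure {x \<in> W. f x \<noteq> 0}\<close> is the support relative to \<open>W\<close>.
\<close>

definition smooth_compact_support ::
    "('m::topological_space, 's::euclidean_space) chart set \<Rightarrow> 'm set \<Rightarrow> 'm set \<Rightarrow>
     ('m \<Rightarrow> real) \<Rightarrow> bool" where
  "smooth_compact_support B S W f \<longleftrightarrow> smooth_fun B W f \<and>
     compact (W \<inter> closure {x \<in> W. f x \<noteq> 0}) \<and> (\<forall>x\<in>S - W. f x = 0)"

end

theory Submission
  imports Defs
begin

text \<open>
  Write \<open>s = \<epsilon>\<^sup>2\<close>. As the form \<open>\<theta>\<^sub>0\<close> equals \<open>\<omega>\<close>, the metric induced on the hypersurface is
  \<open>G + \<tau> \<otimes> \<tau> / s\<close>, where \<open>\<tau>\<close> is the restriction of \<open>\<omega>\<close> and \<open>G\<close> is \<open>g\<close> applied to the components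
  along the distribution. Its Gram determinant is \<open>(s A + D) / s\<close> with \<open>A\<close> and \<open>D\<close> independent of
  \<open>s\<close>, where \<open>A \<ge> 0\<close>, and \<open>D > 0\<close> away from the characteristic points, and
  by the normalisation of \<open>\<omega>\<close> the volume form \<open>\<mu>\<close> is \<open>n! \<surd>D\<close> up to orientation.
  The gradient \<open>X\<close> of \<open>f\<close> and the multiplier \<open>c = \<tau>(X) / s\<close> solve the linear system
  \<open>G(X, \<cdot>) + c \<tau> = df\<close>, \<open>\<tau>(X) = s c\<close>, which stays nondegenerate at \<open>s = 0\<close>, where its solution is
  the horizontal gradient. Since constant factors of a volume form do not change the divergence, both
  Laplacians are \<open>div(\<rho> X) / \<rho>\<close> with \<open>\<rho> = \<surd>(s A + D)\<close>, a function which is smooth jointly in \<open>s\<close> and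
  the point up to \<open>s = 0\<close>. Hence the convergence is locally uniform, and the compactness of the
  support of \<open>f\<close> makes it uniform. The points are compared in a common chart, which requires that the
  divergence does not depend on the chart.
\<close>

section \<open>Calculus of smooth maps\<close>

text \<open>Two features of the setting shape the proof. The tangent space at \<open>p\<close>
  consists of coordinates in \<open>chart_at A p\<close>, which jumps with \<open>p\<close>, so
  pointwise objects must be rewritten in one fixed chart before continuity makes sense. For the
  divergence the danger lies in the second derivatives of the transition maps; they cancel by
  symmetry. Moreover metric and volume form blow up as \<open>s\<close> tends to 0. The multiplier
  turns the singular gradient equation into a system affine in \<open>s\<close>, solved smoothly by
  Cramer's rule, while the factor \<open>1 / sqrt s\<close> of the volume form is constant on the
  hypersurface. The relation between \<open>D\<close> and \<mu> comes from a frame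
  \<open>(fs, T)\<close> in which \<open>fs\<close> spans the kernel of \<tau> and \<open>T\<close>
  is orthogonal to it: there the Gram determinant is visibly affine in \<open>1 / s\<close>, and the
  normalisation of \<omega> is applied to \<open>fs\<close> together with the normal. The Reeb
  field, the normal and the gradients are definite descriptions, so each requires existence and
  uniqueness, obtained from linear algebra on one tangent space. Off the support of \<open>f\<close>
  there is no compactness; there the locality of the operators replaces it.\<close>

lemma has_derivative_frechet:
  "f differentiable (at x) \<Longrightarrow> (f has_derivative frechet_derivative f (at x)) (at x)"
  by (simp add: frechet_derivative_works)

lemma Ck_on_cong:
  assumes "open U" "\<And>x. x \<in> U \<Longrightarrow> f x = g x"
  shows "Ck_on k f U \<longleftrightarrow> Ck_on k g U"
  using assms(2)
proof (induction k arbitrary: f g)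
  case 0
  then show ?case by (auto intro!: continuous_on_cong)
next
  case (Suc k)
  have d: "f differentiable (at x) \<longleftrightarrow> g differentiable (at x)" if "x \<in> U" for x
    unfolding differentiable_def using that assms(1) Suc.prems
    by (metis has_derivative_transform_within_open)
  have e: "frechet_derivative f (at x) v = frechet_derivative g (at x) v" if "x \<in> U" for x v
  proof (cases "f differentiable (at x)")
    case True
    then show ?thesis
      using frechet_derivative_transform_within_open[of f x U g] that assms(1) Suc.prems by auto
  next
    case False
    \<comment> \<open>\<open>frechet_derivative\<close> is a choice even where no derivative exists;
      both choices are made from the same predicate and hence agree.\<close>
    have "(f has_derivative f') (at x) \<longleftrightarrow> (g has_derivative f') (at x)" for f'
      using that assms(1) Suc.prems by (metis has_derivative_transform_within_open)
    then show ?thesis by (simp add: frechet_derivative_def)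
  qed
  show ?case using Suc.IH[OF e] d by simp
qed

text \<open>Lets a derivative be exhibited by a formula; the inductions for sums, products,
  compositions, inverses and roots all run through this rule.\<close>

lemma Ck_on_SucI:
  assumes "open U" "\<And>x. x \<in> U \<Longrightarrow> (f has_derivative f' x) (at x)"
    "\<And>v. Ck_on k (\<lambda>x. f' x v) U"
  shows "Ck_on (Suc k) f U"
proof -
  have "Ck_on k (\<lambda>x. frechet_derivative f (at x) v) U" for v
    using assms(3)[of v] Ck_on_cong[OF assms(1), of "\<lambda>x. frechet_derivative f (at x) v" "\<lambda>x. f' x v" k]
      frechet_derivative_at[OF assms(2)] by auto
  then show ?thesis using assms(2) by (auto simp: differentiable_def)
qed

lemma Ck_on_SucD:
  assumes "Ck_on (Suc k) f U"
  shows "\<And>x. x \<in> U \<Longrightarrow> (f has_derivative frechet_derivative f (at x)) (at x)"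
    "Ck_on k (\<lambda>x. frechet_derivative f (at x) v) U"
  using assms by (auto intro: has_derivative_frechet)

lemma Ck_on_Suc_imp: "Ck_on (Suc k) f U \<Longrightarrow> Ck_on k f U"
proof (induction k arbitrary: f)
  case 0
  then show ?case
    by (auto intro!: continuous_at_imp_continuous_on differentiable_imp_continuous_within)
next
  case (Suc k)
  then show ?case by (metis Ck_on.simps(2))
qed

lemma Ck_on_subset: "Ck_on k f U \<Longrightarrow> V \<subseteq> U \<Longrightarrow> Ck_on k f V"
  by (induction k arbitrary: f) (auto intro: continuous_on_subset)

lemma Ck_on_const: "Ck_on k (\<lambda>x. c) U"
  by (induction k arbitrary: c) auto

lemma Ck_on_bounded_linear:
  assumes "bounded_linear L" "open U" shows "Ck_on k L U"
proof (cases k)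
  case 0
  then show ?thesis by (simp add: linear_continuous_on[OF assms(1)])
next
  case (Suc j)
  show ?thesis unfolding Suc
    by (rule Ck_on_SucI[where f' = "\<lambda>x. L"])
      (auto intro: assms bounded_linear_imp_has_derivative Ck_on_const)
qed

lemma Ck_on_add:
  assumes "open U" "Ck_on k f U" "Ck_on k g U"
  shows "Ck_on k (\<lambda>x. f x + g x) U"
  using assms(2,3)
proof (induction k arbitrary: f g)
  case 0
  then show ?case by (auto intro: continuous_on_add continuous_on_scaleR)
next
  case (Suc k)
  show ?case
    by (rule Ck_on_SucI[where f' = "\<lambda>x v. frechet_derivative f (at x) v + frechet_derivative g (at x) v"])
      (use Suc Ck_on_SucD[OF Suc.prems(1)] Ck_on_SucD[OF Suc.prems(2)] in
        \<open>auto intro!: assms has_derivative_add simp del: Ck_on.simps\<close>)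
qed

lemma Ck_on_scaleR:
  assumes "open U" "Ck_on k f U" "Ck_on k g U"
  shows "Ck_on k (\<lambda>x. f x *\<^sub>R g x) U"
  using assms(2,3)
proof (induction k arbitrary: f g)
  case 0
  then show ?case by (auto intro: continuous_on_add continuous_on_scaleR)
next
  case (Suc k)
  show ?case
    by (rule Ck_on_SucI[where f' = "\<lambda>x v. f x *\<^sub>R frechet_derivative g (at x) v + frechet_derivative f (at x) v *\<^sub>R g x"])
      (use Ck_on_SucD[OF Suc.prems(1)] Ck_on_SucD[OF Suc.prems(2)]
        Ck_on_Suc_imp[OF Suc.prems(1)] Ck_on_Suc_imp[OF Suc.prems(2)] in
        \<open>auto intro!: assms has_derivative_scaleR Ck_on_add Suc.IH simp del: Ck_on.simps\<close>)
qed

lemma Ck_on_linear_compose: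
  assumes "open U" "bounded_linear L" "Ck_on k f U"
  shows "Ck_on k (\<lambda>x. L (f x)) U"
  using assms(3)
proof (induction k arbitrary: f)
  case 0
  then show ?case by (auto intro: bounded_linear.continuous_on[OF assms(2)])
next
  case (Suc k)
  show ?case
    by (rule Ck_on_SucI[where f' = "\<lambda>x v. L (frechet_derivative f (at x) v)"])
      (use Suc Ck_on_SucD[OF Suc.prems(1)] in
        \<open>auto intro!: assms bounded_linear.has_derivative[OF assms(2)] simp del: Ck_on.simps\<close>)
qed

lemma Ck_on_sum:
  assumes "open U" "\<And>i. i \<in> I \<Longrightarrow> Ck_on k (f i) U"
  shows "Ck_on k (\<lambda>x. \<Sum>i\<in>I. f i x) U"
proof (cases "finite I")
  case True
  then show ?thesis using assms(2)
    by (induction I) (auto intro: Ck_on_const Ck_on_add assms(1))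
qed (simp add: Ck_on_const)

text \<open>\<open>Ck_on\<close> controls derivatives of \<open>g\<close> only in directions
  independent of the point, whereas the chain rule asks for the derivative in the moving direction
  given by the derivative of \<open>f\<close>. Expanding that direction in \<open>Basis\<close>
  leaves products of scalar functions with compositions of lower order; this is why the middle space
  is Euclidean.\<close>

lemma Ck_on_compose:
  fixes f :: "'a::real_normed_vector \<Rightarrow> 'b::euclidean_space" and g :: "'b \<Rightarrow> 'c::real_normed_vector"
  assumes "open U" "open V" "f ` U \<subseteq> V" "Ck_on k f U" "Ck_on k g V"
  shows "Ck_on k (\<lambda>x. g (f x)) U"
  using assms(4,5)
proof (induction k arbitrary: g)
  case 0
  then show ?case using assms(3) by (auto intro: continuous_on_compose2)
next
  case (Suc k)
  let ?D = "\<lambda>x v. \<Sum>b\<in>Basis. (frechet_derivative f (at x) v \<bullet> b) *\<^sub>R frechet_derivative g (at (f x)) b"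
  show ?case
  proof (rule Ck_on_SucI[OF assms(1)])
    fix x assume x: "x \<in> U"
    have f: "(f has_derivative frechet_derivative f (at x)) (at x)"
      using Ck_on_SucD(1)[OF Suc.prems(1)] x by auto
    have g: "(g has_derivative frechet_derivative g (at (f x))) (at (f x))"
      using Ck_on_SucD(1)[OF Suc.prems(2)] x assms(3) by auto
    interpret l: linear "frechet_derivative g (at (f x))"
      using g has_derivative_linear by blast
    have "frechet_derivative g (at (f x)) w = (\<Sum>b\<in>Basis. (w \<bullet> b) *\<^sub>R frechet_derivative g (at (f x)) b)" for w
      by (subst euclidean_representation[of w, symmetric]) (simp add: l.sum l.scale)
    from this[symmetric] have "?D x = (\<lambda>v. frechet_derivative g (at (f x)) (frechet_derivative f (at x) v))"
      by (simp only: fun_eq_iff) simp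
    then show "((\<lambda>x. g (f x)) has_derivative ?D x) (at x)"
      using has_derivative_compose[OF f g] by simp
  next
    fix v
    show "Ck_on k (\<lambda>x. ?D x v) U"
      using Ck_on_SucD(2)[OF Suc.prems(1)] Ck_on_SucD(2)[OF Suc.prems(2)] Ck_on_Suc_imp[OF Suc.prems(1)]
      by (intro Ck_on_sum Ck_on_scaleR assms(1) Suc.IH Ck_on_linear_compose[OF assms(1) bounded_linear_inner_left])
        auto
  qed
qed

text \<open>The derivative is a product of copies of \<open>inverse\<close> itself, so the induction
  closes.\<close>

lemma Ck_on_inverse: "Ck_on k (inverse :: real \<Rightarrow> real) (- {0})"
proof (induction k)
  case 0
  then show ?case by (auto intro!: continuous_intros)
next
  case (Suc k)
  have o: "open (- {0::real})" by auto
  show ?case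
  proof (rule Ck_on_SucI[OF o, where f' = "\<lambda>x v. - (inverse x * v * inverse x)"])
    fix x :: real assume "x \<in> - {0}"
    then show "(inverse has_derivative (\<lambda>v. - (inverse x * v * inverse x))) (at x)"
      by (auto intro!: has_derivative_inverse')
  next
    fix v :: real
    have "Ck_on k (\<lambda>x. (-v) *\<^sub>R (inverse x *\<^sub>R inverse x)) (- {0})"
      by (intro Ck_on_scaleR o Ck_on_const Suc)
    then show "Ck_on k (\<lambda>x. - (inverse x * v * inverse x)) (- {0})"
      by (simp add: mult_ac)
  qed
qed

lemma Ck_on_sqrt: "Ck_on k sqrt {0<..}"
proof (induction k)
  case 0
  then show ?case by (auto intro!: continuous_intros)
next
  case (Suc k)
  have o: "open {0::real<..}" by auto
  show ?case
  proof (rule Ck_on_SucI[OF o, where f' = "\<lambda>x v. (v/2) *\<^sub>R inverse (sqrt x)"])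
    fix x :: real assume x: "x \<in> {0<..}"
    have "(sqrt has_field_derivative (inverse (sqrt x) / 2)) (at x)"
      using x by (auto intro!: DERIV_real_sqrt)
    then show "(sqrt has_derivative (\<lambda>v. (v/2) *\<^sub>R inverse (sqrt x))) (at x)"
      by (rule has_derivative_eq_rhs[OF has_field_derivative_imp_has_derivative]) (auto simp: fun_eq_iff)
  next
    fix v :: real
    have "Ck_on k (\<lambda>x. inverse (sqrt x)) {0<..}"
      by (rule Ck_on_compose[where V = "- {0}"]) (auto intro: Suc Ck_on_inverse)
    then show "Ck_on k (\<lambda>x. (v/2) *\<^sub>R inverse (sqrt x)) {0<..}"
      by (intro Ck_on_scaleR o Ck_on_const)
  qed
qed

section \<open>Closure properties of smooth maps\<close>

lemma smooth_on_cong: "open U \<Longrightarrow> (\<And>x. x \<in> U \<Longrightarrow> f x = g x) \<Longrightarrow> smooth_on U f \<longleftrightarrow> smooth_on U g"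
  unfolding smooth_on_def using Ck_on_cong by blast

lemma smooth_on_subset: "smooth_on U f \<Longrightarrow> V \<subseteq> U \<Longrightarrow> smooth_on V f"
  unfolding smooth_on_def using Ck_on_subset by blast

lemma smooth_on_const [intro, simp]: "smooth_on U (\<lambda>x. c)"
  unfolding smooth_on_def by (simp add: Ck_on_const)

lemma smooth_on_bounded_linear: "bounded_linear L \<Longrightarrow> open U \<Longrightarrow> smooth_on U L"
  unfolding smooth_on_def by (simp add: Ck_on_bounded_linear)

lemma smooth_on_add: "open U \<Longrightarrow> smooth_on U f \<Longrightarrow> smooth_on U g \<Longrightarrow> smooth_on U (\<lambda>x. f x + g x)"
  unfolding smooth_on_def by (simp add: Ck_on_add)

lemma smooth_on_scaleR:
  "open U \<Longrightarrow> smooth_on U f \<Longrightarrow> smooth_on U g \<Longrightarrow> smooth_on U (\<lambda>x. f x *\<^sub>R g x)"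
  unfolding smooth_on_def by (simp add: Ck_on_scaleR)

lemma smooth_on_mult:
  fixes f g :: "_ \<Rightarrow> real"
  shows "open U \<Longrightarrow> smooth_on U f \<Longrightarrow> smooth_on U g \<Longrightarrow> smooth_on U (\<lambda>x. f x * g x)"
  using smooth_on_scaleR[of U f g] by simp

lemma smooth_on_minus:
  "open U \<Longrightarrow> smooth_on U f \<Longrightarrow> smooth_on U (\<lambda>x. - f x)"
  using smooth_on_scaleR[of U "\<lambda>_. -1" f] by simp

lemma smooth_on_diff:
  "open U \<Longrightarrow> smooth_on U f \<Longrightarrow> smooth_on U g \<Longrightarrow> smooth_on U (\<lambda>x. f x - g x)"
  using smooth_on_add[of U f "\<lambda>x. - g x"] smooth_on_minus[of U g] by simp

lemma smooth_on_linear_compose: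
  "open U \<Longrightarrow> bounded_linear L \<Longrightarrow> smooth_on U f \<Longrightarrow> smooth_on U (\<lambda>x. L (f x))"
  unfolding smooth_on_def by (simp add: Ck_on_linear_compose)

lemma smooth_on_inner_left: "open U \<Longrightarrow> smooth_on U f \<Longrightarrow> smooth_on U (\<lambda>x. f x \<bullet> b)"
  using smooth_on_linear_compose[OF _ bounded_linear_inner_left] .

lemma smooth_on_sum:
  "open U \<Longrightarrow> (\<And>i. i \<in> I \<Longrightarrow> smooth_on U (f i)) \<Longrightarrow> smooth_on U (\<lambda>x. \<Sum>i\<in>I. f i x)"
  unfolding smooth_on_def by (simp add: Ck_on_sum)

lemma smooth_on_prod:
  fixes f :: "_ \<Rightarrow> _ \<Rightarrow> real"
  assumes "open U" "\<And>i. i \<in> I \<Longrightarrow> smooth_on U (f i)"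
  shows "smooth_on U (\<lambda>x. \<Prod>i\<in>I. f i x)"
proof (cases "finite I")
  case True
  then show ?thesis using assms(2)
    by (induction I) (auto intro: smooth_on_mult assms(1))
qed simp

lemma smooth_on_compose:
  fixes f :: "'a::real_normed_vector \<Rightarrow> 'b::euclidean_space"
  shows "open U \<Longrightarrow> open V \<Longrightarrow> f ` U \<subseteq> V \<Longrightarrow> smooth_on U f \<Longrightarrow> smooth_on V g \<Longrightarrow> smooth_on U (\<lambda>x. g (f x))"
  unfolding smooth_on_def using Ck_on_compose by blast

lemma smooth_on_divide:
  fixes f g :: "_ \<Rightarrow> real"
  assumes "open U" "smooth_on U f" "smooth_on U g" "\<And>x. x \<in> U \<Longrightarrow> g x \<noteq> 0"
  shows "smooth_on U (\<lambda>x. f x / g x)"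
proof -
  have "smooth_on U (\<lambda>x. inverse (g x))"
    by (rule smooth_on_compose[where V = "- {0}"])
      (use assms in \<open>auto simp: smooth_on_def Ck_on_inverse\<close>)
  from smooth_on_mult[OF assms(1,2) this] show ?thesis by (simp add: divide_inverse)
qed

lemma smooth_on_sqrt:
  fixes f :: "_ \<Rightarrow> real"
  assumes "open U" "smooth_on U f" "\<And>x. x \<in> U \<Longrightarrow> f x > 0"
  shows "smooth_on U (\<lambda>x. sqrt (f x))"
  by (rule smooth_on_compose[where V = "{0<..}"])
    (use assms in \<open>auto simp: smooth_on_def Ck_on_sqrt\<close>)

lemma smooth_on_has_derivative:
  "smooth_on U f \<Longrightarrow> x \<in> U \<Longrightarrow> (f has_derivative frechet_derivative f (at x)) (at x)"
  unfolding smooth_on_def using Ck_on_SucD(1) by blast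

lemma smooth_on_frechet_derivative:
  "smooth_on U f \<Longrightarrow> smooth_on U (\<lambda>x. frechet_derivative f (at x) v)"
  unfolding smooth_on_def using Ck_on_SucD(2) by blast

lemma smooth_on_continuous_on: "smooth_on U f \<Longrightarrow> continuous_on U f"
  unfolding smooth_on_def using Ck_on.simps(1) by blast

lemma linear_frechet_derivative_smooth_on:
  "smooth_on U f \<Longrightarrow> x \<in> U \<Longrightarrow> linear (frechet_derivative f (at x))"
  using smooth_on_has_derivative has_derivative_linear by blast

lemma smooth_on_euclidean:
  fixes f :: "_ \<Rightarrow> 'b::euclidean_space"
  assumes "open U" "\<And>b. b \<in> Basis \<Longrightarrow> smooth_on U (\<lambda>x. f x \<bullet> b)"
  shows "smooth_on U f"
proof -
  have "smooth_on U (\<lambda>x. \<Sum>b\<in>Basis. (f x \<bullet> b) *\<^sub>R b)"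
    by (intro smooth_on_sum smooth_on_scaleR assms) auto
  then show ?thesis by (simp add: euclidean_representation)
qed

section \<open>Symmetry of second derivatives\<close>

text \<open>The second difference is the increment over \<open>[0, t]\<close> of the function \<phi>
  of one variable. The mean value theorem is applied to \<phi>, which moves in direction
  \<open>u\<close>, and then to the resulting first derivative along \<open>v\<close>.\<close>

lemma mvt_second_difference:
  fixes f :: "'a::real_normed_vector \<Rightarrow> real"
  assumes C: "Ck_on 2 f (ball x r)" and t: "0 < t" "t * (norm u + norm v) < r"
  obtains \<xi> where "norm (\<xi> - x) \<le> t * (norm u + norm v)"
    "f (x + t *\<^sub>R u + t *\<^sub>R v) - f (x + t *\<^sub>R u) - f (x + t *\<^sub>R v) + f x =
      t\<^sup>2 * frechet_derivative (\<lambda>y. frechet_derivative f (at y) u) (at \<xi>) v"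
proof -
  let ?D = "\<lambda>y. frechet_derivative f (at y)"
  let ?D2 = "\<lambda>y. frechet_derivative (\<lambda>y. frechet_derivative f (at y) u) (at y)"
  have C': "Ck_on (Suc (Suc 0)) f (ball x r)" using C by (simp add: numeral_2_eq_2)
  have D: "(f has_derivative ?D y) (at y)" if "norm (y - x) < r" for y
    using Ck_on_SucD(1)[OF C'] that by (auto simp: dist_norm norm_minus_commute)
  have D2: "((\<lambda>y. ?D y u) has_derivative ?D2 y) (at y)" if "norm (y - x) < r" for y
    using Ck_on_SucD(1)[OF Ck_on_SucD(2)[OF C', of u]] that by (auto simp: dist_norm norm_minus_commute)
  \<comment> \<open>Keeps the whole parallelogram spanned by \<open>t u\<close> and
    \<open>t v\<close> at \<open>x\<close> inside the ball on which \<open>f\<close> is twice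
    differentiable.\<close>
  have nb: "norm (a *\<^sub>R u + b *\<^sub>R v) \<le> t * (norm u + norm v)" if "0 \<le> a" "a \<le> t" "0 \<le> b" "b \<le> t" for a b
  proof -
    have "norm (a *\<^sub>R u + b *\<^sub>R v) \<le> a * norm u + b * norm v"
      using norm_triangle_ineq[of "a *\<^sub>R u" "b *\<^sub>R v"] that by simp
    also have "\<dots> \<le> t * norm u + t * norm v"
      using that by (intro add_mono mult_right_mono) auto
    finally show ?thesis by (simp add: algebra_simps)
  qed
  define \<phi> where "\<phi> \<equiv> \<lambda>a. f (x + a *\<^sub>R u + t *\<^sub>R v) - f (x + a *\<^sub>R u)"
  have lin: "linear (?D y)" if "norm (y - x) < r" for y
    using D[OF that] has_derivative_linear by blast
  have \<phi>: "(\<phi> has_real_derivative (?D (x + a *\<^sub>R u + t *\<^sub>R v) u - ?D (x + a *\<^sub>R u) u)) (at a)"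
    if a: "0 \<le> a" "a \<le> t" for a
  proof -
    have n1: "norm ((x + a *\<^sub>R u + t *\<^sub>R v) - x) < r" and n2: "norm ((x + a *\<^sub>R u) - x) < r"
      using nb[of a t] nb[of a 0] a t by (auto simp: algebra_simps)
    have "(\<phi> has_derivative (\<lambda>h. ?D (x + a *\<^sub>R u + t *\<^sub>R v) (h *\<^sub>R u) - ?D (x + a *\<^sub>R u) (h *\<^sub>R u))) (at a)"
      unfolding \<phi>_def
      by (intro has_derivative_diff has_derivative_compose[where g = f and f = "\<lambda>a. x + a *\<^sub>R u + t *\<^sub>R v", OF _ D[OF n1]]
          has_derivative_compose[where g = f and f = "\<lambda>a. x + a *\<^sub>R u", OF _ D[OF n2]])
        (auto intro!: derivative_eq_intros)
    then show ?thesis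
      unfolding has_field_derivative_def
      by (rule has_derivative_eq_rhs)
        (simp add: fun_eq_iff linear_cmul[OF lin[OF n1]] linear_cmul[OF lin[OF n2]] left_diff_distrib)
  qed
  obtain a where a: "0 < a" "a < t" and
    e1: "\<phi> t - \<phi> 0 = (t - 0) * (?D (x + a *\<^sub>R u + t *\<^sub>R v) u - ?D (x + a *\<^sub>R u) u)"
    using MVT2[of 0 t \<phi> "\<lambda>a. ?D (x + a *\<^sub>R u + t *\<^sub>R v) u - ?D (x + a *\<^sub>R u) u"] t \<phi> by auto
  have \<psi>: "((\<lambda>b. ?D (x + a *\<^sub>R u + b *\<^sub>R v) u) has_real_derivative (?D2 (x + a *\<^sub>R u + b *\<^sub>R v) v)) (at b)"
    if b: "0 \<le> b" "b \<le> t" for b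
  proof -
    have n1: "norm ((x + a *\<^sub>R u + b *\<^sub>R v) - x) < r"
      using nb[of a b] a b t by (auto simp: algebra_simps)
    have l: "linear (?D2 (x + a *\<^sub>R u + b *\<^sub>R v))"
      using D2[OF n1] has_derivative_linear by blast
    have "((\<lambda>b. ?D (x + a *\<^sub>R u + b *\<^sub>R v) u) has_derivative (\<lambda>h. ?D2 (x + a *\<^sub>R u + b *\<^sub>R v) (h *\<^sub>R v))) (at b)"
      by (intro has_derivative_compose[where g = "\<lambda>y. ?D y u" and f = "\<lambda>b. x + a *\<^sub>R u + b *\<^sub>R v", OF _ D2[OF n1]])
        (auto intro!: derivative_eq_intros)
    then show ?thesis
      unfolding has_field_derivative_def
      by (rule has_derivative_eq_rhs) (simp add: fun_eq_iff linear_cmul[OF l] mult.commute)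
  qed
  obtain b where b: "0 < b" "b < t" and
    e2: "?D (x + a *\<^sub>R u + t *\<^sub>R v) u - ?D (x + a *\<^sub>R u + 0 *\<^sub>R v) u = (t - 0) * ?D2 (x + a *\<^sub>R u + b *\<^sub>R v) v"
    using MVT2[of 0 t "\<lambda>b. ?D (x + a *\<^sub>R u + b *\<^sub>R v) u" "\<lambda>b. ?D2 (x + a *\<^sub>R u + b *\<^sub>R v) v"] t \<psi> by auto
  show thesis
  proof (rule that[of "x + a *\<^sub>R u + b *\<^sub>R v"])
    show "norm (x + a *\<^sub>R u + b *\<^sub>R v - x) \<le> t * (norm u + norm v)"
      using nb[of a b] a b by (simp add: algebra_simps)
    show "f (x + t *\<^sub>R u + t *\<^sub>R v) - f (x + t *\<^sub>R u) - f (x + t *\<^sub>R v) + f x = t\<^sup>2 * ?D2 (x + a *\<^sub>R u + b *\<^sub>R v) v"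
      using e1 e2 by (simp add: \<phi>_def power2_eq_square algebra_simps)
  qed
qed

lemma second_difference_tendsto:
  fixes f :: "'a::real_normed_vector \<Rightarrow> real"
  assumes "open U" "x \<in> U" "Ck_on 2 f U"
  shows "((\<lambda>t. (f (x + t *\<^sub>R u + t *\<^sub>R v) - f (x + t *\<^sub>R u) - f (x + t *\<^sub>R v) + f x) / t\<^sup>2) \<longlongrightarrow>
    frechet_derivative (\<lambda>y. frechet_derivative f (at y) u) (at x) v) (at_right 0)"
    (is "(?Q \<longlongrightarrow> ?L x) _")
proof (rule tendstoI)
  fix e :: real assume e: "e > 0"
  have C': "Ck_on (Suc (Suc 0)) f U" using assms(3) by (simp add: numeral_2_eq_2)
  have "continuous_on U ?L"
    using Ck_on_SucD(2)[OF Ck_on_SucD(2)[OF C', of u], of v] by simp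
  then have "isCont ?L x"
    using continuous_on_eq_continuous_at[OF assms(1)] assms(2) by auto
  then obtain d where d: "d > 0" "\<And>y. dist y x < d \<Longrightarrow> dist (?L y) (?L x) < e"
    using e unfolding continuous_at_eps_delta by auto
  obtain r where r: "r > 0" "ball x r \<subseteq> U" using assms(1,2) openE by blast
  \<comment> \<open>The summand 1 keeps \<open>k\<close> positive when \<open>u\<close> and
    \<open>v\<close> both vanish.\<close>
  define k where "k = norm u + norm v + 1"
  have k: "k > 0" by (simp add: k_def add_nonneg_pos)
  show "\<forall>\<^sub>F t in at_right 0. dist (?Q t) (?L x) < e"
    unfolding eventually_at_right_field
  proof (intro exI conjI allI impI)
    show "0 < min d r / k" using d r k by simp
  next
    fix t :: real assume t: "0 < t" "t < min d r / k"
    have tk: "t * k < min d r" using t k by (simp add: pos_less_divide_eq)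
    have tn: "t * (norm u + norm v) < min d r"
      using tk t by (simp add: k_def algebra_simps)
    obtain \<xi> where \<xi>: "norm (\<xi> - x) \<le> t * (norm u + norm v)"
      "f (x + t *\<^sub>R u + t *\<^sub>R v) - f (x + t *\<^sub>R u) - f (x + t *\<^sub>R v) + f x = t\<^sup>2 * ?L \<xi>"
      using mvt_second_difference[OF Ck_on_subset[OF assms(3) r(2)] t(1), of u v] tn by auto
    have "?Q t = ?L \<xi>" using \<xi>(2) t by simp
    moreover have "dist \<xi> x < d" using \<xi>(1) tn by (simp add: dist_norm)
    ultimately show "dist (?Q t) (?L x) < e" using d(2) by simp
  qed
qed

text \<open>Both iterated derivatives are limits of one and the same quotient, which is unchanged
  when \<open>u\<close> and \<open>v\<close> are exchanged.\<close>

lemma second_derivative_commute_real: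
  fixes f :: "'a::real_normed_vector \<Rightarrow> real"
  assumes "open U" "x \<in> U" "Ck_on 2 f U"
  shows "frechet_derivative (\<lambda>y. frechet_derivative f (at y) u) (at x) v =
    frechet_derivative (\<lambda>y. frechet_derivative f (at y) v) (at x) u"
proof -
  have "(\<lambda>t. (f (x + t *\<^sub>R u + t *\<^sub>R v) - f (x + t *\<^sub>R u) - f (x + t *\<^sub>R v) + f x) / t\<^sup>2) =
    (\<lambda>t. (f (x + t *\<^sub>R v + t *\<^sub>R u) - f (x + t *\<^sub>R v) - f (x + t *\<^sub>R u) + f x) / t\<^sup>2)"
    by (intro ext) (simp add: add.assoc add.commute[of "_ *\<^sub>R u"])
  with second_difference_tendsto[OF assms, of v u]
  show ?thesis
    by (intro tendsto_unique[OF _ second_difference_tendsto[OF assms, of u v]]) auto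
qed

lemma second_derivative_commute:
  fixes f :: "'a::real_normed_vector \<Rightarrow> 'b::euclidean_space"
  assumes "open U" "x \<in> U" "smooth_on U f"
  shows "frechet_derivative (\<lambda>y. frechet_derivative f (at y) u) (at x) v =
    frechet_derivative (\<lambda>y. frechet_derivative f (at y) v) (at x) u"
proof (rule euclidean_eqI)
  fix b :: 'b assume "b \<in> Basis"
  let ?g = "\<lambda>x. f x \<bullet> b"
  have g: "Ck_on 2 ?g U" using smooth_on_inner_left[OF assms(1,3)] by (simp add: smooth_on_def)
  have 1: "frechet_derivative ?g (at y) w = frechet_derivative f (at y) w \<bullet> b" if "y \<in> U" for y w
    using frechet_derivative_at[OF has_derivative_inner_left[OF smooth_on_has_derivative[OF assms(3) that], of b]]
    by metis
  have 2: "frechet_derivative (\<lambda>y. frechet_derivative ?g (at y) w) (at x) w' =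
    frechet_derivative (\<lambda>y. frechet_derivative f (at y) w) (at x) w' \<bullet> b" for w w'
  proof -
    have "((\<lambda>y. frechet_derivative f (at y) w \<bullet> b) has_derivative
      (\<lambda>w'. frechet_derivative (\<lambda>y. frechet_derivative f (at y) w) (at x) w' \<bullet> b)) (at x)"
      using smooth_on_has_derivative[OF smooth_on_frechet_derivative[OF assms(3)] assms(2)]
        has_derivative_inner_left by blast
    then have "((\<lambda>y. frechet_derivative ?g (at y) w) has_derivative
      (\<lambda>w'. frechet_derivative (\<lambda>y. frechet_derivative f (at y) w) (at x) w' \<bullet> b)) (at x)"
      by (rule has_derivative_transform_within_open[OF _ assms(1,2)]) (simp add: 1)
    then show ?thesis using frechet_derivative_at by metis
  qed
  show "frechet_derivative (\<lambda>y. frechet_derivative f (at y) u) (at x) v \<bullet> b =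
    frechet_derivative (\<lambda>y. frechet_derivative f (at y) v) (at x) u \<bullet> b"
    using second_derivative_commute_real[OF assms(1,2) g, of u v] 2 by simp
qed

section \<open>Alternating forms and Gram determinants\<close>

lemma alternating_linear:
  "alternating k a \<Longrightarrow> length vs = k \<Longrightarrow> i < k \<Longrightarrow> linear (\<lambda>x. a (vs[i := x]))"
  by (simp add: alternating_def)

lemma alternating_eq_zero:
  "alternating k a \<Longrightarrow> length vs = k \<Longrightarrow> i < k \<Longrightarrow> j < k \<Longrightarrow> i \<noteq> j \<Longrightarrow> vs ! i = vs ! j \<Longrightarrow> a vs = 0"
  unfolding alternating_def by blast

text \<open>Polarisation: the value with \<open>x + y\<close> in both slots is zero, and so are two
  of the four terms of its expansion.\<close>

lemma alternating_swap:
  assumes a: "alternating k a" and l: "length vs = k" and ij: "i < k" "j < k" "i \<noteq> j"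
  shows "a (vs[i := x, j := y]) = - a (vs[i := y, j := x])"
proof -
  have Z: "a (vs[i := z, j := z]) = 0" for z
    by (rule alternating_eq_zero[OF a, of _ i j]) (use l ij in auto)
  have I: "a (vs[i := u + v, j := w]) = a (vs[i := u, j := w]) + a (vs[i := v, j := w])" for u v w
    using linear_add[OF alternating_linear[OF a, of "vs[j := w]" i], of u v] l ij
    by (simp add: list_update_swap)
  have J: "a (vs[i := w, j := u + v]) = a (vs[i := w, j := u]) + a (vs[i := w, j := v])" for u v w
    using linear_add[OF alternating_linear[OF a, of "vs[i := w]" j], of u v] l ij by simp
  have "a (vs[i := x + y, j := x + y]) = (a (vs[i := x, j := x]) + a (vs[i := x, j := y])) +
      (a (vs[i := y, j := x]) + a (vs[i := y, j := y]))"
    by (simp only: I J)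
  then show ?thesis by (simp add: Z)
qed

lemma permute_list_transpose:
  assumes "i < length vs" "j < length vs"
  shows "permute_list (Transposition.transpose i j) vs = vs[i := vs ! j, j := vs ! i]"
  using assms by (intro nth_equalityI) (auto simp: permute_list_def nth_list_update Transposition.transpose_def)

lemma alternating_permute:
  assumes "alternating k a" "length vs = k" "\<sigma> permutes {..<k}"
  shows "a (permute_list \<sigma> vs) = of_int (sign \<sigma>) * a vs"
  using assms(3) finite_lessThan assms(2)
proof (induction arbitrary: vs rule: permutes_induct)
  case id
  then show ?case by simp
next
  case (swap i j p)
  let ?t = "Transposition.transpose i j"
  have t: "?t permutes {..<k}" using swap by (intro permutes_swap_id) auto
  have "permutation ?t" "permutation p" using swap t permutation_permutes by blast+
  then have s: "sign (?t \<circ> p) = - sign p"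
    using swap by (simp add: sign_compose sign_swap_id)
  have "a (permute_list (?t \<circ> p) vs) = a (permute_list p (permute_list ?t vs))"
    using swap by (simp add: permute_list_compose)
  also have "\<dots> = of_int (sign p) * a (vs[i := vs ! j, j := vs ! i])"
    using swap by (simp add: permute_list_transpose)
  also have "a (vs[i := vs ! j, j := vs ! i]) = - a vs"
    using alternating_swap[OF assms(1), of vs i j "vs ! j" "vs ! i"] swap by simp
  finally show ?case unfolding s by simp
qed

text \<open>Bringing slot \<open>i\<close> to the front takes \<open>i\<close> adjacent swaps. The
  sign is the one in \<open>ext_deriv\<close>, so that the two cancel in the computation of the
  divergence.\<close>

lemma alternating_move:
  assumes "alternating k a" "length vs = k" "i < k"
  shows "a (w # take i vs @ drop (Suc i) vs) = (- 1) ^ i * a (vs[i := w])"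
  using assms(2,3)
proof (induction i arbitrary: vs)
  case 0
  then show ?case by (cases vs) auto
next
  case (Suc i)
  let ?us = "vs[Suc i := vs ! i]"
  have "take i ?us @ drop (Suc i) ?us = take (Suc i) vs @ drop (Suc (Suc i)) vs"
    using Suc.prems
    by (simp add: take_Suc_conv_app_nth drop_update_swap Cons_nth_drop_Suc[symmetric])
  then have "a (w # take (Suc i) vs @ drop (Suc (Suc i)) vs) = (- 1) ^ i * a (vs[Suc i := vs ! i, i := w])"
    using Suc.IH[of ?us] Suc.prems by simp
  also have "a (vs[Suc i := vs ! i, i := w]) = - a (vs[Suc i := w, i := vs ! i])"
    using alternating_swap[OF assms(1)] Suc.prems by (metis Suc_lessD n_not_Suc_n)
  also have "vs[Suc i := w, i := vs ! i] = vs[Suc i := w]"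
    by (metis list_update_id n_not_Suc_n list_update_swap)
  finally show ?case by simp
qed

lemma alternating_cong:
  assumes "\<And>vs. length vs = k \<Longrightarrow> a vs = b vs"
  shows "alternating k a \<longleftrightarrow> alternating k b"
  using assms by (auto simp: alternating_def cong: conj_cong)

lemma alternating_lincomb:
  assumes "alternating k a" "alternating k b"
  shows "alternating k (\<lambda>vs. r * a vs + s * b vs)"
  unfolding alternating_def
proof (intro allI impI conjI)
  fix vs :: "'a list" and i assume l: "length vs = k" "i < k"
  show "linear (\<lambda>x. r * a (vs[i := x]) + s * b (vs[i := x]))"
    using alternating_linear[OF assms(1) l] alternating_linear[OF assms(2) l]
    by (auto simp: linear_iff algebra_simps)
next
  fix vs :: "'a list" and i j assume "length vs = k" "i < k" "j < k" "i \<noteq> j \<and> vs ! i = vs ! j"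
  then show "r * a vs + s * b vs = 0"
    using alternating_eq_zero[OF assms(1)] alternating_eq_zero[OF assms(2)]
    by (metis add.right_neutral mult_zero_right)
qed

lemma alternating_scale: "alternating k a \<Longrightarrow> alternating k (\<lambda>vs. r * a vs)"
  using alternating_lincomb[of k a a r 0] by simp

lemma alternating_map:
  assumes "linear L" "alternating k a"
  shows "alternating k (\<lambda>vs. a (map L vs))"
  unfolding alternating_def
proof (intro allI impI conjI)
  fix vs :: "'a list" and i assume l: "length vs = k" "i < k"
  have "linear (\<lambda>y. a ((map L vs)[i := y]))"
    using alternating_linear[OF assms(2)] l by simp
  then have "linear ((\<lambda>y. a ((map L vs)[i := y])) \<circ> L)"
    using assms(1) linear_compose by blast
  then show "linear (\<lambda>x. a (map L (vs[i := x])))"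
    by (simp add: o_def map_update)
next
  fix vs :: "'a list" and i j assume "length vs = k" "i < k" "j < k" "i \<noteq> j \<and> vs ! i = vs ! j"
  then show "a (map L vs) = 0"
    by (intro alternating_eq_zero[OF assms(2), of _ i j]) auto
qed

lemma permute_list_update:
  assumes "\<sigma> permutes {..<length vs}" "i < length vs"
  shows "permute_list \<sigma> (vs[i := x]) = (permute_list \<sigma> vs)[inv \<sigma> i := x]"
proof (intro nth_equalityI)
  fix j assume j: "j < length (permute_list \<sigma> (vs[i := x]))"
  then have "\<sigma> j < length vs" using permutes_in_image[OF assms(1)] by auto
  moreover have "\<sigma> j = i \<longleftrightarrow> j = inv \<sigma> i" using permutes_inv_eq[OF assms(1)] by metis
  ultimately show "permute_list \<sigma> (vs[i := x]) ! j = (permute_list \<sigma> vs)[inv \<sigma> i := x] ! j"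
    using j assms by (auto simp: permute_list_nth nth_list_update)
qed simp

text \<open>Composing with the transposition of two equal entries permutes the summands and reverses
  their signs, so the sum is its own negative. Serves both Gram determinants and wedge
  products.\<close>

lemma alternating_antisymmetrization:
  fixes c :: "'a::real_vector list \<Rightarrow> real"
  assumes lin: "\<And>vs i. length vs = k \<Longrightarrow> i < k \<Longrightarrow> linear (\<lambda>x. c (vs[i := x]))"
  shows "alternating k (\<lambda>vs. \<Sum>\<sigma> | \<sigma> permutes {..<length vs}. of_int (sign \<sigma>) * c (permute_list \<sigma> vs))"
  unfolding alternating_def
proof (intro allI impI conjI)
  fix vs :: "'a list" and i assume l: "length vs = k" "i < k"
  have "linear (\<lambda>x. of_int (sign \<sigma>) * c (permute_list \<sigma> (vs[i := x])))"
    if s: "\<sigma> permutes {..<k}" for \<sigma>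
  proof -
    have "inv \<sigma> i < k" using permutes_in_image[OF permutes_inv[OF s]] l by auto
    then have "linear (\<lambda>x. c ((permute_list \<sigma> vs)[inv \<sigma> i := x]))"
      using lin l by simp
    then show ?thesis using s l by (simp add: permute_list_update linear_iff algebra_simps)
  qed
  then show "linear (\<lambda>x. \<Sum>\<sigma> | \<sigma> permutes {..<length (vs[i := x])}.
      of_int (sign \<sigma>) * c (permute_list \<sigma> (vs[i := x])))"
    using l by (auto intro!: linear_compose_sum)
next
  fix vs :: "'a list" and i j
  assume l: "length vs = k" "i < k" "j < k" and ij: "i \<noteq> j \<and> vs ! i = vs ! j"
  let ?t = "Transposition.transpose i j"
  let ?f = "\<lambda>\<sigma>. of_int (sign \<sigma>) * c (permute_list \<sigma> vs) :: real"
  have t: "?t permutes {..<k}" using l by (intro permutes_swap_id) auto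
  have "sum ?f {\<sigma>. \<sigma> permutes {..<k}} = sum (\<lambda>\<sigma>. ?f (?t \<circ> \<sigma>)) {\<sigma>. \<sigma> permutes {..<k}}"
    by (rule setum_permutations_compose_left[OF t])
  also have "\<dots> = sum (\<lambda>\<sigma>. - ?f \<sigma>) {\<sigma>. \<sigma> permutes {..<k}}"
  proof (rule sum.cong)
    fix \<sigma> assume "\<sigma> \<in> {\<sigma>. \<sigma> permutes {..<k}}"
    then have s: "\<sigma> permutes {..<k}" by simp
    have "permutation ?t" "permutation \<sigma>" using s t permutation_permutes by blast+
    then have "sign (?t \<circ> \<sigma>) = - sign \<sigma>" using ij by (simp add: sign_compose sign_swap_id)
    moreover have "permute_list (?t \<circ> \<sigma>) vs = permute_list \<sigma> vs"
      using s l ij by (simp add: permute_list_compose permute_list_transpose) (metis list_update_id)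
    ultimately show "?f (?t \<circ> \<sigma>) = - ?f \<sigma>" by simp
  qed simp
  finally show "(\<Sum>\<sigma> | \<sigma> permutes {..<length vs}. ?f \<sigma>) = 0"
    using l by (simp add: sum_negf)
qed

text \<open>By linearity the entries can be replaced one at a time by members of \<open>bs\<close>.
  A list with all entries in \<open>bs\<close> either repeats an entry or is a permutation of
  \<open>bs\<close>, and the form vanishes on both.\<close>

lemma alternating_basis_zero:
  fixes bs :: "'a::euclidean_space list"
  assumes a: "alternating m a" and bs: "length bs = m" "span (set bs) = UNIV"
    and z: "a bs = 0" and vs: "length vs = m"
  shows "a vs = 0"
proof -
  \<comment> \<open>\<open>j\<close> counts the leading entries that may still be arbitrary; all
    later ones lie in \<open>bs\<close>.\<close>
  have "\<forall>vs. length vs = m \<longrightarrow> (\<forall>i. j \<le> i \<and> i < m \<longrightarrow> vs ! i \<in> set bs) \<longrightarrow> a vs = 0" if "j \<le> m" for j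
    using that
  proof (induction j)
    case 0
    show ?case
    proof (intro allI impI)
      fix vs :: "'a list" assume l: "length vs = m" and "\<forall>i. 0 \<le> i \<and> i < m \<longrightarrow> vs ! i \<in> set bs"
      then have sub: "set vs \<subseteq> set bs" by (auto simp: in_set_conv_nth)
      show "a vs = 0"
      proof (cases "distinct vs")
        case True
        have c: "card (set vs) = m" using True l distinct_card by blast
        have "card (set bs) \<le> m" using bs card_length by blast
        then have "set vs = set bs" using sub c by (metis card_seteq finite_set)
        moreover have "distinct bs" using c calculation bs by (simp add: card_distinct)
        ultimately have "mset vs = mset bs" using True set_eq_iff_mset_eq_distinct by blast
        then obtain \<sigma> where "\<sigma> permutes {..<length bs}" "permute_list \<sigma> bs = vs"
          by (rule mset_eq_permutation)
        then show ?thesis using alternating_permute[OF a, of bs \<sigma>] bs z by auto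
      next
        case False
        then show ?thesis using l alternating_eq_zero[OF a] by (metis distinct_conv_nth)
      qed
    qed
  next
    case (Suc j)
    show ?case
    proof (intro allI impI)
      fix vs :: "'a list" assume l: "length vs = m" and v: "\<forall>i. Suc j \<le> i \<and> i < m \<longrightarrow> vs ! i \<in> set bs"
      have "a (vs[j := x]) = 0" if "x \<in> set bs" for x
      proof -
        have "\<forall>i. j \<le> i \<and> i < m \<longrightarrow> vs[j := x] ! i \<in> set bs"
          using that v l by (auto simp: nth_list_update)
        then show ?thesis using Suc l by simp
      qed
      then have "a (vs[j := vs ! j]) = 0"
        using linear_eq_0_on_span[OF alternating_linear[OF a l, of j], of "set bs" "vs ! j"] Suc.prems bs by auto
      then show "a vs = 0" by simp
    qed
  qed
  from this[of m] vs show ?thesis by auto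
qed

text \<open>The combination of \<open>a\<close> and \<open>b\<close> that vanishes on
  \<open>bs\<close> vanishes everywhere, so the two forms are proportional.\<close>

lemma alternating_unique:
  fixes bs :: "'a::euclidean_space list"
  assumes "alternating m a" "alternating m b" "length bs = m" "span (set bs) = UNIV" "length vs = m"
  shows "a vs * b bs = b vs * a bs"
  using alternating_basis_zero[OF alternating_lincomb[OF assms(1,2), of "b bs" "- a bs"] assms(3,4) _ assms(5)]
  by (simp add: mult.commute)

text \<open>Forms take lists of vectors, so \<open>Basis\<close> has to be put in some
  order.\<close>

definition basis_list :: "'a::euclidean_space list" where
  "basis_list = (SOME bs. set bs = Basis \<and> distinct bs)"

lemma basis_list: "set (basis_list :: 'a::euclidean_space list) = Basis" "distinct (basis_list :: 'a list)"
  using someI_ex[OF finite_distinct_list[OF finite_Basis[where 'a = 'a]]] by (auto simp: basis_list_def)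

lemma length_basis_list [simp]: "length (basis_list :: 'a::euclidean_space list) = DIM('a)"
  using distinct_card[OF basis_list(2)] basis_list(1) by metis

lemma span_basis_list: "span (set (basis_list :: 'a::euclidean_space list)) = UNIV"
  by (simp add: basis_list)

lemma basis_list_nth_in: "i < DIM('a) \<Longrightarrow> (basis_list :: 'a::euclidean_space list) ! i \<in> Basis"
  using basis_list(1) length_basis_list nth_mem by metis

lemma inner_basis_list:
  "i < DIM('a) \<Longrightarrow> j < DIM('a) \<Longrightarrow>
    (basis_list :: 'a::euclidean_space list) ! i \<bullet> basis_list ! j = (if i = j then 1 else 0)"
  using basis_list(2)[where 'a = 'a] by (auto simp: inner_Basis basis_list_nth_in nth_eq_iff_index_eq)

lemma sum_Basis_list:
  fixes f :: "'a::euclidean_space \<Rightarrow> 'b::comm_monoid_add"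
  shows "(\<Sum>b\<in>Basis. f b) = (\<Sum>i<DIM('a). f (basis_list ! i))"
proof -
  have "sum f (set basis_list) = (\<Sum>i<length (basis_list :: 'a list). f (basis_list ! i))"
    using basis_list(2)[where 'a='a] by (simp add: sum.distinct_set_conv_list sum_list_sum_nth atLeast0LessThan)
  then show ?thesis by (simp add: basis_list)
qed

section \<open>Gram determinants\<close>

text \<open>The determinant of the matrix \<open>h (us ! i) (vs ! j)\<close>. Separate lists for
  rows and columns, possibly of different types, make it alternating in each list and allow a single
  row to be altered in Cramer's rule.\<close>

definition gram :: "('a \<Rightarrow> 'b \<Rightarrow> real) \<Rightarrow> 'a list \<Rightarrow> 'b list \<Rightarrow> real" where
  "gram h us vs = (\<Sum>\<sigma> | \<sigma> permutes {..<length vs}. of_int (sign \<sigma>) *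
     (\<Prod>i<length vs. h (us ! i) (vs ! \<sigma> i)))"

lemma gram_det_eq: "gram_det h vs = gram h vs vs"
  by (simp add: gram_def gram_det_def)

lemma alternating_gram_right:
  fixes h :: "'a \<Rightarrow> 'b::real_vector \<Rightarrow> real"
  assumes "\<And>u. linear (h u)"
  shows "alternating k (gram h us)"
proof -
  have l: "linear (\<lambda>x. \<Prod>j<k. h (us ! j) (vs[i := x] ! j))" if "length vs = k" "i < k" for vs :: "'b list" and i
  proof -
    have "(\<lambda>x. \<Prod>j<k. h (us ! j) (vs[i := x] ! j)) =
        (\<lambda>x. (\<Prod>j\<in>{..<k} - {i}. h (us ! j) (vs ! j)) * h (us ! i) x)"
    proof
      fix x
      have "(\<Prod>j<k. h (us ! j) (vs[i := x] ! j)) =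
          h (us ! i) (vs[i := x] ! i) * (\<Prod>j\<in>{..<k} - {i}. h (us ! j) (vs[i := x] ! j))"
        using that by (intro prod.remove) auto
      also have "\<dots> = h (us ! i) x * (\<Prod>j\<in>{..<k} - {i}. h (us ! j) (vs ! j))"
        using that by (intro arg_cong2[where f = "(*)"] prod.cong) auto
      finally show "(\<Prod>j<k. h (us ! j) (vs[i := x] ! j)) = (\<Prod>j\<in>{..<k} - {i}. h (us ! j) (vs ! j)) * h (us ! i) x"
        by (simp add: mult.commute)
    qed
    then show ?thesis using assms[of "us ! i"] by (auto simp: linear_iff algebra_simps)
  qed
  have "alternating k (\<lambda>vs. \<Sum>\<sigma> | \<sigma> permutes {..<length vs}. of_int (sign \<sigma>) *
     (\<Prod>j<k. h (us ! j) (permute_list \<sigma> vs ! j)))"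
    by (rule alternating_antisymmetrization) (rule l)
  then show ?thesis
    by (rule alternating_cong[THEN iffD1, rotated])
      (auto simp: gram_def permute_list_nth intro!: sum.cong prod.cong)
qed

text \<open>The determinant of the transposed matrix: the sum is reindexed by inverse
  permutations.\<close>

lemma gram_transpose:
  assumes "length us = length vs"
  shows "gram h us vs = gram (\<lambda>x y. h y x) vs us"
proof -
  let ?k = "length vs"
  have "gram h us vs = (\<Sum>\<sigma> | \<sigma> permutes {..<?k}. of_int (sign (inv \<sigma>)) * (\<Prod>i<?k. h (us ! i) (vs ! inv \<sigma> i)))"
    unfolding gram_def by (rule sum_permutations_inverse)
  also have "\<dots> = (\<Sum>\<sigma> | \<sigma> permutes {..<?k}. of_int (sign \<sigma>) * (\<Prod>i<?k. h (us ! \<sigma> i) (vs ! i)))"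
  proof (rule sum.cong)
    fix \<sigma> assume "\<sigma> \<in> {\<sigma>. \<sigma> permutes {..<?k}}"
    then have s: "\<sigma> permutes {..<?k}" by simp
    have "sign (inv \<sigma>) = sign \<sigma>" using s permutation_permutes sign_inverse by blast
    moreover have "(\<Prod>i<?k. h (us ! i) (vs ! inv \<sigma> i)) = (\<Prod>i<?k. h (us ! \<sigma> i) (vs ! i))"
      using prod.permute[OF s, of "\<lambda>i. h (us ! i) (vs ! inv \<sigma> i)"] permutes_inverses(2)[OF s]
      by (simp add: o_def)
    ultimately show "of_int (sign (inv \<sigma>)) * (\<Prod>i<?k. h (us ! i) (vs ! inv \<sigma> i)) =
      of_int (sign \<sigma>) * (\<Prod>i<?k. h (us ! \<sigma> i) (vs ! i))" by simp
  qed simp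
  finally show ?thesis using assms by (simp add: gram_def)
qed

lemma alternating_gram_left:
  fixes h :: "'a::real_vector \<Rightarrow> 'b \<Rightarrow> real"
  assumes "\<And>v. linear (\<lambda>u. h u v)" "length vs = k"
  shows "alternating k (\<lambda>us. gram h us vs)"
proof -
  have "gram (\<lambda>x y. h y x) vs us = gram h us vs" if "length us = k" for us
    using gram_transpose[of us vs h] that assms(2) by simp
  from alternating_cong[of k "gram (\<lambda>x y. h y x) vs" "\<lambda>us. gram h us vs", OF this]
  show ?thesis
    using alternating_gram_right[of "\<lambda>x y. h y x" k vs, OF assms(1)] by simp
qed

lemma gram_delta:
  assumes "length us = length vs"
    "\<And>i j. i < length vs \<Longrightarrow> j < length vs \<Longrightarrow> h (us ! i) (vs ! j) = (if i = j then 1 else 0)"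
  shows "gram h us vs = 1"
proof -
  let ?k = "length vs"
  have "(\<Sum>\<sigma> | \<sigma> permutes {..<?k}. of_int (sign \<sigma>) * (\<Prod>i<?k. h (us ! i) (vs ! \<sigma> i))) =
      (\<Sum>\<sigma> \<in> {id}. of_int (sign \<sigma>) * (\<Prod>i<?k. h (us ! i) (vs ! \<sigma> i)))"
  proof (rule sum.mono_neutral_right)
    show "\<forall>\<sigma>\<in>{\<sigma>. \<sigma> permutes {..<?k}} - {id}. of_int (sign \<sigma>) * (\<Prod>i<?k. h (us ! i) (vs ! \<sigma> i)) = 0"
    proof
      fix \<sigma> assume s: "\<sigma> \<in> {\<sigma>. \<sigma> permutes {..<?k}} - {id}"
      then obtain i where i: "\<sigma> i \<noteq> i" by fastforce
      then have "i < ?k" using permutes_not_in[of \<sigma> "{..<?k}" i] s by auto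
      moreover have "\<sigma> i < ?k" using s calculation permutes_in_image[of \<sigma> "{..<?k}" i] by simp
      ultimately have "h (us ! i) (vs ! \<sigma> i) = 0" using assms(2) i by simp
      then show "of_int (sign \<sigma>) * (\<Prod>i<?k. h (us ! i) (vs ! \<sigma> i)) = 0"
        using \<open>i < ?k\<close> by (auto intro!: prod_zero)
    qed
  qed (auto simp: finite_permutations permutes_id)
  then show ?thesis using assms(2) by (simp add: gram_def)
qed

text \<open>The last row of the Gram matrix is zero off the diagonal, so only permutations fixing
  the last index contribute, and these are the permutations of the earlier indices.\<close>

lemma gram_det_snoc:
  assumes "\<And>w. w \<in> set ws \<Longrightarrow> h v w = 0"
  shows "gram_det h (ws @ [v]) = gram_det h ws * h v v"
proof -
  let ?k = "length ws" and ?vs = "ws @ [v]"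
  let ?f = "\<lambda>\<sigma>. of_int (sign \<sigma>) * (\<Prod>i<Suc ?k. h (?vs ! i) (?vs ! \<sigma> i))"
  have "gram_det h ?vs = sum ?f {\<sigma>. \<sigma> permutes {..<Suc ?k}}" by (simp add: gram_det_def)
  also have "\<dots> = sum ?f {\<sigma>. \<sigma> permutes {..<?k}}"
  proof (rule sum.mono_neutral_right)
    show "{\<sigma>. \<sigma> permutes {..<?k}} \<subseteq> {\<sigma>. \<sigma> permutes {..<Suc ?k}}"
      by (auto intro: permutes_subset)
    show "\<forall>\<sigma>\<in>{\<sigma>. \<sigma> permutes {..<Suc ?k}} - {\<sigma>. \<sigma> permutes {..<?k}}. ?f \<sigma> = 0"
    proof
      fix \<sigma> assume s: "\<sigma> \<in> {\<sigma>. \<sigma> permutes {..<Suc ?k}} - {\<sigma>. \<sigma> permutes {..<?k}}"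
      have "\<sigma> ?k \<noteq> ?k"
      proof
        assume k: "\<sigma> ?k = ?k"
        have "\<sigma> x = x" if "x \<in> {..<Suc ?k} - {..<?k}" for x
          using that k by (simp add: less_Suc_eq)
        then have "\<sigma> permutes {..<?k}"
          using s permutes_superset[of \<sigma> "{..<Suc ?k}" "{..<?k}"] by blast
        then show False using s by simp
      qed
      moreover have "\<sigma> ?k < Suc ?k" using s permutes_in_image[of \<sigma> "{..<Suc ?k}" ?k] by simp
      ultimately have "h (?vs ! ?k) (?vs ! \<sigma> ?k) = 0" using assms by (simp add: nth_append)
      then show "?f \<sigma> = 0" by (simp add: prod_zero)
    qed
  qed (simp add: finite_permutations)
  also have "\<dots> = (\<Sum>\<sigma> | \<sigma> permutes {..<?k}. of_int (sign \<sigma>) * (\<Prod>i<?k. h (ws ! i) (ws ! \<sigma> i)) * h v v)"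
  proof (rule sum.cong)
    fix \<sigma> assume s: "\<sigma> \<in> {\<sigma>. \<sigma> permutes {..<?k}}"
    then have "\<sigma> ?k = ?k" using permutes_not_in[of \<sigma> "{..<?k}" ?k] by simp
    moreover have "\<sigma> i < ?k" if "i < ?k" for i using s that permutes_in_image[of \<sigma> "{..<?k}" i] by simp
    ultimately show "?f \<sigma> = of_int (sign \<sigma>) * (\<Prod>i<?k. h (ws ! i) (ws ! \<sigma> i)) * h v v"
      by (simp add: nth_append)
  qed simp
  finally show ?thesis by (simp add: gram_det_def sum_distrib_right)
qed

text \<open>The determinant in the coordinates given by \<open>basis_list\<close>. It is the
  reference form of top degree: every other one is its multiple by the value on
  \<open>basis_list\<close>.\<close>

definition det_form :: "'a::euclidean_space list \<Rightarrow> real" where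
  "det_form vs = gram (\<bullet>) vs basis_list"

lemma alternating_det_form: "alternating DIM('a) (det_form :: 'a::euclidean_space list \<Rightarrow> real)"
  unfolding det_form_def by (rule alternating_gram_left) (auto simp: bounded_linear.linear bounded_linear_inner_left)

lemma det_form_basis [simp]: "det_form basis_list = 1"
  unfolding det_form_def by (rule gram_delta) (auto simp: inner_basis_list)

lemma alternating_eq_det_form:
  fixes vs :: "'a::euclidean_space list"
  assumes "alternating DIM('a) a" "length vs = DIM('a)"
  shows "a vs = det_form vs * a basis_list"
  using alternating_unique[OF assms(1) alternating_det_form length_basis_list span_basis_list assms(2)] by simp

text \<open>The product rule for determinants, obtained from the uniqueness of alternating forms in
  each of the two lists.\<close>

lemma gram_eq_det_form:
  fixes h :: "'a::euclidean_space \<Rightarrow> 'a \<Rightarrow> real"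
  assumes "\<And>u. linear (h u)" "\<And>v. linear (\<lambda>u. h u v)" "length us = DIM('a)" "length vs = DIM('a)"
  shows "gram h us vs = gram_det h basis_list * det_form us * det_form vs"
  using alternating_eq_det_form[OF alternating_gram_right[of h _ us, OF assms(1)] assms(4)]
    alternating_eq_det_form[OF alternating_gram_left[of h basis_list, OF assms(2)] assms(3)]
  by (simp add: gram_det_eq)

lemma gram_det_eq_det_form:
  fixes h :: "'a::euclidean_space \<Rightarrow> 'a \<Rightarrow> real"
  assumes "\<And>u. linear (h u)" "\<And>v. linear (\<lambda>u. h u v)" "length vs = DIM('a)"
  shows "gram_det h vs = gram_det h basis_list * (det_form vs)\<^sup>2"
  using gram_eq_det_form[OF assms(1,2,3,3)] by (simp add: gram_det_eq power2_eq_square)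

section \<open>Nondegenerate forms and Cramer's rule\<close>

text \<open>The values of \<open>h u\<close> on the basis depend linearly and injectively on
  \<open>u\<close>, hence surjectively. This is the source of the Reeb field, of the normal and of
  the gradients.\<close>

lemma nondegenerate_bij:
  fixes h :: "'a::euclidean_space \<Rightarrow> 'a \<Rightarrow> real"
  assumes "\<And>u. linear (h u)" "\<And>v. linear (\<lambda>u. h u v)" "\<And>u. (\<And>v. h u v = 0) \<Longrightarrow> u = 0"
    and l: "linear l"
  obtains u where "\<And>v. h u v = l v"
proof -
  let ?T = "\<lambda>u. \<Sum>b\<in>Basis. h u b *\<^sub>R b"
  have T: "linear ?T"
    using assms(2) by (auto simp: linear_iff algebra_simps sum.distrib scaleR_sum_right)
  have rep: "k v = (\<Sum>b\<in>Basis. (v \<bullet> b) * k b)" if "linear k" for k :: "'a \<Rightarrow> real" and v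
    using linear_sum[OF that, of "\<lambda>b. (v \<bullet> b) *\<^sub>R b" Basis] linear_cmul[OF that]
    by (simp add: euclidean_representation)
  have "inj ?T"
    unfolding linear_injective_0[OF T]
  proof (intro allI impI)
    fix u assume "?T u = 0"
    then have "h u b = 0" if "b \<in> Basis" for b
      using inner_sum_left_Basis[OF that, of "h u"] by (metis inner_zero_left)
    then have "h u v = 0" for v using rep[OF assms(1), of u v] by simp
    then show "u = 0" by (rule assms(3))
  qed
  then have "surj ?T" using linear_injective_imp_surjective[OF T] by simp
  then obtain u where u: "(\<Sum>b\<in>Basis. l b *\<^sub>R b) = ?T u" by (rule surjE)
  have "h u b = l b" if "b \<in> Basis" for b
    using inner_sum_left_Basis[OF that, of "h u"] inner_sum_left_Basis[OF that, of l] by (simp only: u)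
  then have "h u v = l v" for v using rep[OF assms(1), of u v] rep[OF l, of v] by simp
  then show ?thesis using that by blast
qed

text \<open>Pairing the dual vectors \<open>u i\<close> with the basis gives a Gram determinant
  equal to 1, and this is a multiple of the one in question.\<close>

lemma gram_det_nondegenerate:
  fixes h :: "'a::euclidean_space \<Rightarrow> 'a \<Rightarrow> real"
  assumes "\<And>u. linear (h u)" "\<And>v. linear (\<lambda>u. h u v)" "\<And>u. (\<And>v. h u v = 0) \<Longrightarrow> u = 0"
  shows "gram_det h basis_list \<noteq> 0"
proof -
  let ?b = "basis_list :: 'a list"
  have "\<exists>u. \<forall>v. h u v = v \<bullet> (?b ! i)" for i
    using nondegenerate_bij[OF assms, of "\<lambda>v. v \<bullet> (?b ! i)"]
    by (metis bounded_linear.linear bounded_linear_inner_left)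
  then obtain u where u: "\<And>i v. h (u i) v = v \<bullet> (?b ! i)" by metis
  let ?us = "map u [0..<DIM('a)]"
  have "gram h ?us ?b = 1" by (rule gram_delta) (auto simp: u inner_basis_list)
  then show ?thesis using gram_eq_det_form[OF assms(1,2), of ?us ?b] by auto
qed

lemma alternating_basis_update:
  fixes a :: "'a::euclidean_space list \<Rightarrow> real"
  assumes "alternating DIM('a) a" "i < DIM('a)"
  shows "a (basis_list[i := u]) = (u \<bullet> basis_list ! i) * a basis_list"
proof -
  let ?b = "basis_list :: 'a list"
  have l: "linear (\<lambda>x. a (?b[i := x]))" using alternating_linear[OF assms(1) _ assms(2)] by simp
  have "a (?b[i := u]) = a (?b[i := (\<Sum>j<DIM('a). (u \<bullet> ?b ! j) *\<^sub>R (?b ! j))])"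
    using euclidean_representation[of u] sum_Basis_list[of "\<lambda>b. (u \<bullet> b) *\<^sub>R b"] by simp
  also have "\<dots> = (\<Sum>j<DIM('a). (u \<bullet> ?b ! j) * a (?b[i := ?b ! j]))"
    by (subst linear_sum[OF l]) (simp only: linear_cmul[OF l] real_scaleR_def)
  also have "\<dots> = (\<Sum>j<DIM('a). if j = i then (u \<bullet> ?b ! i) * a ?b else 0)"
  proof (rule sum.cong)
    fix j assume j: "j \<in> {..<DIM('a)}"
    show "(u \<bullet> ?b ! j) * a (?b[i := ?b ! j]) = (if j = i then (u \<bullet> ?b ! i) * a ?b else 0)"
    proof (cases "j = i")
      case False
      then have "a (?b[i := ?b ! j]) = 0"
        using j assms(2) by (intro alternating_eq_zero[OF assms(1), of _ i j]) auto
      then show ?thesis using False by simp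
    qed simp
  qed simp
  finally show ?thesis using assms(2) by simp
qed

text \<open>Cramer's rule: putting the solution \<open>u\<close> in place of
  \<open>basis_list ! i\<close> turns row \<open>i\<close> into the values of \<open>l\<close>. To
  describe the altered matrix without mentioning \<open>u\<close>, the left arguments are row
  numbers and not vectors.\<close>

lemma gram_cramer:
  fixes h :: "'a::euclidean_space \<Rightarrow> 'a \<Rightarrow> real"
  assumes "\<And>v. linear (\<lambda>u. h u v)" "\<And>v. h u v = l v" "i < DIM('a)"
  shows "(u \<bullet> basis_list ! i) * gram_det h basis_list =
    gram (\<lambda>k v. if k = i then l v else h (basis_list ! k) v) [0..<DIM('a)] (basis_list :: 'a list)"
proof -
  have "(u \<bullet> basis_list ! i) * gram_det h basis_list = gram h (basis_list[i := u]) (basis_list :: 'a list)"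
    using alternating_basis_update[OF alternating_gram_left[of h basis_list, OF assms(1)] assms(3)] by (simp add: gram_det_eq)
  also have "\<dots> = gram (\<lambda>k v. if k = i then l v else h (basis_list ! k) v) [0..<DIM('a)] (basis_list :: 'a list)"
    unfolding gram_def by (intro sum.cong prod.cong arg_cong2[where f = "(*)"]) (auto simp: assms(2,3))
  finally show ?thesis .
qed

lemma gram_det_imp_nondegenerate:
  fixes h :: "'a::euclidean_space \<Rightarrow> 'a \<Rightarrow> real"
  assumes "\<And>v. linear (\<lambda>u. h u v)" "gram_det h basis_list \<noteq> 0" "\<And>v. h u v = 0"
  shows "u = 0"
proof -
  have "u \<bullet> basis_list ! i = 0" if i: "i < DIM('a)" for i
  proof -
    have "gram (\<lambda>k v. if k = i then 0 else h (basis_list ! k) v) [0..<DIM('a)] (basis_list :: 'a list) = 0"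
      unfolding gram_def using i by (intro sum.neutral) (auto intro!: prod_zero)
    then show ?thesis using gram_cramer[of h u "\<lambda>_. 0", OF assms(1,3) i] assms(2) by simp
  qed
  then show ?thesis
    by (metis euclidean_all_zero_iff basis_list(1) in_set_conv_nth length_basis_list)
qed

lemma smooth_on_gram:
  assumes "open U" "\<And>i j. i < length vs \<Longrightarrow> j < length vs \<Longrightarrow> smooth_on U (\<lambda>y. h y (us ! i) (vs ! j))"
  shows "smooth_on U (\<lambda>y. gram (h y) us vs)"
  unfolding gram_def
proof (intro smooth_on_sum smooth_on_mult smooth_on_prod smooth_on_const assms(1))
  fix \<sigma> i assume "\<sigma> \<in> {\<sigma>. \<sigma> permutes {..<length vs}}" "i \<in> {..<length vs}"
  then show "smooth_on U (\<lambda>y. h y (us ! i) (vs ! \<sigma> i))"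
    using assms(2) permutes_in_image[of \<sigma> "{..<length vs}" i] by simp
qed

text \<open>The coordinates of \<open>Z\<close> are quotients of determinants in the smooth
  coefficients. Turns pointwise solutions into smooth fields, both for the Reeb field and for the
  bordered system.\<close>

lemma smooth_on_linear_system:
  fixes h :: "'b::real_normed_vector \<Rightarrow> 'a::euclidean_space \<Rightarrow> 'a \<Rightarrow> real"
  assumes U: "open U"
    and lin: "\<And>y v. y \<in> U \<Longrightarrow> linear (\<lambda>u. h y u v)"
    and nz: "\<And>y. y \<in> U \<Longrightarrow> gram_det (h y) basis_list \<noteq> 0"
    and h: "\<And>u v. smooth_on U (\<lambda>y. h y u v)" and l: "\<And>v. smooth_on U (\<lambda>y. l y v)"
    and Z: "\<And>y v. y \<in> U \<Longrightarrow> h y (Z y) v = l y v"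
  shows "smooth_on U Z"
proof (rule smooth_on_euclidean[OF U])
  fix b :: 'a assume "b \<in> Basis"
  then obtain i where i: "i < DIM('a)" "b = basis_list ! i"
    by (metis basis_list(1) in_set_conv_nth length_basis_list)
  let ?n = "\<lambda>y. gram (\<lambda>k v. if k = i then l y v else h y (basis_list ! k) v) [0..<DIM('a)] (basis_list :: 'a list)"
  have 1: "smooth_on U ?n"
  proof (rule smooth_on_gram[OF U])
    fix j k assume "j < length (basis_list :: 'a list)" "k < length (basis_list :: 'a list)"
    show "smooth_on U (\<lambda>y. if [0..<DIM('a)] ! j = i then l y ((basis_list :: 'a list) ! k)
        else h y (basis_list ! ([0..<DIM('a)] ! j)) (basis_list ! k))"
      by (cases "[0..<DIM('a)] ! j = i") (auto simp: h l)
  qed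
  have 2: "smooth_on U (\<lambda>y. gram_det (h y) basis_list)"
    unfolding gram_det_eq by (rule smooth_on_gram[OF U]) (rule h)
  have "Z y \<bullet> b = ?n y / gram_det (h y) basis_list" if "y \<in> U" for y
    using gram_cramer[of "h y", OF lin[OF that] Z[OF that] i(1)] nz[OF that] i(2) by (simp add: field_simps)
  then show "smooth_on U (\<lambda>y. Z y \<bullet> b)"
    using smooth_on_divide[OF U 1 2 nz] by (subst smooth_on_cong[OF U]) auto
qed

section \<open>Derivatives of determinants, and wedge products as alternating forms\<close>

text \<open>The left-hand side is alternating in \<open>vs\<close>, hence a multiple of
  \<open>det_form\<close>, and on \<open>basis_list\<close> it is the trace. This is how a
  divergence emerges from an exterior derivative.\<close>

lemma alternating_trace:
  fixes L :: "'a::euclidean_space \<Rightarrow> 'a"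
  assumes L: "linear L" and vs: "length vs = DIM('a)"
  shows "(\<Sum>i<DIM('a). det_form (vs[i := L (vs ! i)])) = (\<Sum>b\<in>Basis. L b \<bullet> b) * det_form vs"
proof -
  let ?m = "DIM('a)"
  let ?c = "\<lambda>vs. \<Sum>i<?m. det_form (vs[i := L (vs ! i)])"
  note D = alternating_det_form[where 'a='a]
  have "alternating ?m ?c"
    unfolding alternating_def
  proof (intro allI impI conjI)
    fix vs :: "'a list" and j assume l: "length vs = ?m" "j < ?m"
    show "linear (\<lambda>x. \<Sum>i<?m. det_form ((vs[j := x])[i := L (vs[j := x] ! i)]))"
    proof (intro linear_compose_sum ballI)
      fix i assume "i \<in> {..<?m}"
      then have i: "i < ?m" by simp
      show "linear (\<lambda>x. det_form ((vs[j := x])[i := L (vs[j := x] ! i)]))"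
      proof (cases "i = j")
        case True
        have "linear ((\<lambda>x. det_form (vs[j := x])) \<circ> L)"
          using alternating_linear[OF D l] L linear_compose by blast
        then show ?thesis using True l by (simp add: o_def)
      next
        case False
        have "linear (\<lambda>x. det_form ((vs[i := L (vs ! i)])[j := x]))"
          using alternating_linear[OF D, of "vs[i := L (vs ! i)]" j] l by simp
        then show ?thesis using False by (simp add: list_update_swap)
      qed
    qed
  next
    fix vs :: "'a list" and i j assume l: "length vs = ?m" "i < ?m" "j < ?m" and ij: "i \<noteq> j \<and> vs ! i = vs ! j"
    have "?c vs = (\<Sum>k\<in>{i, j}. det_form (vs[k := L (vs ! k)]))"
    proof (rule sum.mono_neutral_right)
      show "\<forall>k\<in>{..<?m} - {i, j}. det_form (vs[k := L (vs ! k)]) = 0"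
        using l ij by (auto intro!: alternating_eq_zero[OF D, of _ i j])
    qed (use l in auto)
    \<comment> \<open>Only the terms altering one of the two equal entries survive; they differ by
      an exchange of slots \<open>i\<close> and \<open>j\<close>.\<close>
    also have "\<dots> = det_form (vs[i := L (vs ! i), j := vs ! i]) + det_form (vs[i := vs ! i, j := L (vs ! i)])"
    proof -
      have e1: "vs[i := L (vs ! i), j := vs ! i] = vs[i := L (vs ! i)]"
        using ij by (metis list_update_id list_update_swap)
      have e2: "vs[i := vs ! i, j := L (vs ! i)] = vs[j := L (vs ! j)]"
        using ij by (metis list_update_id)
      have "i \<notin> {j}" using ij by simp
      then show ?thesis unfolding e1 e2
        by simp
    qed
    also have "\<dots> = 0"
      using alternating_swap[OF D l conjunct1[OF ij], of "L (vs ! i)" "vs ! i"] by simp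
    finally show "?c vs = 0" .
  qed
  from alternating_eq_det_form[OF this vs]
  have "?c vs = det_form vs * ?c basis_list" .
  also have "?c basis_list = (\<Sum>i<?m. L (basis_list ! i) \<bullet> basis_list ! i)"
    using alternating_basis_update[OF D] by simp
  also have "\<dots> = (\<Sum>b\<in>Basis. L b \<bullet> b)" by (simp add: sum_Basis_list)
  finally show ?thesis by simp
qed

text \<open>The product rule in the Leibniz expansion, regrouped by the entry that is
  differentiated.\<close>

lemma has_derivative_det_form:
  fixes F :: "nat \<Rightarrow> 'b::real_normed_vector \<Rightarrow> 'a::euclidean_space"
  assumes "\<And>i. i < DIM('a) \<Longrightarrow> (F i has_derivative F' i) (at x)"
  shows "((\<lambda>y. det_form (map (\<lambda>i. F i y) [0..<DIM('a)])) has_derivative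
    (\<lambda>h. \<Sum>i<DIM('a). det_form ((map (\<lambda>i. F i x) [0..<DIM('a)])[i := F' i h]))) (at x)"
proof -
  let ?m = "DIM('a)" and ?b = "basis_list :: 'a list"
  have "((\<lambda>y. \<Sum>\<sigma> | \<sigma> permutes {..<?m}. of_int (sign \<sigma>) * (\<Prod>i<?m. F i y \<bullet> ?b ! \<sigma> i)) has_derivative
    (\<lambda>h. \<Sum>\<sigma> | \<sigma> permutes {..<?m}. of_int (sign \<sigma>) *
      (\<Sum>i<?m. (F' i h \<bullet> ?b ! \<sigma> i) * (\<Prod>j\<in>{..<?m} - {i}. F j x \<bullet> ?b ! \<sigma> j)))) (at x)"
    using assms
    by (intro has_derivative_sum has_derivative_mult_right has_derivative_prod has_derivative_inner_left) auto
  moreover have "(\<lambda>y. \<Sum>\<sigma> | \<sigma> permutes {..<?m}. of_int (sign \<sigma>) * (\<Prod>i<?m. F i y \<bullet> ?b ! \<sigma> i)) =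
    (\<lambda>y. det_form (map (\<lambda>i. F i y) [0..<?m]))"
    by (auto simp: det_form_def gram_def fun_eq_iff intro!: sum.cong prod.cong)
  moreover have "(\<lambda>h. \<Sum>\<sigma> | \<sigma> permutes {..<?m}. of_int (sign \<sigma>) *
      (\<Sum>i<?m. (F' i h \<bullet> ?b ! \<sigma> i) * (\<Prod>j\<in>{..<?m} - {i}. F j x \<bullet> ?b ! \<sigma> j))) =
    (\<lambda>h. \<Sum>i<?m. det_form ((map (\<lambda>i. F i x) [0..<?m])[i := F' i h]))"
  proof
    fix h
    have p: "(F' i h \<bullet> ?b ! \<sigma> i) * (\<Prod>j\<in>{..<?m} - {i}. F j x \<bullet> ?b ! \<sigma> j) =
      (\<Prod>j<?m. ((map (\<lambda>i. F i x) [0..<?m])[i := F' i h]) ! j \<bullet> ?b ! \<sigma> j)" if "i < ?m" for i \<sigma>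
    proof -
      have "(\<Prod>j<?m. ((map (\<lambda>i. F i x) [0..<?m])[i := F' i h]) ! j \<bullet> ?b ! \<sigma> j) =
        (((map (\<lambda>i. F i x) [0..<?m])[i := F' i h]) ! i \<bullet> ?b ! \<sigma> i) *
        (\<Prod>j\<in>{..<?m} - {i}. ((map (\<lambda>i. F i x) [0..<?m])[i := F' i h]) ! j \<bullet> ?b ! \<sigma> j)"
        using that by (intro prod.remove) auto
      also have "\<dots> = (F' i h \<bullet> ?b ! \<sigma> i) * (\<Prod>j\<in>{..<?m} - {i}. F j x \<bullet> ?b ! \<sigma> j)"
        using that by (intro arg_cong2[where f = "(*)"] prod.cong) (auto simp: nth_list_update)
      finally show ?thesis by simp
    qed
    show "(\<Sum>\<sigma> | \<sigma> permutes {..<?m}. of_int (sign \<sigma>) *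
      (\<Sum>i<?m. (F' i h \<bullet> ?b ! \<sigma> i) * (\<Prod>j\<in>{..<?m} - {i}. F j x \<bullet> ?b ! \<sigma> j))) =
      (\<Sum>i<?m. det_form ((map (\<lambda>i. F i x) [0..<?m])[i := F' i h]))"
      unfolding det_form_def gram_def sum_distrib_left
      by (subst sum.swap) (auto simp: p intro!: sum.cong)
  qed
  ultimately show ?thesis by simp
qed

text \<open>Up to a constant, \<open>wedge\<close> is the antisymmetrisation of the tensor product,
  which is linear in each slot.\<close>

lemma alternating_wedge:
  fixes \<alpha> \<beta> :: "('m, 'e::real_vector) form"
  assumes a: "alternating k (\<alpha> p)" and b: "alternating l (\<beta> p)"
  shows "alternating (k + l) (wedge k \<alpha> \<beta> p)"
proof -
  let ?c = "\<lambda>vs. \<alpha> p (take k vs) * \<beta> p (drop k vs)"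
  have "linear (\<lambda>x. ?c (vs[i := x]))" if vs: "length vs = k + l" "i < k + l" for vs :: "'e list" and i
  proof (cases "i < k")
    case True
    have "linear (\<lambda>x. \<alpha> p ((take k vs)[i := x]))"
      using alternating_linear[OF a] True vs by simp
    then show ?thesis using True by (simp add: take_update_swap linear_iff algebra_simps)
  next
    case False
    have "linear (\<lambda>x. \<beta> p ((drop k vs)[i - k := x]))"
      using alternating_linear[OF b] False vs by simp
    then show ?thesis using False by (simp add: drop_update_swap linear_iff algebra_simps)
  qed
  from alternating_scale[OF alternating_antisymmetrization[OF this], where r = "1 / (fact k * fact l)"]
  have 1: "alternating (k + l) (\<lambda>vs. 1 / (fact k * fact l) *
      (\<Sum>\<sigma> | \<sigma> permutes {..<length vs}. of_int (sign \<sigma>) * ?c (permute_list \<sigma> vs)))" .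
  have 2: "1 / (fact k * fact l) *
      (\<Sum>\<sigma> | \<sigma> permutes {..<length vs}. of_int (sign \<sigma>) * ?c (permute_list \<sigma> vs)) = wedge k \<alpha> \<beta> p vs"
    if "length vs = k + l" for vs
    using that by (simp add: wedge_def mult.assoc)
  show ?thesis by (rule iffD1[OF alternating_cong 1]) (rule 2)
qed

section \<open>Charts and the divergence\<close>

lemma frechet_derivative_compose_local:
  assumes "(f has_derivative frechet_derivative f (at x)) (at x)"
    "(g has_derivative frechet_derivative g (at (f x))) (at (f x))"
    "open U" "x \<in> U" "\<And>y. y \<in> U \<Longrightarrow> h y = g (f y)"
  shows "frechet_derivative h (at x) = (\<lambda>v. frechet_derivative g (at (f x)) (frechet_derivative f (at x) v))"
proof -
  have "(h has_derivative (\<lambda>v. frechet_derivative g (at (f x)) (frechet_derivative f (at x) v))) (at x)"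
    using has_derivative_transform_within_open[OF has_derivative_compose[OF assms(1,2)] assms(3,4)] assms(5)
    by simp
  then show ?thesis by (simp add: frechet_derivative_at[symmetric])
qed

lemma frechet_derivative_cong_open:
  "open U \<Longrightarrow> x \<in> U \<Longrightarrow> (\<And>y. y \<in> U \<Longrightarrow> f y = g y) \<Longrightarrow> (f has_derivative f') (at x) \<Longrightarrow>
    frechet_derivative g (at x) = f'"
  using has_derivative_transform_within_open frechet_derivative_at by (metis (no_types, lifting))

text \<open>The coefficients of a one-form in the chart \<open>c\<close>. Smoothness is a statement
  about these: \<open>\<omega> p [v]\<close> with \<open>v\<close> fixed refers to a frame that may
  jump with \<open>p\<close>.\<close>

definition form1_coords ::
    "('m, 'e::euclidean_space) chart set \<Rightarrow> ('m, 'e) form \<Rightarrow> ('m, 'e) chart \<Rightarrow> 'e \<Rightarrow> 'e \<Rightarrow> real" where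
  "form1_coords A \<omega> c y v = \<omega> (cinv c y) [from_coords A c (cinv c y) v]"

section \<open>Charts and changes of coordinates\<close>

context
  fixes X :: "'m::{t2_space,second_countable_topology} set" and A :: "('m, 'e::euclidean_space) chart set"
  assumes M: "smooth_manifold X A"
begin

lemma chart_is_chart: "c \<in> A \<Longrightarrow> is_chart X c"
  using M by (simp add: smooth_manifold_def)

lemma chart_homeo: "c \<in> A \<Longrightarrow> homeomorphism (cdom c) (cmap c ` cdom c) (cmap c) (cinv c)"
  using chart_is_chart by (simp add: is_chart_def)

lemma chart_open: "c \<in> A \<Longrightarrow> open (cmap c ` cdom c)"
  using chart_is_chart by (simp add: is_chart_def)

lemma chart_openin: "c \<in> A \<Longrightarrow> openin (top_of_set X) (cdom c)"
  using chart_is_chart by (simp add: is_chart_def)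

lemma chart_subset: "c \<in> A \<Longrightarrow> cdom c \<subseteq> X"
  using chart_openin openin_imp_subset by blast

lemma cinv_cmap: "c \<in> A \<Longrightarrow> p \<in> cdom c \<Longrightarrow> cinv c (cmap c p) = p"
  using chart_homeo by (meson homeomorphism_apply1)

lemma cmap_cinv: "y \<in> cmap c ` cdom c \<Longrightarrow> cmap c (cinv c y) = y" for c :: "('m, 'e) chart"
  by (rule f_inv_into_f)

lemma cinv_in: "y \<in> cmap c ` cdom c \<Longrightarrow> cinv c y \<in> cdom c" for c :: "('m, 'e) chart"
  by (rule inv_into_into)

lemma chart_image_open:
  assumes "c \<in> A" "openin (top_of_set X) W"
  shows "open (cmap c ` (W \<inter> cdom c))"
proof -
  obtain T where T: "open T" "W = X \<inter> T" using assms(2) by (auto simp: openin_open)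
  then have "W \<inter> cdom c = cdom c \<inter> T" using chart_subset[OF assms(1)] by blast
  then have "openin (top_of_set (cdom c)) (W \<inter> cdom c)"
    using openin_open_Int[OF T(1), of "cdom c"] by metis
  then have "openin (top_of_set (cmap c ` cdom c)) (cmap c ` (W \<inter> cdom c))"
    by (rule homeomorphism_imp_open_map[OF chart_homeo[OF assms(1)]])
  then show ?thesis using openin_open_eq[OF chart_open[OF assms(1)]] by simp
qed

lemma chart_at_in: "p \<in> X \<Longrightarrow> chart_at A p \<in> A \<and> p \<in> cdom (chart_at A p)"
  unfolding chart_at_def using M by (rule_tac someI_ex) (auto simp: smooth_manifold_def)

lemma transition_open: "c \<in> A \<Longrightarrow> c' \<in> A \<Longrightarrow> open (cmap c ` (cdom c \<inter> cdom c'))"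
  using chart_image_open[of c "cdom c'"] chart_openin by (simp add: inf_commute)

lemma transition_smooth:
  "c \<in> A \<Longrightarrow> c' \<in> A \<Longrightarrow> smooth_on (cmap c ` (cdom c \<inter> cdom c')) (cmap c' \<circ> cinv c)"
  using M by (simp add: smooth_manifold_def)

lemma transition_has_derivative:
  assumes "c \<in> A" "c' \<in> A" "p \<in> cdom c" "p \<in> cdom c'"
  shows "((cmap c' \<circ> cinv c) has_derivative frechet_derivative (cmap c' \<circ> cinv c) (at (cmap c p))) (at (cmap c p))"
  using smooth_on_has_derivative[OF transition_smooth[OF assms(1,2)]] assms by blast

text \<open>The cocycle rule for three charts around \<open>p\<close>, from which the conversions
  between coordinates follow.\<close>

lemma transition_chain:
  assumes "a \<in> A" "b \<in> A" "d \<in> A" "p \<in> cdom a" "p \<in> cdom b" "p \<in> cdom d"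
  shows "frechet_derivative (cmap d \<circ> cinv a) (at (cmap a p)) =
    (\<lambda>v. frechet_derivative (cmap d \<circ> cinv b) (at (cmap b p)) (frechet_derivative (cmap b \<circ> cinv a) (at (cmap a p)) v))"
proof -
  let ?U = "cmap a ` (cdom a \<inter> cdom b)"
  have e: "(cmap b \<circ> cinv a) (cmap a p) = cmap b p" using assms by (simp add: cinv_cmap)
  have h: "(cmap d \<circ> cinv a) y = (cmap d \<circ> cinv b) ((cmap b \<circ> cinv a) y)" if "y \<in> ?U" for y
    using that assms by (auto simp: cinv_cmap)
  show ?thesis
    using frechet_derivative_compose_local[of "cmap b \<circ> cinv a" "cmap a p" "cmap d \<circ> cinv b" ?U "cmap d \<circ> cinv a", OF _ _ _ _ h]
      transition_has_derivative[of a b p] transition_has_derivative[of b d p] transition_open[of a b] assms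
    unfolding e by auto
qed

lemma transition_self:
  assumes "a \<in> A" "p \<in> cdom a"
  shows "frechet_derivative (cmap a \<circ> cinv a) (at (cmap a p)) = (\<lambda>v. v)"
  by (rule frechet_derivative_cong_open[OF chart_open[OF assms(1)] _ _ has_derivative_ident])
    (use assms in \<open>auto simp: cinv_cmap\<close>)

lemma from_coords_transition:
  assumes "a \<in> A" "b \<in> A" "p \<in> cdom a" "p \<in> cdom b"
  shows "from_coords A a p v = from_coords A b p (frechet_derivative (cmap b \<circ> cinv a) (at (cmap a p)) v)"
  using transition_chain[of a b "chart_at A p" p] chart_at_in[of p] chart_subset[OF assms(1)] assms
  unfolding from_coords_def by auto

lemma to_from_coords_transition:
  assumes "a \<in> A" "b \<in> A" "p \<in> cdom a" "p \<in> cdom b"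
  shows "to_coords A b p (from_coords A a p v) = frechet_derivative (cmap b \<circ> cinv a) (at (cmap a p)) v"
proof -
  have "p \<in> X" using assms chart_subset by blast
  then show ?thesis
    using transition_chain[of a "chart_at A p" b p] chart_at_in[of p] assms
    unfolding from_coords_def to_coords_def by auto
qed

lemma to_from_coords: "a \<in> A \<Longrightarrow> p \<in> cdom a \<Longrightarrow> to_coords A a p (from_coords A a p v) = v"
  using to_from_coords_transition[of a a p v] transition_self by simp

lemma from_coords_chart_at: "p \<in> X \<Longrightarrow> from_coords A (chart_at A p) p = (\<lambda>v. v)"
  unfolding from_coords_def using transition_self chart_at_in by simp

lemma from_to_coords:
  assumes "a \<in> A" "p \<in> cdom a"
  shows "from_coords A a p (to_coords A a p v) = v"
proof -
  have "p \<in> X" using assms chart_subset by blast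
  then show ?thesis
    using from_coords_transition[of "chart_at A p" a p v] chart_at_in[of p] assms
    by (auto simp: to_coords_def from_coords_chart_at)
qed

lemma linear_from_coords: "a \<in> A \<Longrightarrow> p \<in> cdom a \<Longrightarrow> linear (from_coords A a p)"
  unfolding from_coords_def
  using transition_has_derivative[of a "chart_at A p" p] chart_at_in[of p] chart_subset[of a] has_derivative_linear
  by blast

lemma linear_to_coords: "a \<in> A \<Longrightarrow> p \<in> cdom a \<Longrightarrow> linear (to_coords A a p)"
  unfolding to_coords_def
  using transition_has_derivative[of "chart_at A p" a p] chart_at_in[of p] chart_subset[of a] has_derivative_linear
  by blast

section \<open>The divergence in an arbitrary chart\<close>

text \<open>The definition differentiates in \<open>chart_at A p\<close>, whereas the data are given
  in \<open>c\<close>. Through the transition map \<phi>, the contracted form becomes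
  \<open>k\<close> times the determinant of the field \<open>Y\<close> along \<phi> and of vectors
  moved by the derivative of \<phi>. Its exterior derivative consists of terms with second
  derivatives of \<phi>, which cancel, and of terms with \<open>Y'\<close>, which add up to a trace.
  The constant \<open>k\<close> drops out; it will absorb \<open>fact n\<close>, the orientation
  sign and \<open>1 / sqrt s\<close>.\<close>

lemma divergence_chart:
  fixes \<rho> :: "'e \<Rightarrow> real" and Z :: "'e \<Rightarrow> 'e"
  assumes c: "c \<in> A" and U: "open U" "U \<subseteq> cmap c ` cdom c" "x \<in> U"
    and vol: "\<And>y vs. y \<in> U \<Longrightarrow> length vs = DIM('e) \<Longrightarrow>
        \<mu> (cinv c y) (map (from_coords A c (cinv c y)) vs) = k * \<rho> y * det_form vs"
    and vf: "\<And>y. y \<in> U \<Longrightarrow> V (cinv c y) = from_coords A c (cinv c y) (Z y)"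
    and Y': "((\<lambda>y. \<rho> y *\<^sub>R Z y) has_derivative Y') (at x)"
    and nz: "k \<noteq> 0" "\<rho> x \<noteq> 0"
  shows "divergence A \<mu> V (cinv c x) = (\<Sum>b\<in>Basis. Y' b \<bullet> b) / \<rho> x"
proof -
  let ?m = "DIM('e)"
  define p where "p = cinv c x"
  have pc: "p \<in> cdom c" and cp: "cmap c p = x"
    using U cinv_in cmap_cinv unfolding p_def by blast+
  have pX: "p \<in> X" using pc chart_subset[OF c] by blast
  define c' where "c' = chart_at A p"
  have c': "c' \<in> A" "p \<in> cdom c'" using chart_at_in[OF pX] by (auto simp: c'_def)
  define \<phi> where "\<phi> = cmap c \<circ> cinv c'"
  define N where "N = cmap c' ` (cdom c' \<inter> cdom c)"
  have oN: "open N" unfolding N_def using transition_open c c' by blast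
  have s\<phi>: "smooth_on N \<phi>" unfolding N_def \<phi>_def using transition_smooth c c' by blast
  define x' where "x' = cmap c' p"
  have x'N: "x' \<in> N" using pc c' by (auto simp: x'_def N_def)
  have \<phi>x: "\<phi> x' = x" using c' cp by (simp add: \<phi>_def x'_def cinv_cmap)
  define U' where "U' = N \<inter> \<phi> -` U"
  have oU': "open U'" unfolding U'_def
    using continuous_open_preimage[OF smooth_on_continuous_on[OF s\<phi>] oN U(1)] by simp
  have x'U: "x' \<in> U'" using x'N \<phi>x U by (simp add: U'_def)
  define D where "D = (\<lambda>y. frechet_derivative \<phi> (at y))"
  have D: "(\<phi> has_derivative D y) (at y)" if "y \<in> N" for y
    unfolding D_def using smooth_on_has_derivative[OF s\<phi> that] .
  have linD: "linear (D y)" if "y \<in> N" for y using D[OF that] has_derivative_linear by blast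
  define Y where "Y = (\<lambda>y. \<rho> y *\<^sub>R Z y)"
  note alt = alternating_det_form[where 'a = 'e]

  have q: "cinv c' y \<in> cdom c \<and> cinv c' y \<in> cdom c' \<and> cinv c (\<phi> y) = cinv c' y \<and> \<phi> y \<in> U \<and> cmap c' (cinv c' y) = y"
    if "y \<in> U'" for y
    using that c c' by (auto simp: U'_def N_def \<phi>_def cinv_cmap)
  have fc: "from_coords A c' (cinv c' y) v = from_coords A c (cinv c' y) (D y v)" if "y \<in> U'" for y v
    using from_coords_transition[of c' c "cinv c' y" v] q[OF that] c c' by (simp add: D_def \<phi>_def)
  have iota: "interior_product V \<mu> (cinv c' y) (map (from_coords A c' (cinv c' y)) ws) =
      k * det_form (Y (\<phi> y) # map (D y) ws)" if y: "y \<in> U'" and ws: "length ws = ?m - 1" for y ws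
  proof -
    have l: "linear (\<lambda>v. det_form (v # map (D y) ws))"
      using alternating_linear[OF alt, of "0 # map (D y) ws" 0] ws by simp
    have "interior_product V \<mu> (cinv c' y) (map (from_coords A c' (cinv c' y)) ws) =
       \<mu> (cinv c (\<phi> y)) (map (from_coords A c (cinv c (\<phi> y))) (Z (\<phi> y) # map (D y) ws))"
      using vf[of "\<phi> y"] q[OF y] ext[of "from_coords A c' (cinv c' y)", OF fc[OF y]]
      by (simp add: interior_product_def o_def)
    also have "\<dots> = k * \<rho> (\<phi> y) * det_form (Z (\<phi> y) # map (D y) ws)"
      using vol[of "\<phi> y" "Z (\<phi> y) # map (D y) ws"] q[OF y] ws by simp
    also have "\<dots> = k * det_form (Y (\<phi> y) # map (D y) ws)"
      using linear_cmul[OF l] by (simp add: Y_def)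
    finally show ?thesis .
  qed

  define r where "r = (\<Sum>b\<in>Basis. Y' b \<bullet> b) / \<rho> x"
  have L: "ext_deriv A (interior_product V \<mu>) p vs = r * \<mu> p vs \<and> \<mu> p vs = k * \<rho> x * det_form (map (D x') vs)"
    if vs: "length vs = ?m" for vs
  proof -
    define zs where "zs = map (D x') vs"
    \<comment> \<open>The list whose determinant is differentiated in summand \<open>i\<close> of
      \<open>ext_deriv\<close>: the field in slot \<open>i\<close>, moved vectors in the
      others.\<close>
    define F where "F = (\<lambda>i j y. if j = i then Y (\<phi> y) else D y (vs ! j))"
    define S where "S = (\<lambda>i j. frechet_derivative (\<lambda>y. D y (vs ! j)) (at x') (vs ! i))"
    define F' where "F' = (\<lambda>i j h. if j = i then Y' (D x' h) else frechet_derivative (\<lambda>y. D y (vs ! j)) (at x') h)"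
    have zl: "length zs = ?m" using vs by (simp add: zs_def)
    have F': "(F i j has_derivative F' i j) (at x')" for i j
    proof (cases "j = i")
      case True
      have "((\<lambda>y. Y (\<phi> y)) has_derivative (\<lambda>h. Y' (D x' h))) (at x')"
        using has_derivative_compose[OF D[OF x'N], of Y Y'] Y' by (simp add: \<phi>x Y_def)
      then show ?thesis using True by (simp add: F_def F'_def)
    next
      case False
      have "smooth_on N (\<lambda>y. D y (vs ! j))"
        unfolding D_def by (rule smooth_on_frechet_derivative[OF s\<phi>])
      then show ?thesis using False smooth_on_has_derivative[OF _ x'N] by (simp add: F_def F'_def)
    qed
    have Fl: "map (\<lambda>j. F i j y) [0..<?m] = (map (D y) vs)[i := Y (\<phi> y)]" if "i < ?m" for i y
      using that vs by (intro nth_equalityI) (auto simp: F_def nth_list_update)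
    have summand: "frechet_derivative (\<lambda>y. interior_product V \<mu> (cinv c' y)
          (map (from_coords A c' (cinv c' y)) (take i vs @ drop (Suc i) vs))) (at x') (vs ! i) =
        (- 1) ^ i * (k * (\<Sum>j<?m. det_form (zs[i := Y x, j := F' i j (vs ! i)])))" if i: "i < ?m" for i
    proof -
      have d: "((\<lambda>y. (- 1) ^ i * (k * det_form (map (\<lambda>j. F i j y) [0..<?m]))) has_derivative
          (\<lambda>h. (- 1) ^ i * (k * (\<Sum>j<?m. det_form ((map (\<lambda>j. F i j x') [0..<?m])[j := F' i j h]))))) (at x')"
        by (intro has_derivative_mult_right has_derivative_det_form F')
      have e: "(- 1) ^ i * (k * det_form (map (\<lambda>j. F i j y) [0..<?m])) =
          interior_product V \<mu> (cinv c' y) (map (from_coords A c' (cinv c' y)) (take i vs @ drop (Suc i) vs))"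
        if "y \<in> U'" for y
      proof -
        have "interior_product V \<mu> (cinv c' y) (map (from_coords A c' (cinv c' y)) (take i vs @ drop (Suc i) vs)) =
           k * det_form (Y (\<phi> y) # take i (map (D y) vs) @ drop (Suc i) (map (D y) vs))"
          using iota[OF that, of "take i vs @ drop (Suc i) vs"] i vs by (simp add: take_map drop_map)
        also have "\<dots> = k * ((- 1) ^ i * det_form ((map (D y) vs)[i := Y (\<phi> y)]))"
          using alternating_move[OF alt, of "map (D y) vs" i] i vs by simp
        finally show ?thesis by (simp add: Fl[OF i])
      qed
      show ?thesis
        using fun_cong[OF frechet_derivative_cong_open[OF oU' x'U e d], of "vs ! i"] Fl[OF i, of x']
        by (simp add: zs_def \<phi>x)
    qed
    have c'p: "cinv c' x' = p" using c' by (simp add: x'_def cinv_cmap)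
    have "ext_deriv A (interior_product V \<mu>) p vs =
        (\<Sum>i<?m. (- 1) ^ i * ((- 1) ^ i * (k * (\<Sum>j<?m. det_form (zs[i := Y x, j := F' i j (vs ! i)])))))"
      unfolding ext_deriv_def Let_def c'_def[symmetric] x'_def[symmetric] vs
      by (intro sum.cong arg_cong2[where f = "(*)"] summand) simp_all
    \<comment> \<open>One sign stems from \<open>ext_deriv\<close>, the other from moving the field
      into slot \<open>i\<close>; their product is 1.\<close>
    also have "\<dots> = k * (\<Sum>i<?m. \<Sum>j<?m. det_form (zs[i := Y x, j := F' i j (vs ! i)]))"
      by (simp add: sum_distrib_left mult.assoc[symmetric] power_mult_distrib[symmetric])
    \<comment> \<open>For \<open>j = i\<close> the derivative falls on the field itself and, by the
      chain rule, is \<open>Y'\<close> at \<open>zs ! i\<close>; the other terms carry the second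
      derivatives \<open>S i j\<close>.\<close>
    also have "(\<Sum>i<?m. \<Sum>j<?m. det_form (zs[i := Y x, j := F' i j (vs ! i)])) =
        (\<Sum>i<?m. (\<Sum>j<?m. if j = i then 0 else det_form (zs[i := Y x, j := S i j])) + det_form (zs[i := Y' (zs ! i)]))"
    proof (rule sum.cong)
      fix i assume i: "i \<in> {..<?m}"
      have "(\<Sum>j<?m. det_form (zs[i := Y x, j := F' i j (vs ! i)])) =
        (\<Sum>j<?m. (if j = i then 0 else det_form (zs[i := Y x, j := S i j])) +
          (if j = i then det_form (zs[i := Y' (zs ! i)]) else 0))"
        by (rule sum.cong) (use i vs in \<open>auto simp: F'_def S_def zs_def\<close>)
      then show "(\<Sum>j<?m. det_form (zs[i := Y x, j := F' i j (vs ! i)])) =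
          (\<Sum>j<?m. if j = i then 0 else det_form (zs[i := Y x, j := S i j])) + det_form (zs[i := Y' (zs ! i)])"
        using i by (simp add: sum.distrib)
    qed simp
    also have "\<dots> = (\<Sum>i<?m. \<Sum>j<?m. if j = i then 0 else det_form (zs[i := Y x, j := S i j])) +
        (\<Sum>b\<in>Basis. Y' b \<bullet> b) * det_form zs"
      using alternating_trace[OF has_derivative_linear[OF Y'] zl] by (simp add: sum.distrib)
    \<comment> \<open>The second derivatives of the transition map cancel in pairs: they are symmetric, \<open>det_form\<close> is alternating.\<close>
    also have "(\<Sum>i<?m. \<Sum>j<?m. if j = i then 0 else det_form (zs[i := Y x, j := S i j])) = 0" (is "?E = 0")
    proof -
      have anti: "(if j = i then 0 else det_form (zs[i := Y x, j := S i j])) =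
        - (if i = j then 0 else det_form (zs[j := Y x, i := S j i]))" if "i < ?m" "j < ?m" for i j
      proof (cases "i = j")
        case False
        have "S i j = S j i"
          unfolding S_def D_def by (rule second_derivative_commute[OF oN x'N s\<phi>])
        then show ?thesis
          using False alternating_swap[OF alt zl that False, of "Y x" "S i j"]
          by (simp add: list_update_swap[OF False])
      qed simp
      have "?E = (\<Sum>i<?m. \<Sum>j<?m. - (if i = j then 0 else det_form (zs[j := Y x, i := S j i])))"
        by (intro sum.cong anti) auto
      also have "\<dots> = - ?E" by (subst (2) sum.swap) (simp add: sum_negf)
      finally show ?thesis by simp
    qed
    finally have 1: "ext_deriv A (interior_product V \<mu>) p vs = k * ((\<Sum>b\<in>Basis. Y' b \<bullet> b) * det_form zs)" by simp
    have "map (from_coords A c p) zs = vs"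
      using fc[OF x'U] c'p from_coords_chart_at[OF pX] by (simp add: zs_def o_def c'_def[symmetric] map_idI)
    then have 2: "\<mu> p vs = k * \<rho> x * det_form zs"
      using vol[OF U(3) zl] by (simp add: p_def)
    show ?thesis using 1 2 nz by (simp add: r_def zs_def)
  qed
  have "divergence A \<mu> V p = r"
    unfolding divergence_def
  proof (rule the_equality)
    show "\<forall>vs. length vs = ?m \<longrightarrow> ext_deriv A (interior_product V \<mu>) p vs = r * \<mu> p vs"
      using L by blast
  next
    fix s assume s: "\<forall>vs. length vs = ?m \<longrightarrow> ext_deriv A (interior_product V \<mu>) p vs = s * \<mu> p vs"
    \<comment> \<open>A test list with nonzero volume: the coordinate frame of \<open>c\<close>,
      which \<open>D x'\<close> maps to \<open>basis_list\<close>.\<close>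
    define vs where "vs = map (from_coords A c p) (basis_list :: 'e list)"
    have "D x' (from_coords A c p v) = v" for v
    proof -
      have "D x' (from_coords A c p v) = to_coords A c p (from_coords A c' p (from_coords A c p v))"
        using to_from_coords_transition[of c' c p] c c' pc by (simp add: D_def \<phi>_def x'_def)
      then show ?thesis using from_coords_chart_at[OF pX] to_from_coords[OF c pc] by (simp add: c'_def)
    qed
    then have "map (D x') vs = basis_list" by (simp add: vs_def o_def map_idI)
    moreover have "length vs = ?m" by (simp add: vs_def)
    ultimately have "\<mu> p vs \<noteq> 0" "r * \<mu> p vs = s * \<mu> p vs"
      using L[of vs] s nz by auto
    then show "s = r" by simp
  qed
  then show ?thesis by (simp add: r_def p_def)
qed

section \<open>One-forms and their exterior derivatives in coordinates\<close>

lemma form1_linear: "smooth_form X A 1 \<omega> \<Longrightarrow> p \<in> X \<Longrightarrow> linear (\<lambda>v. \<omega> p [v])"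
  using alternating_linear[of 1 "\<omega> p" "[0]" 0] by (simp add: smooth_form_def)

lemma form1_coords_linear:
  assumes "smooth_form X A 1 \<omega>" "c \<in> A" "y \<in> cmap c ` cdom c"
  shows "linear (form1_coords A \<omega> c y)"
proof -
  have q: "cinv c y \<in> cdom c" using assms(3) by (rule cinv_in)
  have "linear ((\<lambda>v. \<omega> (cinv c y) [v]) \<circ> from_coords A c (cinv c y))"
    using form1_linear[OF assms(1)] linear_from_coords[OF assms(2) q] q chart_subset[OF assms(2)] linear_compose
    by blast
  then show ?thesis by (simp add: form1_coords_def[abs_def] o_def)
qed

lemma form1_coords_smooth:
  assumes "smooth_form X A 1 \<omega>" "c \<in> A"
  shows "smooth_on (cmap c ` cdom c) (\<lambda>y. form1_coords A \<omega> c y v)"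
proof -
  have "\<forall>ws. length ws = 1 \<longrightarrow>
        smooth_on (cmap c ` cdom c) (\<lambda>x. \<omega> (cinv c x) (map (from_coords A c (cinv c x)) ws))"
    using assms by (simp add: smooth_form_def)
  from this[rule_format, of "[v]"] show ?thesis by (simp add: form1_coords_def)
qed

text \<open>The usual coordinate formula, valid in any chart around \<open>p\<close>. Passing from
  \<open>chart_at A p\<close> to \<open>c\<close> adds the form evaluated on a second derivative of
  the transition map; this is symmetric in the two arguments and disappears in the
  difference.\<close>

lemma ext_deriv_form1:
  assumes w: "smooth_form X A 1 \<omega>" and c: "c \<in> A" "p \<in> cdom c"
  shows "ext_deriv A \<omega> p [from_coords A c p u, from_coords A c p v] =
    frechet_derivative (\<lambda>y. form1_coords A \<omega> c y v) (at (cmap c p)) u -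
    frechet_derivative (\<lambda>y. form1_coords A \<omega> c y u) (at (cmap c p)) v"
proof -
  have pX: "p \<in> X" using c chart_subset by blast
  define c' where "c' = chart_at A p"
  have c': "c' \<in> A" "p \<in> cdom c'" using chart_at_in[OF pX] by (auto simp: c'_def)
  define \<phi> where "\<phi> = cmap c \<circ> cinv c'"
  define N where "N = cmap c' ` (cdom c' \<inter> cdom c)"
  have oN: "open N" unfolding N_def using transition_open c c' by blast
  have s\<phi>: "smooth_on N \<phi>" unfolding N_def \<phi>_def using transition_smooth c c' by blast
  define x' where "x' = cmap c' p"
  define x where "x = cmap c p"
  have x'N: "x' \<in> N" using c c' by (auto simp: x'_def N_def)
  have \<phi>x: "\<phi> x' = x" using c' by (simp add: \<phi>_def x'_def x_def cinv_cmap)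
  define D where "D = (\<lambda>y. frechet_derivative \<phi> (at y))"
  have D: "(\<phi> has_derivative D y) (at y)" if "y \<in> N" for y
    unfolding D_def using smooth_on_has_derivative[OF s\<phi> that] .
  have x: "x \<in> cmap c ` cdom c" using c by (auto simp: x_def)
  let ?w = "\<lambda>v y. form1_coords A \<omega> c y v"
  let ?D2 = "\<lambda>v. frechet_derivative (\<lambda>y. D y v) (at x')"
  have rep: "form1_coords A \<omega> c y v = (\<Sum>b\<in>Basis. (v \<bullet> b) * form1_coords A \<omega> c y b)" if "y \<in> cmap c ` cdom c" for y v
    using linear_sum[OF form1_coords_linear[OF w c(1) that], of "\<lambda>b. (v \<bullet> b) *\<^sub>R b" Basis]
      linear_cmul[OF form1_coords_linear[OF w c(1) that]]
    by (simp add: euclidean_representation)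
  have Dw: "(?w b has_derivative frechet_derivative (?w b) (at x)) (at x)" for b
    using smooth_on_has_derivative[OF form1_coords_smooth[OF w c(1)] x] .
  have Dw': "frechet_derivative (?w v) (at x) = (\<lambda>h. \<Sum>b\<in>Basis. (v \<bullet> b) * frechet_derivative (?w b) (at x) h)" for v
    by (rule frechet_derivative_cong_open[OF chart_open[OF c(1)] x, where f = "\<lambda>y. \<Sum>b\<in>Basis. (v \<bullet> b) * ?w b y"])
      (auto intro!: has_derivative_sum has_derivative_mult_right Dw simp: rep[of _ v])
  have "frechet_derivative (\<lambda>y. \<omega> (cinv c' y) [from_coords A c' (cinv c' y) v]) (at x') =
      (\<lambda>h. \<Sum>b\<in>Basis. (D x' v \<bullet> b) * frechet_derivative (?w b) (at x) (D x' h) + (?D2 v h \<bullet> b) * ?w b x)" for v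
  proof (rule frechet_derivative_cong_open[OF oN x'N, where f = "\<lambda>y. \<Sum>b\<in>Basis. (D y v \<bullet> b) * ?w b (\<phi> y)"])
    fix y assume y: "y \<in> N"
    then have q: "cinv c' y \<in> cdom c" "cinv c' y \<in> cdom c'" "cinv c (\<phi> y) = cinv c' y"
      "\<phi> y \<in> cmap c ` cdom c" "cmap c' (cinv c' y) = y"
      using c c' by (auto simp: N_def \<phi>_def cinv_cmap)
    have "from_coords A c' (cinv c' y) v = from_coords A c (cinv c' y) (D y v)"
      using from_coords_transition[of c' c "cinv c' y" v] q c c' by (simp add: D_def \<phi>_def)
    then have "\<omega> (cinv c' y) [from_coords A c' (cinv c' y) v] = form1_coords A \<omega> c (\<phi> y) (D y v)"
      by (simp add: form1_coords_def q)
    then show "(\<Sum>b\<in>Basis. (D y v \<bullet> b) * ?w b (\<phi> y)) = \<omega> (cinv c' y) [from_coords A c' (cinv c' y) v]"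
      using rep[OF q(4), of "D y v"] by simp
  next
    have 1: "((\<lambda>y. ?w b (\<phi> y)) has_derivative (\<lambda>h. frechet_derivative (?w b) (at x) (D x' h))) (at x')" for b
      using has_derivative_compose[OF D[OF x'N], of "?w b"] Dw[of b] by (simp add: \<phi>x)
    have "((\<lambda>y. D y v) has_derivative ?D2 v) (at x')"
      using smooth_on_has_derivative[OF smooth_on_frechet_derivative[OF s\<phi>] x'N] by (simp add: D_def)
    then have 2: "((\<lambda>y. D y v \<bullet> b) has_derivative (\<lambda>h. ?D2 v h \<bullet> b)) (at x')" for b
      by (rule has_derivative_inner_left)
    show "((\<lambda>y. \<Sum>b\<in>Basis. (D y v \<bullet> b) * ?w b (\<phi> y)) has_derivative
      (\<lambda>h. \<Sum>b\<in>Basis. (D x' v \<bullet> b) * frechet_derivative (?w b) (at x) (D x' h) + (?D2 v h \<bullet> b) * ?w b x)) (at x')"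
      using has_derivative_mult[OF 2 1] by (intro has_derivative_sum) (simp add: \<phi>x)
  qed
  then have E: "frechet_derivative (\<lambda>y. \<omega> (cinv c' y) [from_coords A c' (cinv c' y) v]) (at x') h =
      frechet_derivative (?w (D x' v)) (at x) (D x' h) + (\<Sum>b\<in>Basis. (?D2 v h \<bullet> b) * ?w b x)" for v h
    by (simp add: sum.distrib Dw'[of "D x' v"])
  have fin: "ext_deriv A \<omega> p [u', v'] = frechet_derivative (?w (D x' v')) (at x) (D x' u') -
      frechet_derivative (?w (D x' u')) (at x) (D x' v')" for u' v'
  proof -
    have "?D2 v' u' = ?D2 u' v'"
      unfolding D_def by (rule second_derivative_commute[OF oN x'N s\<phi>])
    moreover have "{..<length [u', v']} = {0, Suc 0}" by auto
    ultimately show ?thesis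
      unfolding ext_deriv_def Let_def c'_def[symmetric] x'_def[symmetric]
      by (simp add: E)
  qed
  have "D x' (from_coords A c p v) = v" for v
  proof -
    have "D x' (from_coords A c p v) = to_coords A c p (from_coords A c' p (from_coords A c p v))"
      using to_from_coords_transition[of c' c p] c c' by (simp add: D_def \<phi>_def x'_def)
    then show ?thesis using from_coords_chart_at[OF pX] to_from_coords[OF c] by (simp add: c'_def)
  qed
  then show ?thesis using fin by (simp add: x_def)
qed

end

section \<open>The inclusion of a hypersurface; wedge products\<close>

lemma dfun_from_coords:
  assumes B: "smooth_manifold S B" and c: "c \<in> B" and W: "openin (top_of_set S) W" "q \<in> W" "q \<in> cdom c"
    and f: "smooth_fun B W f"
  shows "dfun B f q (from_coords B c q v) = frechet_derivative (f \<circ> cinv c) (at (cmap c q)) v"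
proof -
  define c' where "c' = chart_at B q"
  have qS: "q \<in> S" using chart_subset[OF B c] W by blast
  have c': "c' \<in> B" "q \<in> cdom c'" using chart_at_in[OF B qS] by (auto simp: c'_def)
  let ?U = "cmap c ` (cdom c \<inter> cdom c')"
  have e: "(cmap c' \<circ> cinv c) (cmap c q) = cmap c' q" using c W by (simp add: cinv_cmap[OF B])
  have h: "(f \<circ> cinv c) y = (f \<circ> cinv c') ((cmap c' \<circ> cinv c) y)" if "y \<in> ?U" for y
    using that c c' by (auto simp: cinv_cmap[OF B])
  have df: "((f \<circ> cinv c') has_derivative frechet_derivative (f \<circ> cinv c') (at (cmap c' q))) (at (cmap c' q))"
    by (rule smooth_on_has_derivative[of "cmap c' ` (W \<inter> cdom c')"])
      (use f c' W in \<open>auto simp: smooth_fun_def\<close>)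
  have "frechet_derivative (f \<circ> cinv c) (at (cmap c q)) =
    (\<lambda>v. frechet_derivative (f \<circ> cinv c') (at (cmap c' q)) (frechet_derivative (cmap c' \<circ> cinv c) (at (cmap c q)) v))"
    using frechet_derivative_compose_local[of "cmap c' \<circ> cinv c" "cmap c q" "f \<circ> cinv c'" ?U "f \<circ> cinv c", OF _ _ _ _ h]
      transition_has_derivative[OF B, of c c' q] transition_open[OF B, of c c'] df c c' W
    unfolding e by auto
  then show ?thesis by (simp add: dfun_def from_coords_def c'_def)
qed

lemma linear_dfun:
  assumes B: "smooth_manifold S B" and W: "openin (top_of_set S) W" "q \<in> W" and f: "smooth_fun B W f"
  shows "linear (dfun B f q)"
proof -
  have "q \<in> S" using W openin_imp_subset by blast
  then have c: "chart_at B q \<in> B" "q \<in> cdom (chart_at B q)" using chart_at_in[OF B] by auto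
  have "((f \<circ> cinv (chart_at B q)) has_derivative dfun B f q) (at (cmap (chart_at B q) q))"
    unfolding dfun_def
    by (rule smooth_on_has_derivative[of "cmap (chart_at B q) ` (W \<inter> cdom (chart_at B q))"])
      (use f c W in \<open>auto simp: smooth_fun_def\<close>)
  then show ?thesis by (rule has_derivative_linear)
qed

section \<open>The inclusion in coordinates\<close>

context
  fixes M S :: "'m::{t2_space,second_countable_topology} set"
    and A :: "('m, 'e::euclidean_space) chart set"
    and B :: "('m, 's::euclidean_space) chart set"
  assumes A: "smooth_manifold M A" and emb: "embedded_hypersurface M A S B"
begin

lemma hyp_manifold: "smooth_manifold S B"
  and hyp_subset: "S \<subseteq> M" and hyp_inj: "p \<in> S \<Longrightarrow> inj (incl B A p)"
  and hyp_dim: "DIM('s) + 1 = DIM('e)"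
  using emb by (auto simp: embedded_hypersurface_def)

lemma incl_chart_open: "c \<in> B \<Longrightarrow> a \<in> A \<Longrightarrow> open (cmap c ` {x \<in> cdom c. x \<in> cdom a})"
proof -
  assume c: "c \<in> B" and a: "a \<in> A"
  have "openin (top_of_set S) (S \<inter> cdom a)"
  proof -
    obtain T where "open T" "cdom a = M \<inter> T" using chart_openin[OF A a] by (auto simp: openin_open)
    then show ?thesis using hyp_subset openin_open_Int[of T S] by (metis Int_assoc inf.absorb_iff1)
  qed
  from chart_image_open[OF hyp_manifold c this]
  have "open (cmap c ` (S \<inter> cdom a \<inter> cdom c))" .
  also have "S \<inter> cdom a \<inter> cdom c = {x \<in> cdom c. x \<in> cdom a}"
    using chart_subset[OF hyp_manifold c] by auto
  finally show ?thesis .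
qed

lemma incl_chart_smooth:
  assumes "c \<in> B" "a \<in> A"
  shows "smooth_on (cmap c ` {x \<in> cdom c. x \<in> cdom a}) (cmap a \<circ> (\<lambda>x. x) \<circ> cinv c)"
  using assms emb unfolding embedded_hypersurface_def smooth_map_def by blast

lemma incl_chart_has_derivative:
  assumes "c \<in> B" "a \<in> A" "q \<in> cdom c" "q \<in> cdom a"
  shows "((cmap a \<circ> (\<lambda>x. x) \<circ> cinv c) has_derivative
    frechet_derivative (cmap a \<circ> (\<lambda>x. x) \<circ> cinv c) (at (cmap c q))) (at (cmap c q))"
  by (rule smooth_on_has_derivative[OF incl_chart_smooth]) (use assms in auto)

text \<open>The differential is defined by the distinguished charts at \<open>q\<close>. The
  inclusion, read from \<open>c\<close> to \<open>chart_at A q\<close>, factors once through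
  \<open>chart_at B q\<close> and once through \<open>a\<close>; the two chain rules give the
  formula for arbitrary charts.\<close>

lemma incl_from_coords:
  assumes c: "c \<in> B" "q \<in> cdom c" and a: "a \<in> A" "q \<in> cdom a"
  shows "incl B A q (from_coords B c q v) =
    from_coords A a q (frechet_derivative (cmap a \<circ> (\<lambda>x. x) \<circ> cinv c) (at (cmap c q)) v)"
proof -
  note B = hyp_manifold
  define c' where "c' = chart_at B q"
  define a' where "a' = chart_at A q"
  have qS: "q \<in> S" using chart_subset[OF B c(1)] c by blast
  have c': "c' \<in> B" "q \<in> cdom c'" using chart_at_in[OF B qS] by (auto simp: c'_def)
  have a': "a' \<in> A" "q \<in> cdom a'" using chart_at_in[OF A, of q] qS hyp_subset by (auto simp: a'_def)
  let ?I = "\<lambda>a c. cmap a \<circ> (\<lambda>x. x) \<circ> cinv c"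
  have e1: "(cmap c' \<circ> cinv c) (cmap c q) = cmap c' q" using c by (simp add: cinv_cmap[OF B])
  have h1: "?I a' c y = ?I a' c' ((cmap c' \<circ> cinv c) y)" if "y \<in> cmap c ` (cdom c \<inter> cdom c')" for y
    using that c c' by (auto simp: cinv_cmap[OF B])
  have 1: "frechet_derivative (?I a' c) (at (cmap c q)) =
    (\<lambda>v. frechet_derivative (?I a' c') (at (cmap c' q)) (frechet_derivative (cmap c' \<circ> cinv c) (at (cmap c q)) v))"
    using frechet_derivative_compose_local[of "cmap c' \<circ> cinv c" "cmap c q" "?I a' c'" "cmap c ` (cdom c \<inter> cdom c')" "?I a' c", OF _ _ _ _ h1]
      transition_has_derivative[OF B, of c c' q] transition_open[OF B, of c c'] incl_chart_has_derivative[of c' a' q] a' c c'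
    unfolding e1 by auto
  have e2: "?I a c (cmap c q) = cmap a q" using c by (simp add: cinv_cmap[OF B])
  have h2: "?I a' c y = (cmap a' \<circ> cinv a) (?I a c y)" if "y \<in> cmap c ` {x \<in> cdom c. x \<in> cdom a}" for y
    using that c a by (auto simp: cinv_cmap[OF B] cinv_cmap[OF A])
  have 2: "frechet_derivative (?I a' c) (at (cmap c q)) =
    (\<lambda>v. frechet_derivative (cmap a' \<circ> cinv a) (at (cmap a q)) (frechet_derivative (?I a c) (at (cmap c q)) v))"
    using frechet_derivative_compose_local[of "?I a c" "cmap c q" "cmap a' \<circ> cinv a" "cmap c ` {x \<in> cdom c. x \<in> cdom a}" "?I a' c", OF _ _ _ _ h2]
      transition_has_derivative[OF A, of a a' q] incl_chart_open[of c a] incl_chart_has_derivative[of c a q] a' c a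
    unfolding e2 by auto
  show ?thesis
    using fun_cong[OF 1, of v] fun_cong[OF 2, of v]
    by (simp add: differential_def from_coords_def c'_def a'_def)
qed

lemma linear_incl:
  assumes "p \<in> S" shows "linear (incl B A p)"
proof -
  have "chart_at B p \<in> B" "p \<in> cdom (chart_at B p)" using chart_at_in[OF hyp_manifold assms] by auto
  moreover have "chart_at A p \<in> A" "p \<in> cdom (chart_at A p)" using chart_at_in[OF A] assms hyp_subset by auto
  ultimately show ?thesis
    unfolding differential_def
    using has_derivative_linear[OF incl_chart_has_derivative[of "chart_at B p" "chart_at A p" p]] by simp
qed

end

section \<open>Hyperplanes and wedge products\<close>

text \<open>The kernel is a hyperplane, so any basis of it is completed to a frame of the whole
  space by one transversal vector \<open>T\<close>. Prescribing \<open>S0\<close> allows a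
  suspicious vector of the kernel to be placed in the frame.\<close>

lemma kernel_basis:
  fixes l :: "'a::euclidean_space \<Rightarrow> real"
  assumes l: "linear l" "l T \<noteq> 0" and S0: "independent S0" "\<And>x. x \<in> S0 \<Longrightarrow> l x = 0"
  obtains ds where "distinct ds" "S0 \<subseteq> set ds" "\<And>x. x \<in> set ds \<Longrightarrow> l x = 0" "length ds + 1 = DIM('a)"
    "span (insert T (set ds)) = UNIV" "independent (set ds)"
proof -
  obtain D where D: "S0 \<subseteq> D" "D \<subseteq> {x. l x = 0}" "independent D" "{x. l x = 0} \<subseteq> span D"
    using maximal_independent_subset_extend[of S0 "{x. l x = 0}"] S0 by blast
  have fin: "finite D" using D(3) independent_imp_finite by blast
  have sp: "x \<in> span (insert T D)" for x
  proof -
    have "l (x - (l x / l T) *\<^sub>R T) = 0" using l by (simp add: linear_diff linear_cmul)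
    then have "x - (l x / l T) *\<^sub>R T \<in> span D" using D by blast
    then have "x - (l x / l T) *\<^sub>R T \<in> span (insert T D)" using span_mono[of D "insert T D"] by blast
    moreover have "(l x / l T) *\<^sub>R T \<in> span (insert T D)" by (simp add: span_base span_scale)
    ultimately show ?thesis using span_add by fastforce
  qed
  have "subspace {x. l x = 0}" using l(1) by (simp add: linear_subspace_kernel)
  then have "span D \<subseteq> {x. l x = 0}" using D(2) span_minimal by blast
  then have nT: "T \<notin> span D" using l(2) by blast
  then have "independent (insert T D)" using D(3) by (simp add: independent_insert)
  moreover have "span (insert T D) = span UNIV" using sp by auto
  ultimately have "card (insert T D) = DIM('a)"
    using dim_eq_card[of "insert T D" UNIV] by simp
  moreover have "T \<notin> D" using nT span_base by blast
  ultimately have "card D + 1 = DIM('a)" using fin by simp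
  moreover obtain ds where ds: "set ds = D" "distinct ds" using finite_distinct_list[OF fin] by blast
  ultimately show ?thesis using D sp that[of ds] distinct_card[OF ds(2)] by auto
qed

text \<open>A permutation contributes only if it leaves \<open>T\<close> in front, since \<alpha>
  kills the other entries. The \<open>fact l\<close> remaining permutations contribute equally, and
  the normalisation of \<open>wedge\<close> cancels their number.\<close>

lemma wedge_1_kernel:
  fixes \<alpha> \<beta> :: "('m, 'e::real_vector) form"
  assumes b: "alternating l (\<beta> p)" and vs: "length vs = l" "\<And>v. v \<in> set vs \<Longrightarrow> \<alpha> p [v] = 0"
  shows "wedge 1 \<alpha> \<beta> p (T # vs) = \<alpha> p [T] * \<beta> p vs"
proof -
  \<comment> \<open>Its permutations are those permutations of the indices of \<open>T # vs\<close>
    that fix index 0.\<close>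
  let ?S = "{1..<Suc l}"
  let ?f = "\<lambda>\<sigma>. of_int (sign \<sigma>) * \<alpha> p (take 1 (permute_list \<sigma> (T # vs))) * \<beta> p (drop 1 (permute_list \<sigma> (T # vs)))"
  have key: "\<beta> p (drop 1 (permute_list \<sigma> (T # us))) = of_int (sign \<sigma>) * \<beta> p us"
    if "\<sigma> permutes ?S" "length us = l" for \<sigma> us
    using that(1) finite_atLeastLessThan that(2)
  proof (induction arbitrary: us rule: permutes_induct)
    case id
    then show ?case by simp
  next
    case (swap i j \<sigma>)
    let ?t = "Transposition.transpose i j"
    obtain i' j' where ij: "i = Suc i'" "j = Suc j'" "i' < l" "j' < l" "i' \<noteq> j'"
      using swap(1-3) by (cases i; cases j) auto
    have t: "?t permutes ?S" using swap by (intro permutes_swap_id) auto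
    have "permutation ?t" "permutation \<sigma>" using swap t permutation_permutes by blast+
    then have s: "sign (?t \<circ> \<sigma>) = - sign \<sigma>"
      using swap by (simp add: sign_compose sign_swap_id)
    have \<sigma>': "\<sigma> permutes {..<length (T # us)}"
      by (rule permutes_subset[OF \<open>\<sigma> permutes ?S\<close>]) (use swap in auto)
    have "permute_list (?t \<circ> \<sigma>) (T # us) = permute_list \<sigma> (permute_list ?t (T # us))"
      using \<sigma>' by (simp add: permute_list_compose)
    also have "permute_list ?t (T # us) = T # us[i' := us ! j', j' := us ! i']"
      using ij swap by (subst permute_list_transpose) auto
    finally have "\<beta> p (drop 1 (permute_list (?t \<circ> \<sigma>) (T # us))) = of_int (sign \<sigma>) * \<beta> p (us[i' := us ! j', j' := us ! i'])"
      using swap.IH[of "us[i' := us ! j', j' := us ! i']"] swap.prems by (simp add: comp_def)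
    also have "\<beta> p (us[i' := us ! j', j' := us ! i']) = - \<beta> p us"
      using alternating_swap[OF b swap.prems ij(3-5), of "us ! j'" "us ! i'"] by simp
    finally show ?case unfolding s by simp
  qed
  have "sum ?f {\<sigma>. \<sigma> permutes {..<Suc l}} = sum ?f {\<sigma>. \<sigma> permutes ?S}"
  proof (rule sum.mono_neutral_right)
    show "{\<sigma>. \<sigma> permutes ?S} \<subseteq> {\<sigma>. \<sigma> permutes {..<Suc l}}"
      by (auto intro: permutes_subset)
    show "\<forall>\<sigma>\<in>{\<sigma>. \<sigma> permutes {..<Suc l}} - {\<sigma>. \<sigma> permutes ?S}. ?f \<sigma> = 0"
    proof
      fix \<sigma> assume s: "\<sigma> \<in> {\<sigma>. \<sigma> permutes {..<Suc l}} - {\<sigma>. \<sigma> permutes ?S}"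
      have "\<sigma> 0 \<noteq> 0"
      proof
        assume k: "\<sigma> 0 = 0"
        have "\<sigma> x = x" if "x \<in> {..<Suc l} - ?S" for x
          using that k by (cases x) auto
        then show False
          using s permutes_superset[of \<sigma> "{..<Suc l}" ?S] by blast
      qed
      moreover have "\<sigma> 0 < Suc l" using s permutes_in_image[of \<sigma> "{..<Suc l}" 0] by simp
      ultimately have "(T # vs) ! \<sigma> 0 \<in> set vs" using vs by (cases "\<sigma> 0") auto
      moreover have "take 1 (permute_list \<sigma> (T # vs)) = [(T # vs) ! \<sigma> 0]"
        by (simp add: permute_list_def upt_conv_Cons del: upt_Suc)
      ultimately have "\<alpha> p (take 1 (permute_list \<sigma> (T # vs))) = 0" using vs(2) by metis
      then show "?f \<sigma> = 0" by simp
    qed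
  qed (simp add: finite_permutations)
  also have "\<dots> = (\<Sum>\<sigma> | \<sigma> permutes ?S. \<alpha> p [T] * \<beta> p vs)"
  proof (rule sum.cong)
    fix \<sigma> assume s: "\<sigma> \<in> {\<sigma>. \<sigma> permutes ?S}"
    then have "\<sigma> 0 = 0" using permutes_not_in[of \<sigma> ?S 0] by simp
    then have 1: "take 1 (permute_list \<sigma> (T # vs)) = [T]"
      by (simp add: permute_list_def upt_conv_Cons del: upt_Suc)
    have 2: "\<beta> p (drop 1 (permute_list \<sigma> (T # vs))) = of_int (sign \<sigma>) * \<beta> p vs"
      using key[of \<sigma> vs] s vs by simp
    have "real_of_int (sign \<sigma>) * real_of_int (sign \<sigma>) = 1"
      by (metis of_int_1 of_int_mult sign_idempotent)
    then show "?f \<sigma> = \<alpha> p [T] * \<beta> p vs" unfolding 1 2 by (simp add: algebra_simps)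
  qed simp
  also have "\<dots> = fact l * (\<alpha> p [T] * \<beta> p vs)"
    using card_permutations[of ?S l] by simp
  finally show ?thesis using vs by (simp add: wedge_def)
qed

text \<open>In each term of the wedge the vector \<open>v\<close> sits either in the factor \<beta>,
  which then vanishes, or in the rest of the list, to which the induction hypothesis
  applies.\<close>

lemma wedge_power_degenerate:
  assumes "k > 0" "length vs = 2 * k" "v \<in> set vs"
    "\<And>w. w \<in> set vs \<Longrightarrow> \<beta> p [v, w] = 0" "\<And>w. w \<in> set vs \<Longrightarrow> \<beta> p [w, v] = 0"
  shows "wedge_power \<beta> k p vs = 0"
  using assms
proof (induction k arbitrary: vs)
  case (Suc k)
  have "\<beta> p (take 2 ps) * wedge_power \<beta> k p (drop 2 ps) = 0"
    if ps: "set ps = set vs" "length ps = 2 * Suc k" for ps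
  proof -
    obtain x y rs where r: "ps = x # y # rs" using ps by (cases ps; cases "tl ps") auto
    show ?thesis
    proof (cases "v = x \<or> v = y")
      case True
      then have "\<beta> p [x, y] = 0" using Suc.prems ps r by auto
      then show ?thesis by (simp add: r numeral_2_eq_2)
    next
      case False
      then have v: "v \<in> set rs" using Suc.prems ps r by auto
      then have "k > 0" using ps r by (cases k) auto
      have "set rs \<subseteq> set vs" using ps r by auto
      then have "wedge_power \<beta> k p rs = 0"
        using Suc.IH[of rs] \<open>k > 0\<close> v Suc.prems ps r by auto
      then show ?thesis by (simp add: r numeral_2_eq_2)
    qed
  qed
  then have "\<beta> p (take 2 (permute_list \<sigma> vs)) * wedge_power \<beta> k p (drop 2 (permute_list \<sigma> vs)) = 0"
    if "\<sigma> permutes {..<length vs}" for \<sigma>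
    using that Suc.prems by simp
  then show ?case by (auto simp: wedge_def mult.assoc intro!: sum.neutral)
qed simp

lemma alternating_wedge_power:
  assumes "alternating 2 (\<beta> p)"
  shows "alternating (2 * k) (wedge_power \<beta> k p)"
proof (induction k)
  case 0
  then show ?case by (simp add: alternating_def)
next
  case (Suc k)
  from alternating_wedge[of 2 \<beta> p "2 * k" "wedge_power \<beta> k", OF assms Suc]
  show ?case by simp
qed

lemma alternating_2I:
  assumes "\<And>v. linear (\<lambda>u. b [u, v])" "\<And>u. linear (\<lambda>v. b [u, v])" "\<And>u. b [u, u] = 0"
  shows "alternating 2 b"
  unfolding alternating_def
proof (intro allI impI conjI)
  fix vs :: "'a list" and i :: nat assume l: "length vs = 2" "i < 2"
  then obtain x y where "vs = [x, y]"
    by (metis (no_types) One_nat_def Suc_1 length_0_conv length_Suc_conv)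
  then show "linear (\<lambda>x. b (vs[i := x]))" using l assms by (cases i) auto
next
  fix vs :: "'a list" and i j :: nat assume l: "length vs = 2" "i < 2" "j < 2" "i \<noteq> j \<and> vs ! i = vs ! j"
  then obtain x y where xy: "vs = [x, y]"
    by (metis (no_types) One_nat_def Suc_1 length_0_conv length_Suc_conv)
  then have "x = y" using l by (cases i; cases j) auto
  then show "b vs = 0" using xy assms(3) by simp
qed

lemma alternating_ext_deriv_form1:
  assumes A: "smooth_manifold X A" and w: "smooth_form X A 1 \<omega>" and p: "p \<in> X"
  shows "alternating 2 (ext_deriv A \<omega> p)"
proof -
  define c where "c = chart_at A p"
  have c: "c \<in> A" "p \<in> cdom c" using chart_at_in[OF A p] by (auto simp: c_def)
  define x where "x = cmap c p"
  have x: "x \<in> cmap c ` cdom c" using c by (auto simp: x_def)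
  let ?D = "\<lambda>v. frechet_derivative (\<lambda>y. form1_coords A \<omega> c y v) (at x)"
  have e: "ext_deriv A \<omega> p [u, v] = ?D v u - ?D u v" for u v
    using ext_deriv_form1[OF A w c, of u v] from_coords_chart_at[OF A p] by (simp add: c_def x_def)
  have d: "((\<lambda>y. form1_coords A \<omega> c y v) has_derivative ?D v) (at x)" for v
    using smooth_on_has_derivative[OF form1_coords_smooth[OF A w c(1)] x] .
  have l1: "linear (?D v)" for v using d has_derivative_linear by blast
  have l2: "linear (\<lambda>v. ?D v u)" for u
  proof (rule linearI)
    fix v v' r
    have 1: "?D (v + v') = (\<lambda>h. ?D v h + ?D v' h)"
      by (rule frechet_derivative_cong_open[OF chart_open[OF A c(1)] x _ has_derivative_add[OF d[of v] d[of v']]])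
        (simp add: linear_add[OF form1_coords_linear[OF A w c(1)]])
    have 2: "?D (r *\<^sub>R v) = (\<lambda>h. r * ?D v h)"
      by (rule frechet_derivative_cong_open[OF chart_open[OF A c(1)] x _ has_derivative_mult_right[OF d[of v]]])
        (simp add: linear_cmul[OF form1_coords_linear[OF A w c(1)]])
    show "?D (v + v') u = ?D v u + ?D v' u" "?D (r *\<^sub>R v) u = r *\<^sub>R ?D v u"
      using 1 2 by simp_all
  qed
  show ?thesis
    by (rule alternating_2I) (use l1 l2 in \<open>auto simp: e linear_compose_sub\<close>)
qed

section \<open>Contact geometry at a point\<close>

lemma alternating_Cons:
  assumes "alternating (Suc k) a"
  shows "alternating k (\<lambda>vs. a (w # vs))"
  unfolding alternating_def
proof (intro allI impI conjI)
  fix vs :: "'a list" and i assume l: "length vs = k" "i < k"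
  then show "linear (\<lambda>x. a (w # vs[i := x]))"
    using alternating_linear[OF assms, of "w # vs" "Suc i"] by simp
next
  fix vs :: "'a list" and i j assume l: "length vs = k" "i < k" "j < k" "i \<noteq> j \<and> vs ! i = vs ! j"
  show "a (w # vs) = 0"
    by (rule alternating_eq_zero[OF assms, of _ "Suc i" "Suc j"]) (use l in auto)
qed

lemma alternating_nonzero_of_spanning:
  fixes vs :: "'a::euclidean_space list"
  assumes "alternating DIM('a) a" "length us = DIM('a)" "a us \<noteq> 0" "length vs = DIM('a)" "span (set vs) = UNIV"
  shows "a vs \<noteq> 0"
  using alternating_basis_zero[OF assms(1,4,5) _ assms(2)] assms(3) by blast

definition horizontal_part :: "('m, 'e::euclidean_space) chart set \<Rightarrow> ('m, 'e) form \<Rightarrow> 'm \<Rightarrow> 'e \<Rightarrow> 'e" where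
  "horizontal_part A \<omega> p u = u - \<omega> p [u] *\<^sub>R reeb A \<omega> p"

text \<open>\<open>g p\<close> is meaningful only on the distribution. Composing it with the
  projection along the Reeb field gives a positive semidefinite bilinear form on the whole tangent
  space, accessible to linear algebra and to coordinates.\<close>

definition horizontal_metric ::
    "('m, 'e::euclidean_space) chart set \<Rightarrow> ('m, 'e) form \<Rightarrow> ('m \<Rightarrow> 'e \<Rightarrow> 'e \<Rightarrow> real) \<Rightarrow> 'm \<Rightarrow> 'e \<Rightarrow> 'e \<Rightarrow> real" where
  "horizontal_metric A \<omega> g p u v = g p (horizontal_part A \<omega> p u) (horizontal_part A \<omega> p v)"

section \<open>Contact forms and the Reeb field\<close>

context
  fixes M :: "'m::{t2_space,second_countable_topology} set"
    and A :: "('m, 'e::euclidean_space) chart set"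
    and n :: nat and \<omega> :: "('m, 'e) form" and g :: "'m \<Rightarrow> 'e \<Rightarrow> 'e \<Rightarrow> real"
  assumes C: "contact_sub_riemannian M A n \<omega> g"
begin

lemma contact_dim: "DIM('e) = 2 * n + 1"
  and contact_manifold: "smooth_manifold M A"
  and contact_form: "smooth_form M A 1 \<omega>"
  and contact_metric: "smooth_fibre_inner_product M A \<omega> g"
  using C unfolding contact_sub_riemannian_def by blast+

lemma contact_form_linear: "p \<in> M \<Longrightarrow> linear (\<lambda>v. \<omega> p [v])"
  using form1_linear[OF contact_manifold contact_form] .

lemma contact_form_simps:
  assumes "p \<in> M"
  shows "\<omega> p [u + v] = \<omega> p [u] + \<omega> p [v]" "\<omega> p [u - v] = \<omega> p [u] - \<omega> p [v]"
    "\<omega> p [r *\<^sub>R u] = r * \<omega> p [u]" "\<omega> p [- u] = - \<omega> p [u]"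
  using linear_add[OF contact_form_linear[OF assms]] linear_diff[OF contact_form_linear[OF assms]]
    linear_cmul[OF contact_form_linear[OF assms]] linear_neg[OF contact_form_linear[OF assms]]
  by simp_all

lemma alternating_dw: "p \<in> M \<Longrightarrow> alternating 2 (ext_deriv A \<omega> p)"
  using alternating_ext_deriv_form1[OF contact_manifold contact_form] .

lemma dw_linear_left: "p \<in> M \<Longrightarrow> linear (\<lambda>u. ext_deriv A \<omega> p [u, v])"
  using alternating_linear[OF alternating_dw, of p "[0, v]" 0] by simp

lemma dw_linear_right: "p \<in> M \<Longrightarrow> linear (\<lambda>v. ext_deriv A \<omega> p [u, v])"
  using alternating_linear[OF alternating_dw, of p "[u, 0]" 1] by simp

lemma dw_simps:
  assumes "p \<in> M"
  shows "ext_deriv A \<omega> p [u + u', v] = ext_deriv A \<omega> p [u, v] + ext_deriv A \<omega> p [u', v]"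
    "ext_deriv A \<omega> p [u - u', v] = ext_deriv A \<omega> p [u, v] - ext_deriv A \<omega> p [u', v]"
    "ext_deriv A \<omega> p [r *\<^sub>R u, v] = r * ext_deriv A \<omega> p [u, v]"
    "ext_deriv A \<omega> p [v, u + u'] = ext_deriv A \<omega> p [v, u] + ext_deriv A \<omega> p [v, u']"
    "ext_deriv A \<omega> p [v, u - u'] = ext_deriv A \<omega> p [v, u] - ext_deriv A \<omega> p [v, u']"
    "ext_deriv A \<omega> p [v, r *\<^sub>R u] = r * ext_deriv A \<omega> p [v, u]"
  using linear_add[OF dw_linear_left[OF assms]] linear_diff[OF dw_linear_left[OF assms]]
    linear_cmul[OF dw_linear_left[OF assms]] linear_add[OF dw_linear_right[OF assms]]
    linear_diff[OF dw_linear_right[OF assms]] linear_cmul[OF dw_linear_right[OF assms]]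
  by simp_all

lemma dw_self: "p \<in> M \<Longrightarrow> ext_deriv A \<omega> p [u, u] = 0"
  using alternating_eq_zero[OF alternating_dw, of p "[u, u]" 0 1] by simp

lemma dw_skew: "p \<in> M \<Longrightarrow> ext_deriv A \<omega> p [u, v] = - ext_deriv A \<omega> p [v, u]"
  using alternating_swap[OF alternating_dw, of p "[u, v]" 0 1 u v] by simp

lemma alternating_dw_power: "p \<in> M \<Longrightarrow> alternating (2 * n) (wedge_power (ext_deriv A \<omega>) n p)"
  using alternating_wedge_power[where \<beta> = "ext_deriv A \<omega>" and p = p, OF alternating_dw] .

lemma contact_volume_Cons:
  assumes "p \<in> M" "length ds = 2 * n" "\<And>d. d \<in> set ds \<Longrightarrow> \<omega> p [d] = 0"
  shows "contact_volume A n \<omega> p (T # ds) = \<omega> p [T] * wedge_power (ext_deriv A \<omega>) n p ds"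
  unfolding contact_volume_def
  by (rule wedge_1_kernel[where \<beta> = "wedge_power (ext_deriv A \<omega>) n" and p = p and \<alpha> = \<omega>, OF alternating_dw_power])
    (use assms in auto)

lemma alternating_contact_volume: "p \<in> M \<Longrightarrow> alternating (Suc (2 * n)) (contact_volume A n \<omega> p)"
proof -
  assume p: "p \<in> M"
  have "alternating 1 (\<omega> p)" using contact_form p by (simp add: smooth_form_def)
  from alternating_wedge[where \<alpha> = \<omega> and \<beta> = "wedge_power (ext_deriv A \<omega>) n" and p = p, OF this alternating_dw_power[OF p]]
  show ?thesis by (simp add: contact_volume_def)
qed

lemma contact_volume_nonzero:
  assumes "p \<in> M" "length vs = Suc (2 * n)" "span (set vs) = UNIV"
  shows "contact_volume A n \<omega> p vs \<noteq> 0"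
proof -
  obtain us where "length us = 2 * n + 1" "contact_volume A n \<omega> p us \<noteq> 0"
    using C assms(1) unfolding contact_sub_riemannian_def by blast
  then show ?thesis
    using alternating_nonzero_of_spanning[of "contact_volume A n \<omega> p" us vs]
      alternating_contact_volume assms by (simp add: contact_dim)
qed

text \<open>If the form vanished at \<open>p\<close>, all vectors would lie in its kernel and
  \<open>contact_volume_Cons\<close> would make the contact volume vanish on a basis.\<close>

lemma contact_form_nonzero:
  assumes "p \<in> M" obtains T where "\<omega> p [T] \<noteq> 0"
proof -
  obtain T ds where b: "(basis_list :: 'e list) = T # ds"
    using length_basis_list[where 'a='e] contact_dim by (metis Suc_eq_plus1 length_Suc_conv)
  have "contact_volume A n \<omega> p (T # ds) \<noteq> 0" "length ds = 2 * n"
    using contact_volume_nonzero[OF assms, of "T # ds"] span_basis_list[where 'a='e]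
      length_basis_list[where 'a='e] contact_dim by (auto simp: b)
  then show ?thesis using contact_volume_Cons[OF assms, of ds T] that by (metis mult_zero_left)
qed

lemma dw_power_nonzero:
  assumes "p \<in> M" "length ds = 2 * n" "\<And>d. d \<in> set ds \<Longrightarrow> \<omega> p [d] = 0" "span (insert T (set ds)) = UNIV"
  shows "wedge_power (ext_deriv A \<omega>) n p ds \<noteq> 0"
  using contact_volume_nonzero[OF assms(1), of "T # ds"] contact_volume_Cons[OF assms(1-3), of T] assms by simp

text \<open>A nonzero horizontal \<open>v\<close> with this property is part of a basis of the
  distribution, on which the power of \<open>d\<omega>\<close> would then vanish, against the
  contact condition.\<close>

lemma dw_nondegenerate:
  assumes p: "p \<in> M" and v: "\<omega> p [v] = 0" and z: "\<And>u. \<omega> p [u] = 0 \<Longrightarrow> ext_deriv A \<omega> p [v, u] = 0"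
  shows "v = 0"
proof (rule ccontr)
  assume "v \<noteq> 0"
  obtain T where T: "\<omega> p [T] \<noteq> 0" using contact_form_nonzero[OF p] .
  obtain ds where ds: "{v} \<subseteq> set ds" "\<And>x. x \<in> set ds \<Longrightarrow> \<omega> p [x] = 0" "length ds + 1 = DIM('e)"
    "span (insert T (set ds)) = UNIV"
    by (rule kernel_basis[OF contact_form_linear[OF p] T, of "{v}"]) (use \<open>v \<noteq> 0\<close> v in auto)
  have l: "length ds = 2 * n" using ds contact_dim by simp
  then have "n > 0" using ds(1) by (cases n) auto
  have "wedge_power (ext_deriv A \<omega>) n p ds = 0"
  proof (rule wedge_power_degenerate[OF \<open>n > 0\<close> l])
    show "v \<in> set ds" using ds by simp
    show "ext_deriv A \<omega> p [v, w] = 0" if "w \<in> set ds" for w using z ds(2) that by blast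
    then show "ext_deriv A \<omega> p [w, v] = 0" if "w \<in> set ds" for w using that dw_skew[OF p, of w v] by simp
  qed
  then show False using dw_power_nonzero[OF p l ds(2,4)] by blast
qed

lemma reeb_unique:
  assumes p: "p \<in> M" and "\<omega> p [v] = 1" "\<And>w. ext_deriv A \<omega> p [v, w] = 0"
    "\<omega> p [v'] = 1" "\<And>w. ext_deriv A \<omega> p [v', w] = 0"
  shows "v = v'"
  using dw_nondegenerate[OF p, of "v - v'"] assms by (simp add: contact_form_simps dw_simps)

text \<open>A transversal \<open>T\<close> is corrected by a horizontal \<open>d\<close> that pairs
  with the distribution under \<open>d\<omega>\<close> exactly as \<open>T\<close> does;
  \<open>T - d\<close>, rescaled, is the Reeb vector.\<close>

lemma reeb_exists:
  assumes p: "p \<in> M"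
  obtains v where "\<omega> p [v] = 1" "\<And>w. ext_deriv A \<omega> p [v, w] = 0"
proof -
  obtain T where T: "\<omega> p [T] \<noteq> 0" using contact_form_nonzero[OF p] .
  note lw = contact_form_linear[OF p] and l1 = dw_linear_left[OF p] and l2 = dw_linear_right[OF p]
  let ?w = "\<lambda>v. \<omega> p [v]" and ?b = "\<lambda>u v. ext_deriv A \<omega> p [u, v]"
  define c where "c = 1 / ?w T"
  have c: "c * ?w T = 1" using T by (simp add: c_def)
  define P where "P = (\<lambda>u. u - (?w u * c) *\<^sub>R T)"
  have P: "linear P"
    unfolding P_def by (auto simp: linear_iff contact_form_simps[OF p] algebra_simps)
  have wP: "?w (P u) = 0" for u
  proof -
    have "?w (P u) = ?w u - ?w u * (c * ?w T)" by (simp only: P_def contact_form_simps[OF p] mult.assoc)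
    then show ?thesis unfolding c by simp
  qed
  have PT: "P T = 0" unfolding P_def using c by (simp add: mult.commute)
  have Pk: "P u = u" if "?w u = 0" for u using that by (simp add: P_def)
  \<comment> \<open>\<open>nondegenerate_bij\<close> works on a whole space, so
    \<open>d\<omega>\<close> is extended from the distribution: \<open>P\<close> projects along
    \<open>T\<close>, and the second summand makes the extension nondegenerate in the direction of
    \<open>T\<close>.\<close>
  define k where "k = (\<lambda>u v. ?b (P u) (P v) + ?w u * ?w v)"
  have k1: "linear (k u)" and k2: "linear (\<lambda>u. k u v)" for u v
    unfolding k_def using P
    by (auto intro!: linearI simp: linear_add linear_cmul contact_form_simps[OF p] dw_simps[OF p] algebra_simps)
  have k3: "u = 0" if u: "\<And>v. k u v = 0" for u
  proof -
    have w: "?w u = 0" using u[of T] T linear_0[OF l2] by (simp add: k_def PT)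
    have "?b u v = 0" if "?w v = 0" for v using u[of v] w that by (simp add: k_def Pk)
    then show ?thesis using dw_nondegenerate[OF p w] by blast
  qed
  have lP: "linear (\<lambda>v. ?b T (P v))" using linear_compose[OF P l2[of T]] by (simp add: o_def)
  obtain d where d: "\<And>v. k d v = ?b T (P v)" using nondegenerate_bij[OF k1 k2 k3 lP] by blast
  have wd: "?w d = 0" using d[of T] T linear_0[OF l2] by (simp add: k_def PT)
  have bd: "?b d v = ?b T v" if "?w v = 0" for v using d[of v] that wd by (simp add: k_def Pk)
  define X where "X = (1 / ?w T) *\<^sub>R (T - d)"
  have wX: "?w X = 1" unfolding X_def using T wd by (simp add: contact_form_simps[OF p])
  have bX: "?b X v = 0" if "?w v = 0" for v
    unfolding X_def using bd[OF that] by (simp add: dw_simps[OF p])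
  \<comment> \<open>Beyond the horizontal vectors only the direction of \<open>X\<close> remains, on
    which \<open>d\<omega>\<close> vanishes because it is alternating.\<close>
  have "?b X v = 0" for v
  proof -
    have "?w (v - ?w v *\<^sub>R X) = 0" using wX by (simp add: contact_form_simps[OF p])
    then have "?b X (v - ?w v *\<^sub>R X) = 0" by (rule bX)
    then show ?thesis using dw_self[OF p] by (simp add: dw_simps[OF p])
  qed
  then show ?thesis using wX that by blast
qed

lemma reeb:
  assumes p: "p \<in> M"
  shows "\<omega> p [reeb A \<omega> p] = 1" "ext_deriv A \<omega> p [reeb A \<omega> p, w] = 0"
proof -
  have "\<exists>!v. \<omega> p [v] = 1 \<and> (\<forall>w. ext_deriv A \<omega> p [v, w] = 0)"
  proof -
    obtain v where "\<omega> p [v] = 1" "\<And>w. ext_deriv A \<omega> p [v, w] = 0" using reeb_exists[OF p] by blast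
    then show ?thesis using reeb_unique[OF p] by blast
  qed
  from theI'[OF this] show "\<omega> p [reeb A \<omega> p] = 1" "ext_deriv A \<omega> p [reeb A \<omega> p, w] = 0"
    by (simp_all add: reeb_def)
qed

section \<open>The horizontal projection and the horizontal metric\<close>

lemma contact_form_horizontal_part: "p \<in> M \<Longrightarrow> \<omega> p [horizontal_part A \<omega> p u] = 0"
  using reeb by (simp add: horizontal_part_def contact_form_simps)

lemma horizontal_part_id: "\<omega> p [u] = 0 \<Longrightarrow> horizontal_part A \<omega> p u = u"
  by (simp add: horizontal_part_def)

lemma theta0_eq:
  assumes p: "p \<in> M"
  shows "theta0 A \<omega> p = (\<lambda>v. \<omega> p [v])"
  unfolding theta0_def
proof (rule the_equality)
  show "linear (\<lambda>v. \<omega> p [v]) \<and> \<omega> p [reeb A \<omega> p] = 1 \<and> (\<forall>v\<in>distribution \<omega> p. \<omega> p [v] = 0)"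
    using contact_form_linear[OF p] reeb[OF p] by (simp add: distribution_def)
next
  fix t :: "'e \<Rightarrow> real" assume t: "linear t \<and> t (reeb A \<omega> p) = 1 \<and> (\<forall>v\<in>distribution \<omega> p. t v = 0)"
  show "t = (\<lambda>v. \<omega> p [v])"
  proof
    fix v
    have "t (horizontal_part A \<omega> p v) = 0"
      using t contact_form_horizontal_part[OF p] by (simp add: distribution_def)
    then show "t v = \<omega> p [v]" using t by (simp add: horizontal_part_def linear_diff linear_cmul)
  qed
qed

lemma riem_approx_eq:
  "p \<in> M \<Longrightarrow> riem_approx A \<omega> g \<epsilon> p u v = horizontal_metric A \<omega> g p u v + 1 / \<epsilon>\<^sup>2 * (\<omega> p [u] * \<omega> p [v])"
  by (simp add: riem_approx_def theta0_eq horizontal_metric_def horizontal_part_def)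

lemma linear_horizontal_part: "p \<in> M \<Longrightarrow> linear (horizontal_part A \<omega> p)"
  unfolding horizontal_part_def by (intro linearI) (simp_all add: contact_form_simps algebra_simps)

lemma inner_on_distribution: "p \<in> M \<Longrightarrow> inner_product_on (distribution \<omega> p) (g p)"
  using contact_metric by (simp add: smooth_fibre_inner_product_def)

lemma horizontal_metric_commute: "p \<in> M \<Longrightarrow> horizontal_metric A \<omega> g p u v = horizontal_metric A \<omega> g p v u"
  using inner_on_distribution contact_form_horizontal_part
  by (simp add: horizontal_metric_def inner_product_on_def distribution_def)

lemma linear_horizontal_metric_left: "p \<in> M \<Longrightarrow> linear (\<lambda>u. horizontal_metric A \<omega> g p u v)"
  using inner_on_distribution contact_form_horizontal_part linear_horizontal_part
  by (intro linearI) (auto simp: horizontal_metric_def inner_product_on_def distribution_def linear_add linear_cmul)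

lemma linear_horizontal_metric_right: "p \<in> M \<Longrightarrow> linear (horizontal_metric A \<omega> g p u)"
proof -
  assume p: "p \<in> M"
  have "horizontal_metric A \<omega> g p u = (\<lambda>v. horizontal_metric A \<omega> g p v u)"
    using horizontal_metric_commute[OF p] by blast
  then show ?thesis using linear_horizontal_metric_left[OF p, of u] by simp
qed

lemma horizontal_metric_nonneg: "p \<in> M \<Longrightarrow> horizontal_metric A \<omega> g p u u \<ge> 0"
  and horizontal_metric_eq_0: "p \<in> M \<Longrightarrow> horizontal_metric A \<omega> g p u u = 0 \<Longrightarrow> horizontal_part A \<omega> p u = 0"
proof -
  assume p: "p \<in> M"
  let ?h = "horizontal_part A \<omega> p u"
  have "?h \<noteq> 0 \<Longrightarrow> g p ?h ?h > 0"
    using inner_on_distribution[OF p] contact_form_horizontal_part[OF p]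
    by (simp add: inner_product_on_def distribution_def)
  \<comment> \<open>\<open>inner_product_on\<close> asserts positivity for nonzero vectors only; the
    value at zero is obtained by scaling with 0.\<close>
  moreover have "g p (0 *\<^sub>R ?h) ?h = 0 * g p ?h ?h"
    using inner_on_distribution[OF p] contact_form_horizontal_part[OF p]
    unfolding inner_product_on_def distribution_def by blast
  ultimately show "horizontal_metric A \<omega> g p u u \<ge> 0"
    "horizontal_metric A \<omega> g p u u = 0 \<Longrightarrow> ?h = 0"
    unfolding horizontal_metric_def by (cases "?h = 0"; force)+
qed

lemma horizontal_metric_eq:
  "\<omega> p [u] = 0 \<Longrightarrow> \<omega> p [v] = 0 \<Longrightarrow> horizontal_metric A \<omega> g p u v = g p u v"
  by (simp add: horizontal_metric_def horizontal_part_id)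

lemma horizontal_metric_definite: "p \<in> M \<Longrightarrow> \<omega> p [u] = 0 \<Longrightarrow> horizontal_metric A \<omega> g p u u = 0 \<Longrightarrow> u = 0"
  using horizontal_metric_eq_0 horizontal_part_id by metis

text \<open>Multiplying the normalisation by its sign gives
  \<open>\<bar>w\<bar> = fact n * sqrt (gram_det (g p) ds)\<close>. As \<open>sqrt\<close> is
  positive only at positive arguments, \<open>w \<noteq> 0\<close> already yields the positivity of
  the Gram determinant.\<close>

lemma gram_det_contact:
  assumes p: "p \<in> M" and ds: "length ds = 2 * n" "\<And>d. d \<in> set ds \<Longrightarrow> \<omega> p [d] = 0"
    and nz: "wedge_power (ext_deriv A \<omega>) n p ds \<noteq> 0"
  shows "gram_det (g p) ds > 0" "(wedge_power (ext_deriv A \<omega>) n p ds)\<^sup>2 = (fact n)\<^sup>2 * gram_det (g p) ds"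
proof -
  define w where "w = wedge_power (ext_deriv A \<omega>) n p ds"
  have "set ds \<subseteq> distribution \<omega> p" using ds by (auto simp: distribution_def)
  then have "w = fact n * volume_form g (wedge_power (ext_deriv A \<omega>) n) p ds"
    using C p ds(1) unfolding contact_sub_riemannian_def w_def by blast
  then have w: "w = fact n * (sgn w * sqrt (gram_det (g p) ds))"
    by (simp add: volume_form_def w_def)
  have "\<bar>w\<bar> = w * sgn w" by (simp add: abs_sgn)
  also have "\<dots> = fact n * (sgn w * sgn w) * sqrt (gram_det (g p) ds)"
    by (subst (1) w) simp
  also have "sgn w * sgn w = 1" using nz by (simp add: w_def[symmetric] sgn_real_def)
  finally have a: "\<bar>w\<bar> = fact n * sqrt (gram_det (g p) ds)" by simp
  moreover have "\<bar>w\<bar> > 0" using nz by (simp add: w_def)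
  ultimately have "sqrt (gram_det (g p) ds) > 0" by (metis fact_gt_zero zero_less_mult_pos)
  then show pos: "gram_det (g p) ds > 0" by simp
  have "w\<^sup>2 = \<bar>w\<bar>\<^sup>2" by simp
  also have "\<dots> = (fact n)\<^sup>2 * gram_det (g p) ds"
    unfolding a using pos by (simp add: power_mult_distrib)
  finally show "(wedge_power (ext_deriv A \<omega>) n p ds)\<^sup>2 = (fact n)\<^sup>2 * gram_det (g p) ds"
    by (simp add: w_def)
qed

end

section \<open>The metrics induced on the hypersurface\<close>

definition hyp_form ::
    "('m, 'e::euclidean_space) chart set \<Rightarrow> ('m, 'e) form \<Rightarrow> ('m, 's::euclidean_space) chart set \<Rightarrow> 'm \<Rightarrow> 's \<Rightarrow> real" where
  "hyp_form A \<omega> B p v = \<omega> p [incl B A p v]"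

text \<open>For \<open>t = 1 / \<epsilon>\<^sup>2\<close> this is the metric induced on the hypersurface by the Riemannian approximation.\<close>

definition hyp_metric ::
    "('m, 'e::euclidean_space) chart set \<Rightarrow> ('m, 'e) form \<Rightarrow> ('m \<Rightarrow> 'e \<Rightarrow> 'e \<Rightarrow> real) \<Rightarrow>
     ('m, 's::euclidean_space) chart set \<Rightarrow> real \<Rightarrow> 'm \<Rightarrow> 's \<Rightarrow> 's \<Rightarrow> real" where
  "hyp_metric A \<omega> g B t p u v = horizontal_metric A \<omega> g p (incl B A p u) (incl B A p v) +
     t * (hyp_form A \<omega> B p u * hyp_form A \<omega> B p v)"

text \<open>
  The bordered form on \<open>T\<^sub>pS \<times> \<real>\<close> for \<open>s = \<epsilon>\<^sup>2\<close>: eliminating the multiplier turns it into \<open>hyp_metric\<close> with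
  \<open>t = 1 / s\<close>, whereas for \<open>s = 0\<close> the multiplier enforces the constraint \<open>hyp_form = 0\<close>.
\<close>

definition bordered_form ::
    "('s \<Rightarrow> 's \<Rightarrow> real) \<Rightarrow> ('s \<Rightarrow> real) \<Rightarrow> real \<Rightarrow> 's \<times> real \<Rightarrow> 's \<times> real \<Rightarrow> real" where
  "bordered_form h t s x y = h (fst x) (fst y) + snd x * t (fst y) + t (fst x) * snd y - s * snd x * snd y"

context
  fixes M S :: "'m::{t2_space,second_countable_topology} set"
    and A :: "('m, 'e::euclidean_space) chart set"
    and B :: "('m, 's::euclidean_space) chart set"
    and n :: nat and \<omega> :: "('m, 'e) form" and g :: "'m \<Rightarrow> 'e \<Rightarrow> 'e \<Rightarrow> real"
  assumes C: "contact_sub_riemannian M A n \<omega> g"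
    and emb: "embedded_hypersurface M A S B"
begin

lemma hypersurface_dim: "DIM('s) = 2 * n"
  using hyp_dim[OF contact_manifold[OF C] emb] contact_dim[OF C] by simp

lemma induced_metric_eq:
  "p \<in> S \<Longrightarrow> induced_metric A B (riem_approx A \<omega> g \<epsilon>) p = hyp_metric A \<omega> g B (1 / \<epsilon>\<^sup>2) p"
  using riem_approx_eq[OF C] hyp_subset[OF contact_manifold[OF C] emb]
  by (auto simp: fun_eq_iff induced_metric_def hyp_metric_def hyp_form_def)

context
  fixes p assumes p: "p \<in> S - characteristic_points A \<omega> S B"
begin

lemma pS: "p \<in> S" and pM: "p \<in> M"
  using p hyp_subset[OF contact_manifold[OF C] emb] by auto

lemma incl_linear: "linear (incl B A p)"
  using linear_incl[OF contact_manifold[OF C] emb pS] .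

lemma incl_inj: "inj (incl B A p)"
  using hyp_inj[OF contact_manifold[OF C] emb pS] .

lemma hyp_form_linear: "linear (hyp_form A \<omega> B p)"
  using linear_compose[OF incl_linear contact_form_linear[OF C pM]]
  by (simp add: hyp_form_def[abs_def] o_def)

text \<open>If the restricted form were zero, the tangent space of \<open>S\<close> would lie in the
  distribution and, having at least its dimension, coincide with it; the point would be
  characteristic.\<close>

lemma hyp_form_nonzero: obtains v where "hyp_form A \<omega> B p v \<noteq> 0"
proof -
  obtain T where T: "\<omega> p [T] \<noteq> 0" using contact_form_nonzero[OF C pM] .
  have "\<exists>v. hyp_form A \<omega> B p v \<noteq> 0"
  proof (rule ccontr)
    assume "\<nexists>v. hyp_form A \<omega> B p v \<noteq> 0"
    then have sub: "range (incl B A p) \<subseteq> distribution \<omega> p"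
      by (auto simp: distribution_def hyp_form_def)
    have s1: "subspace (range (incl B A p))"
      using incl_linear subspace_UNIV linear_subspace_image by blast
    have s2: "subspace (distribution \<omega> p)"
      unfolding distribution_def using contact_form_linear[OF C pM] linear_subspace_kernel by blast
    have "T \<notin> distribution \<omega> p" using T by (simp add: distribution_def)
    then have "distribution \<omega> p \<noteq> UNIV" by auto
    then have "dim (distribution \<omega> p) \<noteq> DIM('e)" using s2 dim_eq_full by (metis span_eq_iff)
    then have "dim (distribution \<omega> p) < DIM('e)" using dim_subset_UNIV le_neq_implies_less by blast
    moreover have "dim (range (incl B A p)) = DIM('s)"
      using dim_image_eq[OF incl_linear, of UNIV] incl_inj by (simp add: inj_on_subset)
    ultimately have "dim (distribution \<omega> p) \<le> dim (range (incl B A p))"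
      using hyp_dim[OF contact_manifold[OF C] emb] by simp
    then have "range (incl B A p) = distribution \<omega> p" using subspace_dim_equal[OF s1 s2 sub] by simp
    then show False using p by (auto simp: characteristic_points_def)
  qed
  then show ?thesis using that by blast
qed

lemma hyp_metric_linear_left: "linear (\<lambda>u. hyp_metric A \<omega> g B t p u v)"
  unfolding hyp_metric_def
  using linear_compose[OF incl_linear linear_horizontal_metric_left[OF C pM, of "incl B A p v"]] hyp_form_linear
  by (intro linearI) (auto simp: o_def linear_iff algebra_simps)

lemma hyp_metric_commute: "hyp_metric A \<omega> g B t p u v = hyp_metric A \<omega> g B t p v u"
  unfolding hyp_metric_def using horizontal_metric_commute[OF C pM] by (simp add: mult.commute)

lemma hyp_metric_linear_right: "linear (hyp_metric A \<omega> g B t p u)"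
proof -
  have "hyp_metric A \<omega> g B t p u = (\<lambda>v. hyp_metric A \<omega> g B t p v u)"
    using hyp_metric_commute by blast
  then show ?thesis using hyp_metric_linear_left[of t u] by simp
qed

lemma hyp_metric_0: "hyp_metric A \<omega> g B t p u v = hyp_metric A \<omega> g B 0 p u v + t * (hyp_form A \<omega> B p u * hyp_form A \<omega> B p v)"
  by (simp add: hyp_metric_def)

lemma hyp_metric_nonneg: "t \<ge> 0 \<Longrightarrow> hyp_metric A \<omega> g B t p u u \<ge> 0"
  unfolding hyp_metric_def using horizontal_metric_nonneg[OF C pM] by simp

lemma hyp_metric_0_definite:
  assumes "hyp_form A \<omega> B p u = 0" "hyp_metric A \<omega> g B 0 p u u = 0" shows "u = 0"
proof -
  have "incl B A p u = 0"
    using horizontal_metric_definite[OF C pM, of "incl B A p u"] assms by (simp add: hyp_metric_def hyp_form_def)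
  then show ?thesis using incl_inj incl_linear by (simp add: linear_injective_0)
qed

lemma hyp_metric_definite:
  assumes "t > 0" "hyp_metric A \<omega> g B t p u u = 0" shows "u = 0"
proof -
  have "hyp_metric A \<omega> g B 0 p u u \<ge> 0" "t * (hyp_form A \<omega> B p u * hyp_form A \<omega> B p u) \<ge> 0"
    using hyp_metric_nonneg[of 0] assms(1) by auto
  then have "hyp_metric A \<omega> g B 0 p u u = 0" "t * (hyp_form A \<omega> B p u * hyp_form A \<omega> B p u) = 0"
    using assms(2) hyp_metric_0[of t u u] by linarith+
  then show ?thesis using hyp_metric_0_definite assms(1) by simp
qed

text \<open>\<open>T\<close> represents the restricted form in the metric for \<open>t = 1\<close>,
  hence is orthogonal to the kernel of that form. Since the metrics differ by multiples of the
  squared form, \<open>T\<close> is orthogonal to the kernel for every \<open>t\<close>, and in this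
  frame only one diagonal entry of the Gram matrix involves \<open>t\<close>.\<close>

lemma adapted_frame:
  obtains fs T where "length (fs @ [T]) = 2 * n" "\<And>f. f \<in> set fs \<Longrightarrow> hyp_form A \<omega> B p f = 0"
    "hyp_form A \<omega> B p T > 0" "\<And>f. f \<in> set fs \<Longrightarrow> hyp_metric A \<omega> g B 0 p T f = 0"
    "span (set (fs @ [T])) = UNIV"
proof -
  let ?H = "hyp_metric A \<omega> g B"
  have nd: "u = 0" if "\<And>v. ?H 1 p u v = 0" for u
    using hyp_metric_definite[of 1 u] that[of u] by simp
  obtain T where T: "\<And>v. ?H 1 p T v = hyp_form A \<omega> B p v"
    using nondegenerate_bij[OF hyp_metric_linear_right hyp_metric_linear_left nd hyp_form_linear, of 1] by blast
  obtain v where "hyp_form A \<omega> B p v \<noteq> 0" by (rule hyp_form_nonzero)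
  then have "T \<noteq> 0" using T[of v] linear_0[OF hyp_metric_linear_left] by force
  then have pos: "hyp_form A \<omega> B p T > 0"
    using T[of T] hyp_metric_definite[of 1 T] hyp_metric_nonneg[of 1 T] by fastforce
  obtain fs where fs: "\<And>x. x \<in> set fs \<Longrightarrow> hyp_form A \<omega> B p x = 0" "length fs + 1 = DIM('s)"
    "span (insert T (set fs)) = UNIV"
    by (rule kernel_basis[OF hyp_form_linear, of T "{}"]) (use pos independent_empty in auto)
  show ?thesis
  proof (rule that[of fs T])
    show "?H 0 p T f = 0" if "f \<in> set fs" for f
      using T[of f] fs(1)[OF that] hyp_metric_0[of 1 T f] by simp
  qed (use fs pos hypersurface_dim in auto)
qed

section \<open>Unit normals and the volume they induce\<close>

text \<open>The conditions on \<open>sub_normal\<close> apart from orientation; they determine a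
  vector up to sign.\<close>

definition unit_normal :: "'e \<Rightarrow> bool" where
  "unit_normal N \<longleftrightarrow> \<omega> p [N] = 0 \<and> g p N N = 1 \<and> (\<forall>y. hyp_form A \<omega> B p y = 0 \<longrightarrow> g p N (incl B A p y) = 0)"

text \<open>A Euclidean normal \<open>x\<close> to the image of the tangent space defines a
  covector. Its representative \<open>R\<close> in the metric \<open>k\<close>, projected to the
  distribution and rescaled, is the normal.\<close>

lemma unit_normal_exists: obtains N where "unit_normal N"
proof -
  let ?i = "incl B A p" and ?h = "horizontal_metric A \<omega> g p" and ?w = "\<lambda>v. \<omega> p [v]"
  have "dim (range ?i) \<le> DIM('s)" using dim_image_le[OF incl_linear, of UNIV] by simp
  then have "dim (range ?i) < DIM('e)" using hyp_dim[OF contact_manifold[OF C] emb] by simp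
  then obtain x where x: "x \<noteq> 0" "\<And>y. y \<in> span (range ?i) \<Longrightarrow> orthogonal x y"
    using orthogonal_to_subspace_exists by blast
  have l: "linear (\<lambda>v. x \<bullet> v)" by (simp add: bounded_linear.linear bounded_linear_inner_right)
  \<comment> \<open>A positive definite extension of the fibre metric to the whole tangent
    space.\<close>
  define k where "k = (\<lambda>u v. ?h u v + ?w u * ?w v)"
  have k1: "linear (k u)" and k2: "linear (\<lambda>u. k u v)" for u v
    unfolding k_def
    using linear_horizontal_metric_right[OF C pM, of u] linear_horizontal_metric_left[OF C pM, of v]
    by (auto simp: linear_iff contact_form_simps[OF C pM] algebra_simps)
  have k3: "u = 0" if "\<And>v. k u v = 0" for u
  proof -
    have "?h u u \<ge> 0" "?w u * ?w u \<ge> 0" using horizontal_metric_nonneg[OF C pM] by auto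
    then have "?h u u = 0" "?w u = 0" using that[of u] by (simp_all add: k_def add_nonneg_eq_0_iff)
    then show ?thesis using horizontal_metric_definite[OF C pM] by blast
  qed
  obtain R where R: "\<And>v. k R v = x \<bullet> v" using nondegenerate_bij[OF k1 k2 k3 l] by blast
  define N where "N = horizontal_part A \<omega> p R"
  have wN: "?w N = 0" unfolding N_def by (rule contact_form_horizontal_part[OF C pM])
  have hN: "?h R v = ?h N v" for v
    unfolding horizontal_metric_def N_def
    using horizontal_part_id[OF C contact_form_horizontal_part[OF C pM]] by simp
  have perp: "g p N (?i y) = 0" if "hyp_form A \<omega> B p y = 0" for y
  proof -
    have wy: "?w (?i y) = 0" using that by (simp add: hyp_form_def)
    have "x \<bullet> ?i y = 0" using x(2)[of "?i y"] by (simp add: orthogonal_def span_base)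
    then have "?h N (?i y) = 0" using R[of "?i y"] wy by (simp add: k_def hN)
    then show ?thesis using horizontal_metric_eq[OF C wN wy] by simp
  qed
  \<comment> \<open>Otherwise the covector of \<open>x\<close> would be a multiple of \<omega>. It
    kills a tangent vector on which \<omega> is nonzero, so the factor and then \<open>x\<close>
    itself would be zero.\<close>
  have "N \<noteq> 0"
  proof
    assume N0: "N = 0"
    have "?h N v = 0" for v using linear_0[OF linear_horizontal_metric_left[OF C pM]] N0 by simp
    then have e: "?w R * ?w v = x \<bullet> v" for v using R[of v] by (simp add: k_def hN)
    obtain v where "hyp_form A \<omega> B p v \<noteq> 0" by (rule hyp_form_nonzero)
    then have "?w (?i v) \<noteq> 0" by (simp add: hyp_form_def)
    moreover have "x \<bullet> ?i v = 0" using x(2)[of "?i v"] by (simp add: orthogonal_def span_base)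
    ultimately have "?w R = 0" using e[of "?i v"] by simp
    then have "x \<bullet> x = 0" using e[of x] by simp
    then show False using x(1) by simp
  qed
  then have "?h N N \<noteq> 0" using horizontal_metric_definite[OF C pM wN] by blast
  then have pos: "?h N N > 0" using horizontal_metric_nonneg[OF C pM, of N] by simp
  define N1 where "N1 = (1 / sqrt (?h N N)) *\<^sub>R N"
  have w1: "?w N1 = 0" unfolding N1_def using wN linear_cmul[OF contact_form_linear[OF C pM]] by simp
  have h1: "?h N1 v = 1 / sqrt (?h N N) * ?h N v" for v
    unfolding N1_def using linear_cmul[OF linear_horizontal_metric_left[OF C pM]] by simp
  have "?h N1 N1 = 1 / sqrt (?h N N) * (1 / sqrt (?h N N) * ?h N N)"
    unfolding h1 using horizontal_metric_commute[OF C pM, of N N1] h1[of N] by simp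
  also have "\<dots> = 1" using pos by (simp add: field_simps)
  finally have "g p N1 N1 = 1" using horizontal_metric_eq[OF C w1 w1] by simp
  moreover have "g p N1 (?i y) = 0" if "hyp_form A \<omega> B p y = 0" for y
  proof -
    have wy: "?w (?i y) = 0" using that by (simp add: hyp_form_def)
    show ?thesis
      using h1[of "?i y"] perp[OF that] horizontal_metric_eq[OF C wN wy] horizontal_metric_eq[OF C w1 wy] by simp
  qed
  ultimately have "unit_normal N1" using w1 by (simp add: unit_normal_def)
  then show ?thesis by (rule that)
qed

lemma unit_normal_not_tangent:
  assumes N: "unit_normal N" shows "N \<notin> range (incl B A p)"
proof
  assume "N \<in> range (incl B A p)"
  then obtain v where v: "N = incl B A p v" by blast
  then have "hyp_form A \<omega> B p v = 0" using N by (simp add: unit_normal_def hyp_form_def)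
  then have "g p N N = 0" using N v unfolding unit_normal_def by blast
  then show False using N by (simp add: unit_normal_def)
qed

lemma unit_normal_span:
  assumes N: "unit_normal N" shows "span (insert N (range (incl B A p))) = UNIV"
proof -
  have s: "subspace (range (incl B A p))"
    using incl_linear subspace_UNIV linear_subspace_image by blast
  have "dim (range (incl B A p)) = DIM('s)"
    using dim_image_eq[OF incl_linear, of UNIV] incl_inj by (simp add: inj_on_subset)
  then have "dim (insert N (range (incl B A p))) = DIM('e)"
    using unit_normal_not_tangent[OF N] s hyp_dim[OF contact_manifold[OF C] emb]
    by (simp add: dim_insert span_eq_iff[THEN iffD2])
  then show ?thesis by (simp add: dim_eq_full)
qed

text \<open>The part \<open>v\<close> of \<open>N'\<close> orthogonal to \<open>N\<close> is
  horizontal. Splitting it into a tangent vector and a multiple of \<open>N\<close> shows that it is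
  orthogonal to itself, so \<open>N'\<close> is a multiple of \<open>N\<close>, and both have length
  one.\<close>

lemma unit_normal_unique:
  assumes N: "unit_normal N" and N': "unit_normal N'"
  shows "N' = N \<or> N' = - N"
proof -
  let ?i = "incl B A p" and ?h = "horizontal_metric A \<omega> g p" and ?w = "\<lambda>v. \<omega> p [v]"
  note wl = contact_form_linear[OF C pM] and hl = linear_horizontal_metric_left[OF C pM]
    and hr = linear_horizontal_metric_right[OF C pM] and hc = horizontal_metric_commute[OF C pM]
  have w: "?w N = 0" "?w N' = 0" using N N' by (auto simp: unit_normal_def)
  define c where "c = ?h N' N"
  define v where "v = N' - c *\<^sub>R N"
  have wv: "?w v = 0" using w by (simp add: v_def contact_form_simps[OF C pM])
  have NN: "?h N N = 1" "?h N' N' = 1" using N N' horizontal_metric_eq[OF C] by (auto simp: unit_normal_def)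
  have hd: "?h (x - r *\<^sub>R y) z = ?h x z - r * ?h y z" for x y z r
    using linear_diff[OF hl[of z], of x "r *\<^sub>R y"] linear_cmul[OF hl[of z], of r y] by simp
  have vN: "?h v N = 0" using NN by (simp add: v_def hd c_def)
  have perp: "?h X (?i y) = 0" if "unit_normal X" "hyp_form A \<omega> B p y = 0" for X y
    using that horizontal_metric_eq[OF C, of p X "?i y"] by (auto simp: unit_normal_def hyp_form_def)
  have "v \<in> span (insert N (range ?i))" using unit_normal_span[OF N] by simp
  then obtain b where "v - b *\<^sub>R N \<in> span (range ?i)" by (auto simp: span_breakdown_eq)
  moreover have "subspace (range ?i)"
    using incl_linear subspace_UNIV linear_subspace_image by blast
  ultimately obtain u where u: "v - b *\<^sub>R N = ?i u" by (auto simp: span_eq_iff[THEN iffD2])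
  have "?w (?i u) = 0" unfolding u[symmetric] using wv w by (simp add: contact_form_simps[OF C pM])
  then have tu: "hyp_form A \<omega> B p u = 0" by (simp add: hyp_form_def)
  have "?h v (?i u) = 0"
    using perp[OF N tu] perp[OF N' tu] by (simp add: v_def hd)
  moreover have "v = ?i u + b *\<^sub>R N" using u by (simp add: algebra_simps)
  then have "?h v v = ?h v (?i u) + b * ?h v N"
    using linear_add[OF hr[of v], of "?i u" "b *\<^sub>R N"] linear_cmul[OF hr[of v], of b N] by simp
  ultimately have "?h v v = 0" using vN by simp
  then have "v = 0" using horizontal_metric_definite[OF C pM wv] by blast
  then have e: "N' = c *\<^sub>R N" by (simp add: v_def)
  then have "?h N' N' = c * (c * ?h N N)"
    using linear_cmul[OF hl[of "c *\<^sub>R N"], of c N] linear_cmul[OF hr[of N], of c N] by simp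
  then have "c = 1 \<or> c = - 1" using NN by (simp add: power2_eq_1_iff[symmetric] power2_eq_square)
  then show ?thesis using e by auto
qed

text \<open>\<open>hyp_volume\<close> for an arbitrary candidate \<open>N\<close>, studied before
  the sign of the normal is fixed.\<close>

definition normal_volume :: "'e \<Rightarrow> 's list \<Rightarrow> real" where
  "normal_volume N zs = contact_volume A n \<omega> p (N # map (incl B A p) zs)"

lemma alternating_normal_volume: "alternating DIM('s) (normal_volume N)"
  unfolding normal_volume_def hypersurface_dim
  using alternating_map[OF incl_linear alternating_Cons[OF alternating_contact_volume[OF C pM]]] .

lemma normal_volume_minus:
  assumes "length zs = DIM('s)" shows "normal_volume (- N) zs = - normal_volume N zs"
proof -
  have "linear (\<lambda>x. contact_volume A n \<omega> p ((N # map (incl B A p) zs)[0 := x]))"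
    by (rule alternating_linear[OF alternating_contact_volume[OF C pM]]) (use assms hypersurface_dim in auto)
  then show ?thesis unfolding normal_volume_def using linear_neg by fastforce
qed

text \<open>Exchanging \<open>N\<close> with the image of \<open>T\<close> brings the only
  non-horizontal vector to the front, so the contact volume splits into its \<omega>-value and the
  power of \<open>d\<omega>\<close> on \<open>fs\<close> and \<open>N\<close>. By the normalisation
  the square of the latter is a Gram determinant times \<open>(fact n)\<^sup>2\<close>, and the unit
  vector \<open>N\<close>, orthogonal to \<open>fs\<close>, contributes the factor 1 to it. Here
  \<open>t\<close> is free, since the metrics agree on \<open>fs\<close>.\<close>

lemma normal_volume_adapted:
  assumes N: "unit_normal N" and l: "length (fs @ [T]) = 2 * n"
    and fs: "\<And>f. f \<in> set fs \<Longrightarrow> hyp_form A \<omega> B p f = 0" and sp: "span (set (fs @ [T])) = UNIV"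
  shows "(normal_volume N (fs @ [T]))\<^sup>2 = (fact n)\<^sup>2 * (gram_det (hyp_metric A \<omega> g B t p) fs * (hyp_form A \<omega> B p T)\<^sup>2)"
    "gram_det (hyp_metric A \<omega> g B t p) fs > 0"
proof -
  let ?i = "incl B A p"
  let ?W = "wedge_power (ext_deriv A \<omega>) n p (map ?i fs @ [N])"
  let ?G = "gram_det (hyp_metric A \<omega> g B t p) fs"
  have w: "\<omega> p [d] = 0" if "d \<in> set (map ?i fs @ [N])" for d
    using that N fs by (auto simp: unit_normal_def hyp_form_def)
  have l': "length (map ?i fs @ [N]) = 2 * n" using l by simp
  have "range ?i = span (?i ` set (fs @ [T]))"
    using linear_span_image[OF incl_linear, of "set (fs @ [T])"] sp by simp
  also have "\<dots> \<subseteq> span (insert (?i T) (set (map ?i fs @ [N])))" by (rule span_mono) auto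
  finally have "insert N (range ?i) \<subseteq> span (insert (?i T) (set (map ?i fs @ [N])))"
    by (auto intro: span_base)
  then have "span (insert (?i T) (set (map ?i fs @ [N]))) = UNIV"
    using unit_normal_span[OF N] span_minimal[OF _ subspace_span] by blast
  then have nz: "?W \<noteq> 0" using dw_power_nonzero[OF C pM l' w] by blast
  have "gram_det (g p) (map ?i fs @ [N]) = gram_det (g p) (map ?i fs) * g p N N"
    by (rule gram_det_snoc) (use N fs in \<open>auto simp: unit_normal_def\<close>)
  also have "\<dots> = gram_det (g p) (map ?i fs)" using N by (simp add: unit_normal_def)
  also have "\<dots> = ?G"
    unfolding gram_det_def length_map
  proof (intro sum.cong prod.cong arg_cong2[where f = "(*)"] refl)
    fix \<sigma> i assume "\<sigma> \<in> {\<sigma>. \<sigma> permutes {..<length fs}}" and i: "i \<in> {..<length fs}"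
    then have s: "\<sigma> i < length fs" using permutes_in_image[of \<sigma> "{..<length fs}" i] by simp
    have "hyp_form A \<omega> B p (fs ! i) = 0" "hyp_form A \<omega> B p (fs ! \<sigma> i) = 0" using fs s i by auto
    then show "g p (map ?i fs ! i) (map ?i fs ! \<sigma> i) = hyp_metric A \<omega> g B t p (fs ! i) (fs ! \<sigma> i)"
      using s i horizontal_metric_eq[OF C] by (simp add: hyp_metric_def hyp_form_def)
  qed
  finally have G: "gram_det (g p) (map ?i fs @ [N]) = ?G" .
  show "?G > 0" using gram_det_contact(1)[OF C pM l' w nz] G by simp
  have "contact_volume A n \<omega> p (N # map ?i fs @ [?i T]) = - contact_volume A n \<omega> p (?i T # map ?i fs @ [N])"
  proof -
    let ?L = "N # map ?i fs @ [?i T]"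
    have k: "length ?L = Suc (2 * n)" "0 < Suc (2 * n)" "Suc (length fs) < Suc (2 * n)" "0 \<noteq> Suc (length fs)"
      using l by auto
    have "?L[0 := x, Suc (length fs) := y] = x # map ?i fs @ [y]" for x y
      using list_update_length[of "map ?i fs" "?i T" "[]" y] by simp
    then show ?thesis
      using alternating_swap[OF alternating_contact_volume[OF C pM] k, of N "?i T"] by simp
  qed
  also have "contact_volume A n \<omega> p (?i T # map ?i fs @ [N]) = hyp_form A \<omega> B p T * ?W"
    using contact_volume_Cons[OF C pM l' w] by (simp add: hyp_form_def)
  finally have "normal_volume N (fs @ [T]) = - (hyp_form A \<omega> B p T * ?W)"
    by (simp add: normal_volume_def)
  then show "(normal_volume N (fs @ [T]))\<^sup>2 = (fact n)\<^sup>2 * (?G * (hyp_form A \<omega> B p T)\<^sup>2)"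
    using gram_det_contact(2)[OF C pM l' w nz] G by (simp add: power_mult_distrib)
qed

text \<open>All four facts are read off in an adapted frame, where the determinant is
  \<open>\<Gamma> * (?H 0 T T + t * ?\<tau>\<^sup>2)\<close>; passing to \<open>basis_list\<close>
  divides it by the squared frame determinant \<open>d\<close>. The difference of the values at 1
  and 0 is the coefficient of \<open>t\<close>.\<close>

lemma
  shows gram_hyp_metric_affine: "gram_det (hyp_metric A \<omega> g B t p) basis_list =
      gram_det (hyp_metric A \<omega> g B 0 p) basis_list +
      t * (gram_det (hyp_metric A \<omega> g B 1 p) basis_list - gram_det (hyp_metric A \<omega> g B 0 p) basis_list)"
    and gram_hyp_metric_0_nonneg: "gram_det (hyp_metric A \<omega> g B 0 p) basis_list \<ge> 0"
    and gram_hyp_metric_diff_pos: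
      "gram_det (hyp_metric A \<omega> g B 1 p) basis_list - gram_det (hyp_metric A \<omega> g B 0 p) basis_list > 0"
    and normal_volume_square: "unit_normal N \<Longrightarrow> (normal_volume N basis_list)\<^sup>2 = (fact n)\<^sup>2 *
      (gram_det (hyp_metric A \<omega> g B 1 p) basis_list - gram_det (hyp_metric A \<omega> g B 0 p) basis_list)"
proof -
  let ?H = "\<lambda>t. hyp_metric A \<omega> g B t p" and ?b = "basis_list :: 's list"
  obtain fs T where l: "length (fs @ [T]) = 2 * n" and fs: "\<And>f. f \<in> set fs \<Longrightarrow> hyp_form A \<omega> B p f = 0"
    and T: "hyp_form A \<omega> B p T > 0" and perp: "\<And>f. f \<in> set fs \<Longrightarrow> ?H 0 T f = 0"
    and sp: "span (set (fs @ [T])) = UNIV"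
    by (rule adapted_frame) auto
  let ?z = "fs @ [T]" and ?\<tau> = "hyp_form A \<omega> B p T"
  have lz: "length ?z = DIM('s)" using l hypersurface_dim by simp
  define d where "d = (det_form ?z)\<^sup>2"
  have "det_form ?z \<noteq> 0"
    using alternating_nonzero_of_spanning[OF alternating_det_form length_basis_list _ lz sp] by simp
  then have d: "d > 0" by (simp add: d_def)
  obtain N0 where N0: "unit_normal N0" by (rule unit_normal_exists)
  define \<Gamma> where "\<Gamma> = gram_det (?H 0) fs"
  have \<Gamma>: "\<Gamma> > 0" unfolding \<Gamma>_def using normal_volume_adapted(2)[OF N0 l fs sp] .
  have z: "gram_det (?H t) ?z = \<Gamma> * (?H 0 T T + t * ?\<tau>\<^sup>2)" for t
  proof -
    have "gram_det (?H t) ?z = gram_det (?H t) fs * ?H t T T"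
      by (rule gram_det_snoc) (use perp fs hyp_metric_0[of t T] in simp)
    moreover have "gram_det (?H t) fs = \<Gamma>"
      unfolding \<Gamma>_def gram_det_def
    proof (intro sum.cong prod.cong arg_cong2[where f = "(*)"] refl)
      fix \<sigma> i assume "\<sigma> \<in> {\<sigma>. \<sigma> permutes {..<length fs}}" and i: "i \<in> {..<length fs}"
      then show "?H t (fs ! i) (fs ! \<sigma> i) = ?H 0 (fs ! i) (fs ! \<sigma> i)"
        using hyp_metric_0[of t "fs ! i" "fs ! \<sigma> i"] fs[of "fs ! i"] by simp
    qed
    ultimately show ?thesis using hyp_metric_0[of t T T] by (simp add: power2_eq_square)
  qed
  have b: "gram_det (?H t) ?b = \<Gamma> * (?H 0 T T + t * ?\<tau>\<^sup>2) / d" for t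
    using gram_det_eq_det_form[OF hyp_metric_linear_right hyp_metric_linear_left lz, of t] d
    by (simp add: z d_def field_simps)
  have D: "gram_det (?H 1) ?b - gram_det (?H 0) ?b = \<Gamma> * ?\<tau>\<^sup>2 / d"
    unfolding b by (simp add: diff_divide_distrib[symmetric] algebra_simps)
  show "gram_det (?H t) ?b = gram_det (?H 0) ?b + t * (gram_det (?H 1) ?b - gram_det (?H 0) ?b)"
    unfolding D unfolding b by (simp add: add_divide_distrib[symmetric] algebra_simps)
  show "gram_det (?H 0) ?b \<ge> 0" unfolding b using \<Gamma> d hyp_metric_nonneg[of 0 T] by simp
  show "gram_det (?H 1) ?b - gram_det (?H 0) ?b > 0" unfolding D using \<Gamma> d T by simp
  show "(normal_volume N ?b)\<^sup>2 = (fact n)\<^sup>2 * (gram_det (?H 1) ?b - gram_det (?H 0) ?b)" if N: "unit_normal N"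
  proof -
    have "(normal_volume N ?z)\<^sup>2 = (fact n)\<^sup>2 * (\<Gamma> * ?\<tau>\<^sup>2)"
      using normal_volume_adapted(1)[OF N l fs sp, of 0] by (simp add: \<Gamma>_def)
    moreover have "normal_volume N ?z = det_form ?z * normal_volume N ?b"
      by (rule alternating_eq_det_form[OF alternating_normal_volume lz])
    ultimately have "d * (normal_volume N ?b)\<^sup>2 = (fact n)\<^sup>2 * (\<Gamma> * ?\<tau>\<^sup>2)"
      by (simp add: d_def power_mult_distrib)
    then show ?thesis unfolding D using d by (simp add: field_simps)
  qed
qed

section \<open>The bordered system and the two gradients\<close>

lemma bordered_form_linear:
  "linear (bordered_form (hyp_metric A \<omega> g B 0 p) (hyp_form A \<omega> B p) s x)"
  "linear (\<lambda>x. bordered_form (hyp_metric A \<omega> g B 0 p) (hyp_form A \<omega> B p) s x y)"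
  using hyp_metric_linear_left[of 0 "fst y"] hyp_metric_linear_right[of 0 "fst x"] hyp_form_linear
  by (auto simp: linear_iff bordered_form_def algebra_simps)

text \<open>For \<open>x = (v, c)\<close>, pairing with \<open>(0, 1)\<close> determines the
  restricted form on \<open>v\<close> as \<open>s * c\<close>; pairing with \<open>(v, 0)\<close>
  then gives a vanishing sum of the nonnegative terms \<open>?H v v\<close> and
  \<open>s * c\<^sup>2\<close>. So \<open>v\<close> is horizontal and null, hence zero, and
  \<open>c\<close> vanishes because the restricted form does not.\<close>

lemma bordered_form_nondegenerate:
  assumes s: "s \<ge> 0" and z: "\<And>y. bordered_form (hyp_metric A \<omega> g B 0 p) (hyp_form A \<omega> B p) s x y = 0"
  shows "x = 0"
proof -
  let ?H = "hyp_metric A \<omega> g B 0 p" and ?t = "hyp_form A \<omega> B p"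
  obtain v c where x: "x = (v, c)" by force
  have 1: "?t v = s * c"
    using z[of "(0, 1)"] linear_0[OF hyp_form_linear] linear_0[OF hyp_metric_linear_right]
    by (simp add: bordered_form_def x)
  have 2: "?H v w + c * ?t w = 0" for w using z[of "(w, 0)"] by (simp add: bordered_form_def x)
  have "?H v v + s * c\<^sup>2 = 0" using 2[of v] 1 by (simp add: power2_eq_square algebra_simps)
  moreover have "?H v v \<ge> 0" "s * c\<^sup>2 \<ge> 0" using hyp_metric_nonneg[of 0 v] s by auto
  ultimately have h: "?H v v = 0" and sc: "s * c\<^sup>2 = 0" by linarith+
  have "?t v = 0" using 1 sc by auto
  then have v: "v = 0" using hyp_metric_0_definite h by blast
  obtain w where w: "?t w \<noteq> 0" by (rule hyp_form_nonzero)
  have "c * ?t w = 0" using 2[of w] v linear_0[OF hyp_metric_linear_left] by simp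
  then show ?thesis using x v w by (simp add: zero_prod_def)
qed

text \<open>The second slot expresses the multiplier through \<open>v\<close>; inserted in the first
  it gives the gradient equation for \<open>t = 1 / s\<close>. Definiteness supplies the uniqueness
  demanded by \<open>THE\<close>.\<close>

lemma riem_gradient_bordered:
  assumes s: "s > 0" and z: "\<And>y. bordered_form (hyp_metric A \<omega> g B 0 p) (hyp_form A \<omega> B p) s (v, c) y = dfun B f p (fst y)"
    and l: "linear (dfun B f p)"
  shows "riem_gradient B (hyp_metric A \<omega> g B (1 / s)) f p = v"
  unfolding riem_gradient_def
proof (rule the_equality)
  let ?H = "hyp_metric A \<omega> g B" and ?t = "hyp_form A \<omega> B p"
  have 1: "?t v = s * c"
    using z[of "(0, 1)"] linear_0[OF hyp_form_linear] linear_0[OF hyp_metric_linear_right] linear_0[OF l]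
    by (simp add: bordered_form_def)
  have 2: "?H 0 p v w + c * ?t w = dfun B f p w" for w using z[of "(w, 0)"] by (simp add: bordered_form_def)
  show sol: "\<forall>w. ?H (1 / s) p v w = dfun B f p w"
  proof
    fix w
    have "1 / s * (?t v * ?t w) = c * ?t w" using 1 s by simp
    then show "?H (1 / s) p v w = dfun B f p w" using hyp_metric_0[of "1 / s" v w] 2[of w] by linarith
  qed
  fix v' assume v': "\<forall>w. ?H (1 / s) p v' w = dfun B f p w"
  have "?H (1 / s) p (v' - v) w = 0" for w
    using sol v' linear_diff[OF hyp_metric_linear_left] by simp
  then have "v' - v = 0" using hyp_metric_definite[of "1 / s" "v' - v"] s by simp
  then show "v' = v" by simp
qed

text \<open>At \<open>s = 0\<close> the second slot places \<open>v\<close> in the distribution, and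
  on the distribution the multiplier term drops out of the first.\<close>

lemma horizontal_gradient_bordered:
  assumes z: "\<And>y. bordered_form (hyp_metric A \<omega> g B 0 p) (hyp_form A \<omega> B p) 0 (v, c) y = dfun B f p (fst y)"
    and l: "linear (dfun B f p)"
  shows "horizontal_gradient A \<omega> g B f p = v"
  unfolding horizontal_gradient_def
proof (rule the_equality)
  let ?H = "hyp_metric A \<omega> g B" and ?t = "hyp_form A \<omega> B p" and ?i = "incl B A p"
  have D: "y \<in> hyp_distribution A \<omega> B p \<longleftrightarrow> ?t y = 0" for y
    by (simp add: hyp_distribution_def distribution_def hyp_form_def)
  have g: "g p (?i u) (?i y) = ?H 0 p u y" if "?t u = 0" "?t y = 0" for u y
    using that horizontal_metric_eq[OF C] by (simp add: hyp_metric_def hyp_form_def)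
  have 1: "?t v = 0"
    using z[of "(0, 1)"] linear_0[OF hyp_form_linear] linear_0[OF hyp_metric_linear_right] linear_0[OF l]
    by (simp add: bordered_form_def)
  have 2: "?H 0 p v w + c * ?t w = dfun B f p w" for w using z[of "(w, 0)"] by (simp add: bordered_form_def)
  show "v \<in> hyp_distribution A \<omega> B p \<and> (\<forall>y\<in>hyp_distribution A \<omega> B p. g p (?i v) (?i y) = dfun B f p y)"
    using 1 2 by (auto simp: D g) (metis add.right_neutral mult_zero_right)
  fix v' assume v': "v' \<in> hyp_distribution A \<omega> B p \<and> (\<forall>y\<in>hyp_distribution A \<omega> B p. g p (?i v') (?i y) = dfun B f p y)"
  have t': "?t (v' - v) = 0" using v' 1 linear_diff[OF hyp_form_linear] by (simp add: D)
  have "?H 0 p v' (v' - v) = dfun B f p (v' - v)" using v' t' g[of v' "v' - v"] by (simp add: D)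
  moreover have "?H 0 p v (v' - v) = dfun B f p (v' - v)" using 2[of "v' - v"] t' by simp
  ultimately have "?H 0 p (v' - v) (v' - v) = 0" using linear_diff[OF hyp_metric_linear_left] by simp
  then have "v' - v = 0" using hyp_metric_0_definite t' by blast
  then show "v' = v" by simp
qed

section \<open>Orientation and the choice of the normal\<close>

context
  fixes \<eta> :: "('m, 's) form"
  assumes n: "n \<ge> 1" and \<eta>: "orientation_form S B \<eta>"
begin

lemma alternating_orientation: "alternating DIM('s) (\<eta> p)"
  using \<eta> pS by (simp add: orientation_form_def smooth_form_def)

lemma orientation_eq: "length vs = DIM('s) \<Longrightarrow> \<eta> p vs = det_form vs * \<eta> p basis_list"
  by (rule alternating_eq_det_form[OF alternating_orientation])

lemma orientation_nonzero: "\<eta> p basis_list \<noteq> 0"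
  using \<eta> pS orientation_eq unfolding orientation_form_def by (metis mult_zero_right)

lemma orientation_pos: obtains zs where "length zs = DIM('s)" "\<eta> p zs > 0"
proof (cases "\<eta> p basis_list > 0")
  case True
  then show ?thesis using that[of basis_list] by simp
next
  case False
  let ?b = "basis_list :: 's list"
  have "linear (\<lambda>x. \<eta> p (?b[0 := x]))"
    using alternating_linear[OF alternating_orientation, of ?b 0] by simp
  from linear_neg[OF this, of "?b ! 0"] have "\<eta> p (?b[0 := - (?b ! 0)]) = - \<eta> p ?b" by simp
  then show ?thesis using False orientation_nonzero that[of "?b[0 := - (?b ! 0)]"] by simp
qed

text \<open>Both \<eta> and the normal volume are alternating of top degree, so positivity on all
  positive frames amounts to equal signs on \<open>basis_list\<close>. The volume is nonzero and
  changes sign with the normal, hence exactly one of the two unit normals qualifies.\<close>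

lemma sub_normal_unit:
  "unit_normal (sub_normal A n \<omega> g B \<eta> p)"
  "sgn (normal_volume (sub_normal A n \<omega> g B \<eta> p) basis_list) = sgn (\<eta> p basis_list)"
proof -
  let ?b = "basis_list :: 's list"
  let ?P = "\<lambda>N. \<omega> p [N] = 0 \<and> g p N N = 1 \<and>
     (\<forall>y\<in>hyp_distribution A \<omega> B p. g p N (incl B A p y) = 0) \<and>
     (\<forall>zs. length zs = 2 * n \<and> \<eta> p zs > 0 \<longrightarrow> contact_volume A n \<omega> p (N # map (incl B A p) zs) > 0)"
  have P: "?P N \<longleftrightarrow> unit_normal N \<and> (\<forall>zs. length zs = DIM('s) \<and> \<eta> p zs > 0 \<longrightarrow> normal_volume N zs > 0)" for N
    by (auto simp: unit_normal_def normal_volume_def hyp_distribution_def distribution_def hyp_form_def hypersurface_dim)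
  have Q: "(\<forall>zs. length zs = DIM('s) \<and> \<eta> p zs > 0 \<longrightarrow> normal_volume N zs > 0) \<longleftrightarrow>
      sgn (normal_volume N ?b) = sgn (\<eta> p ?b)" for N
  proof
    assume L: "\<forall>zs. length zs = DIM('s) \<and> \<eta> p zs > 0 \<longrightarrow> normal_volume N zs > 0"
    obtain zs where zs: "length zs = DIM('s)" "\<eta> p zs > 0" by (rule orientation_pos)
    then have "sgn (normal_volume N zs) = sgn (\<eta> p zs)" using L by simp
    then have "sgn (det_form zs) * sgn (normal_volume N ?b) = sgn (det_form zs) * sgn (\<eta> p ?b)"
      using orientation_eq[OF zs(1)] alternating_eq_det_form[OF alternating_normal_volume zs(1)] by (simp add: sgn_mult)
    moreover have "det_form zs \<noteq> 0" using zs orientation_eq[OF zs(1)] by auto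
    ultimately show "sgn (normal_volume N ?b) = sgn (\<eta> p ?b)" by (simp add: sgn_zero_iff)
  next
    assume R: "sgn (normal_volume N ?b) = sgn (\<eta> p ?b)"
    show "\<forall>zs. length zs = DIM('s) \<and> \<eta> p zs > 0 \<longrightarrow> normal_volume N zs > 0"
    proof (intro allI impI)
      fix zs :: "'s list" assume zs: "length zs = DIM('s) \<and> \<eta> p zs > 0"
      then have "sgn (normal_volume N zs) = sgn (\<eta> p zs)"
        using orientation_eq[of zs] alternating_eq_det_form[OF alternating_normal_volume, of zs N] R
        by (simp add: sgn_mult)
      then show "normal_volume N zs > 0" using zs by (simp add: sgn_1_pos)
    qed
  qed
  have nz: "normal_volume N ?b \<noteq> 0" if "unit_normal N" for N
    using normal_volume_square[OF that] gram_hyp_metric_diff_pos by auto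
  obtain N0 where N0: "unit_normal N0" by (rule unit_normal_exists)
  \<comment> \<open>\<open>g p\<close> is known to be linear on the distribution only, so signs are
    pulled out through \<open>horizontal_metric\<close>.\<close>
  have mN: "unit_normal (- N)" if "unit_normal N" for N
  proof -
    have w: "\<omega> p [N] = 0" "\<omega> p [- N] = 0"
      using that by (auto simp: unit_normal_def contact_form_simps[OF C pM])
    have "horizontal_metric A \<omega> g p (- N) v = - horizontal_metric A \<omega> g p N v" for v
      using linear_neg[OF linear_horizontal_metric_left[OF C pM]] by blast
    then have "g p (- N) v = - g p N v" if "\<omega> p [v] = 0" for v
      using horizontal_metric_eq[OF C _ that] w by metis
    moreover have "g p N (- N) = - g p N N"
      using linear_neg[OF linear_horizontal_metric_right[OF C pM]] horizontal_metric_eq[OF C] w by metis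
    ultimately show ?thesis using that w by (auto simp: unit_normal_def hyp_form_def)
  qed
  have "\<exists>!N. unit_normal N \<and> sgn (normal_volume N ?b) = sgn (\<eta> p ?b)"
  proof -
    have neg: "normal_volume (- N) ?b = - normal_volume N ?b" for N by (rule normal_volume_minus) simp
    have "sgn (normal_volume N0 ?b) = sgn (\<eta> p ?b) \<or> sgn (normal_volume (- N0) ?b) = sgn (\<eta> p ?b)"
      using nz[OF N0] orientation_nonzero by (auto simp: neg sgn_real_def)
    then have ex: "\<exists>N. unit_normal N \<and> sgn (normal_volume N ?b) = sgn (\<eta> p ?b)" using N0 mN by blast
    moreover have "N' = N" if "unit_normal N \<and> sgn (normal_volume N ?b) = sgn (\<eta> p ?b)"
      "unit_normal N' \<and> sgn (normal_volume N' ?b) = sgn (\<eta> p ?b)" for N N'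
    proof -
      have "N' \<noteq> - N" using that nz[of N] by (auto simp: neg sgn_real_def split: if_splits)
      then show ?thesis using unit_normal_unique that by blast
    qed
    ultimately show ?thesis by blast
  qed
  from theI'[OF this]
  show "unit_normal (sub_normal A n \<omega> g B \<eta> p)"
    "sgn (normal_volume (sub_normal A n \<omega> g B \<eta> p) ?b) = sgn (\<eta> p ?b)"
    unfolding sub_normal_def P Q by blast+
qed

lemma hyp_volume_basis: "hyp_volume A n \<omega> g B \<eta> p basis_list = fact n * (sgn (\<eta> p basis_list) *
    sqrt (gram_det (hyp_metric A \<omega> g B 1 p) basis_list - gram_det (hyp_metric A \<omega> g B 0 p) basis_list))"
proof -
  let ?N = "sub_normal A n \<omega> g B \<eta> p"
  let ?D = "gram_det (hyp_metric A \<omega> g B 1 p) basis_list - gram_det (hyp_metric A \<omega> g B 0 p) basis_list"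
  have "hyp_volume A n \<omega> g B \<eta> p basis_list = normal_volume ?N basis_list"
    by (simp add: hyp_volume_def interior_product_def normal_volume_def)
  also have "\<dots> = sgn (normal_volume ?N basis_list) * \<bar>normal_volume ?N basis_list\<bar>"
    by (simp add: sgn_mult_abs)
  also have "\<bar>normal_volume ?N basis_list\<bar> = sqrt ((normal_volume ?N basis_list)\<^sup>2)" by simp
  also have "\<dots> = fact n * sqrt ?D"
    unfolding normal_volume_square[OF sub_normal_unit(1)] by (simp add: real_sqrt_mult)
  finally show ?thesis by (simp add: sub_normal_unit(2))
qed

lemma alternating_hyp_volume: "alternating DIM('s) (hyp_volume A n \<omega> g B \<eta> p)"
  using alternating_normal_volume[of "sub_normal A n \<omega> g B \<eta> p"]
  by (simp add: hyp_volume_def[abs_def] interior_product_def normal_volume_def[abs_def])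

end

end

end

section \<open>Smoothness in charts\<close>

lemma gram_det_map: "gram_det h (map L vs) = gram_det (\<lambda>u v. h (L u) (L v)) vs"
  unfolding gram_det_def length_map
proof (intro sum.cong prod.cong arg_cong2[where f = "(*)"] refl)
  fix \<sigma> i assume "\<sigma> \<in> {\<sigma>. \<sigma> permutes {..<length vs}}" and i: "i \<in> {..<length vs}"
  then have "\<sigma> i < length vs" using permutes_in_image[of \<sigma> "{..<length vs}" i] by simp
  then show "h (map L vs ! i) (map L vs ! \<sigma> i) = h (L (vs ! i)) (L (vs ! \<sigma> i))" using i by simp
qed

lemma linear_euclidean_sum:
  fixes f :: "'a::euclidean_space \<Rightarrow> 'b::real_vector"
  assumes "linear f"
  shows "f v = (\<Sum>b\<in>Basis. (v \<bullet> b) *\<^sub>R f b)"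
  using linear_sum[OF assms, of "\<lambda>b. (v \<bullet> b) *\<^sub>R b" Basis] linear_cmul[OF assms]
  by (simp add: euclidean_representation)

lemma smooth_on_frechet_apply:
  fixes \<psi> :: "'a::euclidean_space \<Rightarrow> 'b::real_normed_vector"
  assumes "open U" "smooth_on U \<psi>" "smooth_on U V"
  shows "smooth_on U (\<lambda>y. frechet_derivative \<psi> (at y) (V y))"
proof -
  have "smooth_on U (\<lambda>y. \<Sum>b\<in>Basis. (V y \<bullet> b) *\<^sub>R frechet_derivative \<psi> (at y) b)"
    using assms by (intro smooth_on_sum smooth_on_scaleR smooth_on_inner_left smooth_on_frechet_derivative)
  then show ?thesis
    by (rule smooth_on_cong[OF assms(1), THEN iffD1, rotated])
      (rule linear_euclidean_sum[OF linear_frechet_derivative_smooth_on[OF assms(2)], symmetric])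
qed

section \<open>Smoothness of the Reeb field and of the horizontal metric\<close>

context
  fixes M :: "'m::{t2_space,second_countable_topology} set"
    and A :: "('m, 'e::euclidean_space) chart set"
    and n :: nat and \<omega> :: "('m, 'e) form" and g :: "'m \<Rightarrow> 'e \<Rightarrow> 'e \<Rightarrow> real"
  assumes C: "contact_sub_riemannian M A n \<omega> g"
begin

text \<open>The Reeb field solves the linear system with matrix
  \<open>d\<omega> + \<omega> \<otimes> \<omega>\<close> and right-hand side \<omega>. The matrix is
  nondegenerate on the whole tangent space: testing with the Reeb field shows that a null vector is
  horizontal, and on horizontal vectors \<open>d\<omega>\<close> is nondegenerate.\<close>

lemma reeb_coords_smooth:
  assumes a: "a \<in> A"
  shows "smooth_on (cmap a ` cdom a) (\<lambda>y. to_coords A a (cinv a y) (reeb A \<omega> (cinv a y)))"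
proof -
  note M = contact_manifold[OF C] and w = contact_form[OF C]
  let ?U = "cmap a ` cdom a" and ?w = "\<lambda>v y. form1_coords A \<omega> a y v"
  let ?D = "\<lambda>v y. frechet_derivative (?w v) (at y)"
  let ?f = "\<lambda>y. from_coords A a (cinv a y)"
  define k where "k = (\<lambda>y u v. ?D v y u - ?D u y v + ?w u y * ?w v y)"
  have U: "open ?U" using chart_open[OF M a] .
  have q: "cinv a y \<in> cdom a" "cmap a (cinv a y) = y" "cinv a y \<in> M" if "y \<in> ?U" for y
    using that chart_subset[OF M a] cinv_in[OF M] cmap_cinv[OF M] by blast+
  have k: "k y u v = ext_deriv A \<omega> (cinv a y) [?f y u, ?f y v] + \<omega> (cinv a y) [?f y u] * \<omega> (cinv a y) [?f y v]"
    if "y \<in> ?U" for y u v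
    using ext_deriv_form1[OF M w a q(1)[OF that]] q(2)[OF that] by (simp add: k_def form1_coords_def)
  have lf: "linear (?f y)" if "y \<in> ?U" for y using linear_from_coords[OF M a q(1)[OF that]] .
  have tf: "to_coords A a (cinv a y) (?f y v) = v" "?f y (to_coords A a (cinv a y) v) = v" if "y \<in> ?U" for y v
    using to_from_coords[OF M a q(1)[OF that]] from_to_coords[OF M a q(1)[OF that]] by auto
  have k1: "linear (\<lambda>u. k y u v)" and k2: "linear (k y u)" if "y \<in> ?U" for y u v
    using lf[OF that] q(3)[OF that]
    by (auto intro!: linearI simp: k[OF that] linear_add linear_cmul contact_form_simps[OF C] dw_simps[OF C] algebra_simps)
  have k3: "u = 0" if y: "y \<in> ?U" and z: "\<And>v. k y u v = 0" for y u
  proof -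
    let ?p = "cinv a y"
    note p = q(3)[OF y]
    have z': "ext_deriv A \<omega> ?p [?f y u, v] + \<omega> ?p [?f y u] * \<omega> ?p [v] = 0" for v
      using z[of "to_coords A a ?p v"] by (simp add: k[OF y] tf[OF y])
    have "ext_deriv A \<omega> ?p [?f y u, reeb A \<omega> ?p] = 0"
      using dw_skew[OF C p, of "?f y u" "reeb A \<omega> ?p"] reeb(2)[OF C p] by simp
    then have w0: "\<omega> ?p [?f y u] = 0" using z'[of "reeb A \<omega> ?p"] reeb(1)[OF C p] by simp
    have "ext_deriv A \<omega> ?p [?f y u, v] = 0" for v using z'[of v] w0 by simp
    then have "?f y u = 0" using dw_nondegenerate[OF C p w0] by blast
    then show "u = 0" using tf(1)[OF y, of u] linear_0[OF linear_to_coords[OF M a q(1)[OF y]]] by simp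
  qed
  show ?thesis
  proof (rule smooth_on_linear_system[OF U k1])
    show "gram_det (k y) basis_list \<noteq> 0" if "y \<in> ?U" for y
      by (rule gram_det_nondegenerate[OF k2[OF that] k1[OF that] k3[OF that]])
    show "smooth_on ?U (\<lambda>y. k y u v)" for u v
      unfolding k_def
      by (intro smooth_on_add smooth_on_diff smooth_on_mult smooth_on_frechet_derivative form1_coords_smooth[OF M w a] U)
    show "smooth_on ?U (\<lambda>y. ?w v y)" for v by (rule form1_coords_smooth[OF M w a])
    show "k y (to_coords A a (cinv a y) (reeb A \<omega> (cinv a y))) v = ?w v y" if "y \<in> ?U" for y v
      using reeb[OF C q(3)[OF that]] by (simp add: k[OF that] tf[OF that] form1_coords_def)
  qed
qed

text \<open>\<open>smooth_fibre_inner_product\<close> speaks only of smooth horizontal fields, so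
  such fields have to be supplied: the projected coordinate fields of \<open>a\<close>. In
  \<open>a\<close> their coordinates are the smooth map \<open>V\<close>; in another chart
  \<open>a'\<close> the derivative of the transition map is applied to it.\<close>

lemma horizontal_frame_smooth:
  assumes a: "a \<in> A"
  shows "smooth_vector_field A (cdom a) (\<lambda>q. horizontal_part A \<omega> q (from_coords A a q e))"
  unfolding smooth_vector_field_def
proof
  fix a' assume a': "a' \<in> A"
  note M = contact_manifold[OF C] and w = contact_form[OF C]
  define N where "N = cmap a ` (cdom a \<inter> cdom a')"
  define N' where "N' = cmap a' ` (cdom a' \<inter> cdom a)"
  define \<psi> where "\<psi> = cmap a' \<circ> cinv a"
  define \<phi> where "\<phi> = cmap a \<circ> cinv a'"
  define V where "V = (\<lambda>y. e - form1_coords A \<omega> a y e *\<^sub>R to_coords A a (cinv a y) (reeb A \<omega> (cinv a y)))"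
  have N: "open N" "open N'" "N \<subseteq> cmap a ` cdom a"
    unfolding N_def N'_def using transition_open[OF M] a a' by auto
  have sV: "smooth_on N V"
    unfolding V_def
    by (intro smooth_on_diff smooth_on_scaleR smooth_on_const N smooth_on_subset[OF reeb_coords_smooth[OF a] N(3)]
        smooth_on_subset[OF form1_coords_smooth[OF M w a] N(3)])
  have s\<psi>: "smooth_on N \<psi>" and s\<phi>: "smooth_on N' \<phi>"
    unfolding N_def N'_def \<psi>_def \<phi>_def using transition_smooth[OF M] a a' by blast+
  have im: "\<phi> ` N' \<subseteq> N"
    using a a' by (auto simp: N_def N'_def \<phi>_def cinv_cmap[OF M])
  have "smooth_on N' (\<lambda>x. frechet_derivative \<psi> (at (\<phi> x)) (V (\<phi> x)))"
    by (rule smooth_on_compose[OF N(2,1) im s\<phi> smooth_on_frechet_apply[OF N(1) s\<psi> sV]])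
  moreover have "frechet_derivative \<psi> (at (\<phi> x)) (V (\<phi> x)) =
      to_coords A a' (cinv a' x) (horizontal_part A \<omega> (cinv a' x) (from_coords A a (cinv a' x) e))"
    if "x \<in> N'" for x
  proof -
    define p where "p = cinv a' x"
    have p: "p \<in> cdom a" "p \<in> cdom a'" "\<phi> x = cmap a p" "cinv a (\<phi> x) = p"
      using that a a' by (auto simp: N'_def p_def \<phi>_def cinv_cmap[OF M])
    have "horizontal_part A \<omega> p (from_coords A a p e) = from_coords A a p (V (\<phi> x))"
      using linear_diff[OF linear_from_coords[OF M a p(1)]] linear_cmul[OF linear_from_coords[OF M a p(1)]]
        from_to_coords[OF M a p(1)] by (simp add: horizontal_part_def V_def p(4) form1_coords_def)
    then show ?thesis
      using to_from_coords_transition[OF M a a' p(1,2)] p(3) by (simp add: \<psi>_def p_def[symmetric])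
  qed
  ultimately have "smooth_on N' (\<lambda>x. to_coords A a' (cinv a' x) (horizontal_part A \<omega> (cinv a' x) (from_coords A a (cinv a' x) e)))"
    using smooth_on_cong[OF N(2)] by (metis (no_types, lifting))
  then show "smooth_on (cmap a' ` (cdom a \<inter> cdom a'))
      (\<lambda>x. to_coords A a' (cinv a' x) (horizontal_part A \<omega> (cinv a' x) (from_coords A a (cinv a' x) e)))"
    by (simp add: N'_def Int_commute)
qed

lemma horizontal_metric_smooth:
  assumes a: "a \<in> A"
  shows "smooth_on (cmap a ` cdom a)
    (\<lambda>y. horizontal_metric A \<omega> g (cinv a y) (from_coords A a (cinv a y) u) (from_coords A a (cinv a y) v))"
proof -
  note M = contact_manifold[OF C]
  let ?E = "\<lambda>e q. horizontal_part A \<omega> q (from_coords A a q e)"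
  have "\<forall>p\<in>cdom a. ?E e p \<in> distribution \<omega> p" for e
    using contact_form_horizontal_part[OF C] chart_subset[OF M a] by (auto simp: distribution_def)
  then have "smooth_fun A (cdom a) (\<lambda>p. g p (?E u p) (?E v p))"
    using contact_metric[OF C] horizontal_frame_smooth[OF a] chart_openin[OF M a]
    unfolding smooth_fibre_inner_product_def by blast
  then have "smooth_on (cmap a ` (cdom a \<inter> cdom a)) ((\<lambda>p. g p (?E u p) (?E v p)) \<circ> cinv a)"
    using a unfolding smooth_fun_def by blast
  then show ?thesis by (simp add: horizontal_metric_def o_def)
qed

end

section \<open>Smoothness of the data on the hypersurface\<close>

context
  fixes M S :: "'m::{t2_space,second_countable_topology} set"
    and A :: "('m, 'e::euclidean_space) chart set"
    and B :: "('m, 's::euclidean_space) chart set"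
    and n :: nat and \<omega> :: "('m, 'e) form" and g :: "'m \<Rightarrow> 'e \<Rightarrow> 'e \<Rightarrow> real"
  assumes C: "contact_sub_riemannian M A n \<omega> g"
    and emb: "embedded_hypersurface M A S B"
begin

lemma incl_chart_facts:
  assumes c: "c \<in> B" and a: "a \<in> A" and y: "y \<in> cmap c ` {x \<in> cdom c. x \<in> cdom a}"
  defines "\<psi> \<equiv> cmap a \<circ> (\<lambda>x. x) \<circ> cinv c"
  shows "\<psi> y \<in> cmap a ` cdom a" "cinv a (\<psi> y) = cinv c y"
    "incl B A (cinv c y) (from_coords B c (cinv c y) v) =
      from_coords A a (cinv a (\<psi> y)) (frechet_derivative \<psi> (at y) v)"
    "linear (frechet_derivative \<psi> (at y))" "\<psi> y = cmap a (cinv c y)"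
proof -
  note MA = contact_manifold[OF C]
  note MB = hyp_manifold[OF MA emb]
  obtain x where x: "x \<in> cdom c" "x \<in> cdom a" "y = cmap c x" using y by blast
  have e: "cinv c y = x" using x c by (simp add: cinv_cmap[OF MB])
  show 1: "\<psi> y \<in> cmap a ` cdom a" "\<psi> y = cmap a (cinv c y)" using x(2) unfolding \<psi>_def o_def e by auto
  show 2: "cinv a (\<psi> y) = cinv c y" using cinv_cmap[OF MA a x(2)] by (simp add: \<psi>_def e)
  show "incl B A (cinv c y) (from_coords B c (cinv c y) v) =
      from_coords A a (cinv a (\<psi> y)) (frechet_derivative \<psi> (at y) v)"
    unfolding 2 using incl_from_coords[OF MA emb c x(1) a x(2)] by (simp add: e[unfolded x(3)] x(3) \<psi>_def)
  show "linear (frechet_derivative \<psi> (at y))"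
    unfolding \<psi>_def using linear_frechet_derivative_smooth_on[OF incl_chart_smooth[OF MA emb c a] y] .
qed

lemma hyp_form_smooth:
  assumes c: "c \<in> B" and a: "a \<in> A"
  shows "smooth_on (cmap c ` {x \<in> cdom c. x \<in> cdom a})
    (\<lambda>y. hyp_form A \<omega> B (cinv c y) (from_coords B c (cinv c y) v))"
proof -
  note MA = contact_manifold[OF C] and w = contact_form[OF C]
  let ?U = "cmap c ` {x \<in> cdom c. x \<in> cdom a}" and ?\<psi> = "cmap a \<circ> (\<lambda>x. x) \<circ> cinv c"
  have U: "open ?U" using incl_chart_open[OF MA emb c a] .
  have s: "smooth_on ?U ?\<psi>" using incl_chart_smooth[OF MA emb c a] .
  have im: "?\<psi> ` ?U \<subseteq> cmap a ` cdom a" using incl_chart_facts(1)[OF c a] by blast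
  have "smooth_on ?U (\<lambda>y. \<Sum>b\<in>Basis. (frechet_derivative ?\<psi> (at y) v \<bullet> b) *\<^sub>R form1_coords A \<omega> a (?\<psi> y) b)"
    by (intro smooth_on_sum smooth_on_scaleR smooth_on_inner_left smooth_on_frechet_derivative U s
        smooth_on_compose[OF U chart_open[OF MA a] im s form1_coords_smooth[OF MA w a]])
  moreover have "(\<Sum>b\<in>Basis. (frechet_derivative ?\<psi> (at y) v \<bullet> b) *\<^sub>R form1_coords A \<omega> a (?\<psi> y) b) =
      hyp_form A \<omega> B (cinv c y) (from_coords B c (cinv c y) v)" if y: "y \<in> ?U" for y
    unfolding linear_euclidean_sum[OF form1_coords_linear[OF MA w a incl_chart_facts(1)[OF c a y]], symmetric]
    by (simp only: hyp_form_def incl_chart_facts(3)[OF c a y] form1_coords_def incl_chart_facts(2)[OF c a y])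
  ultimately show ?thesis using smooth_on_cong[OF U] by (metis (no_types, lifting))
qed

text \<open>Seen in a chart of \<open>M\<close>, constant vectors of a chart of \<open>S\<close>
  become directions that vary with the point. Expanding both in \<open>Basis\<close> reduces the
  claim to constant directions.\<close>

lemma hyp_metric_smooth:
  assumes c: "c \<in> B" and a: "a \<in> A"
  shows "smooth_on (cmap c ` {x \<in> cdom c. x \<in> cdom a})
    (\<lambda>y. hyp_metric A \<omega> g B t (cinv c y) (from_coords B c (cinv c y) u) (from_coords B c (cinv c y) v))"
proof -
  note MA = contact_manifold[OF C]
  let ?U = "cmap c ` {x \<in> cdom c. x \<in> cdom a}" and ?\<psi> = "cmap a \<circ> (\<lambda>x. x) \<circ> cinv c"
  let ?D = "\<lambda>v y. frechet_derivative ?\<psi> (at y) v"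
  let ?G = "\<lambda>b b' y. horizontal_metric A \<omega> g (cinv a y) (from_coords A a (cinv a y) b) (from_coords A a (cinv a y) b')"
  have U: "open ?U" using incl_chart_open[OF MA emb c a] .
  have s: "smooth_on ?U ?\<psi>" using incl_chart_smooth[OF MA emb c a] .
  have im: "?\<psi> ` ?U \<subseteq> cmap a ` cdom a" using incl_chart_facts(1)[OF c a] by blast
  have 1: "smooth_on ?U (\<lambda>y. \<Sum>b\<in>Basis. (?D u y \<bullet> b) *\<^sub>R (\<Sum>b'\<in>Basis. (?D v y \<bullet> b') *\<^sub>R ?G b b' (?\<psi> y)))"
    by (intro smooth_on_sum smooth_on_scaleR smooth_on_inner_left smooth_on_frechet_derivative U s
        smooth_on_compose[where g = "?G b b'" for b b', OF U chart_open[OF MA a] im s horizontal_metric_smooth[OF C a]])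
  have 2: "(\<Sum>b\<in>Basis. (?D u y \<bullet> b) *\<^sub>R (\<Sum>b'\<in>Basis. (?D v y \<bullet> b') *\<^sub>R ?G b b' (?\<psi> y))) =
      horizontal_metric A \<omega> g (cinv c y) (incl B A (cinv c y) (from_coords B c (cinv c y) u))
        (incl B A (cinv c y) (from_coords B c (cinv c y) v))" if y: "y \<in> ?U" for y
  proof -
    let ?p = "cinv a (?\<psi> y)"
    have pc: "?p \<in> cdom a" using incl_chart_facts(1)[OF c a y] cinv_in[OF MA] by blast
    then have p: "?p \<in> M" using chart_subset[OF MA a] by blast
    note lf = linear_from_coords[OF MA a pc]
    have r: "linear (\<lambda>b'. ?G b b' (?\<psi> y))" for b
      using linear_compose[OF lf linear_horizontal_metric_right[OF C p]] by (simp only: o_def)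
    have l: "linear (\<lambda>b. ?G b b' (?\<psi> y))" for b'
      using linear_compose[OF lf linear_horizontal_metric_left[OF C p]] by (simp only: o_def)
    have "(\<Sum>b\<in>Basis. (?D u y \<bullet> b) *\<^sub>R (\<Sum>b'\<in>Basis. (?D v y \<bullet> b') *\<^sub>R ?G b b' (?\<psi> y))) =
        (\<Sum>b\<in>Basis. (?D u y \<bullet> b) *\<^sub>R ?G b (?D v y) (?\<psi> y))"
      by (intro sum.cong arg_cong2[where f = "(*\<^sub>R)"] refl linear_euclidean_sum[OF r, symmetric])
    also have "\<dots> = ?G (?D u y) (?D v y) (?\<psi> y)" by (rule linear_euclidean_sum[OF l, symmetric])
    finally show ?thesis
      by (simp only: incl_chart_facts(3)[OF c a y] incl_chart_facts(2)[OF c a y])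
  qed
  have "smooth_on ?U (\<lambda>y. horizontal_metric A \<omega> g (cinv c y) (incl B A (cinv c y) (from_coords B c (cinv c y) u))
        (incl B A (cinv c y) (from_coords B c (cinv c y) v)))"
    by (rule smooth_on_cong[OF U, THEN iffD1, OF 2 1])
  then show ?thesis
    unfolding hyp_metric_def
    by (intro smooth_on_add smooth_on_mult smooth_on_const hyp_form_smooth[OF c a] U)
qed

text \<open>A tangent vector at \<open>p\<close> on which the restricted form is nonzero, continued
  with constant coordinates in a chart, keeps this property nearby by continuity of
  \<open>h\<close>.\<close>

lemma noncharacteristic_openin: "openin (top_of_set S) (S - characteristic_points A \<omega> S B)"
proof (subst openin_subopen, intro ballI)
  fix p assume p: "p \<in> S - characteristic_points A \<omega> S B"
  note MA = contact_manifold[OF C]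
  note MB = hyp_manifold[OF MA emb]
  define c where "c = chart_at B p"
  define a where "a = chart_at A p"
  have c: "c \<in> B" "p \<in> cdom c" using chart_at_in[OF MB] p by (auto simp: c_def)
  have a: "a \<in> A" "p \<in> cdom a" using chart_at_in[OF MA] p hyp_subset[OF MA emb] by (auto simp: a_def)
  let ?U = "cmap c ` {x \<in> cdom c. x \<in> cdom a}"
  obtain v where v: "hyp_form A \<omega> B p v \<noteq> 0" using hyp_form_nonzero[OF C emb p] .
  define h where "h = (\<lambda>y. hyp_form A \<omega> B (cinv c y) (from_coords B c (cinv c y) (to_coords B c p v)))"
  have U: "open ?U" using incl_chart_open[OF MA emb c(1) a(1)] .
  have "continuous_on ?U h"
    unfolding h_def using smooth_on_continuous_on[OF hyp_form_smooth[OF c(1) a(1)]] .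
  then have oV: "open (?U \<inter> h -` (- {0}))"
    using continuous_open_preimage[OF _ U] by blast
  define V where "V = ?U \<inter> h -` (- {0})"
  have Vc: "V \<subseteq> cmap c ` cdom c" by (auto simp: V_def)
  have hp: "cinv c (cmap c p) = p" using c by (simp add: cinv_cmap[OF MB])
  have "openin (top_of_set (cmap c ` cdom c)) V"
    using oV Vc by (simp add: V_def open_subset)
  then have "openin (top_of_set (cdom c)) (cinv c ` V)"
    by (rule homeomorphism_imp_open_map[OF homeomorphism_symD[OF chart_homeo[OF MB c(1)]]])
  then have "openin (top_of_set S) (cinv c ` V)"
    using chart_openin[OF MB c(1)] openin_trans by blast
  moreover have "p \<in> cinv c ` V"
  proof -
    have "h (cmap c p) = hyp_form A \<omega> B p v" by (simp add: h_def hp from_to_coords[OF MB c])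
    then have "cmap c p \<in> V" using v c a by (auto simp: V_def)
    then show ?thesis using hp by (metis image_eqI)
  qed
  moreover have "cinv c ` V \<subseteq> S - characteristic_points A \<omega> S B"
  proof
    fix q assume "q \<in> cinv c ` V"
    then obtain y where y: "y \<in> V" "q = cinv c y" by blast
    then have "q \<in> cdom c" using Vc cinv_in[OF MB] by blast
    then have "q \<in> S" using chart_subset[OF MB c(1)] by blast
    moreover have "q \<notin> characteristic_points A \<omega> S B"
    proof
      assume "q \<in> characteristic_points A \<omega> S B"
      then have "\<omega> q [incl B A q u] = 0" for u by (auto simp: characteristic_points_def distribution_def)
      then show False using y by (simp add: V_def h_def hyp_form_def)
    qed
    ultimately show "q \<in> S - characteristic_points A \<omega> S B" by blast
  qed
  ultimately show "\<exists>T. openin (top_of_set S) T \<and> p \<in> T \<and> T \<subseteq> S - characteristic_points A \<omega> S B" by blast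
qed

end

section \<open>Dependence on the parameter\<close>

lemma bordered_form_pullback:
  "bordered_form (\<lambda>u v. h (L u) (L v)) (\<lambda>v. t (L v)) s x y =
    bordered_form h t s (L (fst x), snd x) (L (fst y), snd y)"
  by (simp add: bordered_form_def)

lemma smooth_on_compose_snd:
  fixes f :: "'b::euclidean_space \<Rightarrow> 'c::real_normed_vector"
  assumes "open U" "smooth_on U f"
  shows "smooth_on (UNIV \<times> U :: ('a::real_normed_vector \<times> 'b) set) (\<lambda>z. f (snd z))"
  by (rule smooth_on_compose[where V = U])
    (use assms in \<open>auto intro: smooth_on_bounded_linear bounded_linear_snd open_Times\<close>)

section \<open>The operators as one family in the parameter\<close>

context
  fixes M S :: "'m::{t2_space,second_countable_topology} set"
    and A :: "('m, 'e::euclidean_space) chart set"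
    and B :: "('m, 's::euclidean_space) chart set"
    and n :: nat and \<omega> :: "('m, 'e) form" and g :: "'m \<Rightarrow> 'e \<Rightarrow> 'e \<Rightarrow> real"
    and \<eta> :: "('m, 's) form" and f :: "'m \<Rightarrow> real"
  assumes C: "contact_sub_riemannian M A n \<omega> g"
    and emb: "embedded_hypersurface M A S B"
    and n: "n \<ge> 1" and \<eta>: "orientation_form S B \<eta>"
    and f: "smooth_fun B (S - characteristic_points A \<omega> S B) f"
begin

text \<open>Joins both kinds of operators in one family in \<open>s\<close>, the square of
  \<epsilon>, so that the limit becomes continuity at \<open>s = 0\<close>; \<open>sqrt s\<close>
  recovers \<epsilon>.\<close>

definition lap :: "real \<Rightarrow> 'm \<Rightarrow> real" where
  "lap s = (if s = 0 then sub_laplacian A n \<omega> g B \<eta> f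
    else laplace_beltrami B \<eta> (induced_metric A B (riem_approx A \<omega> g (sqrt s))) f)"

text \<open>Near \<open>p0\<close> the whole family is given, in one chart, by a single function
  \<open>R\<close> of \<open>s\<close> and \<open>y\<close> built from the smooth solution of the
  bordered system. The last property is the locality of the operators, for use off the support of
  \<open>f\<close>.\<close>

lemma lap_local:
  assumes p0: "p0 \<in> S - characteristic_points A \<omega> S B"
  obtains c U R where "c \<in> B" "p0 \<in> cdom c" "open U" "cmap c p0 \<in> U"
    "U \<subseteq> cmap c ` ((S - characteristic_points A \<omega> S B) \<inter> cdom c)"
    "continuous_on ({0..} \<times> U) R"
    "\<And>s y. s \<ge> 0 \<Longrightarrow> y \<in> U \<Longrightarrow> lap s (cinv c y) = R (s, y)"
    "\<And>s y V. s \<ge> 0 \<Longrightarrow> open V \<Longrightarrow> y \<in> V \<Longrightarrow> V \<subseteq> U \<Longrightarrow> (\<And>z. z \<in> V \<Longrightarrow> f (cinv c z) = 0) \<Longrightarrow> R (s, y) = 0"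
proof -
  note MA = contact_manifold[OF C]
  note MB = hyp_manifold[OF MA emb]
  let ?W = "S - characteristic_points A \<omega> S B"
  note oW = noncharacteristic_openin[OF C emb]
  let ?b = "basis_list :: 's list" and ?bb = "basis_list :: ('s \<times> real) list"
  define c where "c = chart_at B p0"
  define a where "a = chart_at A p0"
  have c: "c \<in> B" "p0 \<in> cdom c" using chart_at_in[OF MB] p0 by (auto simp: c_def)
  have a: "a \<in> A" "p0 \<in> cdom a" using chart_at_in[OF MA] p0 hyp_subset[OF MA emb] by (auto simp: a_def)
  define fr where "fr = (\<lambda>y. from_coords B c (cinv c y))"
  define y0 where "y0 = cmap c p0"
  define U1 where "U1 = cmap c ` {x \<in> cdom c. x \<in> cdom a}"
  define U0 where "U0 = U1 \<inter> cmap c ` (?W \<inter> cdom c)"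
  have oU1: "open U1" unfolding U1_def by (rule incl_chart_open[OF MA emb c(1) a(1)])
  have oU0: "open U0" unfolding U0_def using oU1 chart_image_open[OF MB c(1) oW] by blast
  have y0U0: "y0 \<in> U0" using c a p0 by (auto simp: y0_def U0_def U1_def)
  have U0c: "U0 \<subseteq> cmap c ` cdom c" by (auto simp: U0_def)
  have q: "cinv c y \<in> ?W" "cinv c y \<in> cdom c" "cmap c (cinv c y) = y" if y: "y \<in> U0" for y
  proof -
    obtain x where "x \<in> ?W" "x \<in> cdom c" "y = cmap c x" using y unfolding U0_def by blast
    then show "cinv c y \<in> ?W" "cinv c y \<in> cdom c" "cmap c (cinv c y) = y"
      using c by (simp_all add: cinv_cmap[OF MB])
  qed
  have lfr: "linear (fr y)" if "y \<in> U0" for y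
    unfolding fr_def using linear_from_coords[OF MB c(1) q(2)[OF that]] .
  define to where "to = (\<lambda>y. to_coords B c (cinv c y))"
  have to: "fr y (to y v) = v" "to y (fr y v) = v" if "y \<in> U0" for y v
    unfolding fr_def to_def
    using from_to_coords[OF MB c(1) q(2)[OF that]] to_from_coords[OF MB c(1) q(2)[OF that]] by auto
  \<comment> \<open>The determinant of the change from \<open>c\<close> to the chart distinguished
    at each point. It may jump with \<open>y\<close>, but is absorbed in the smooth quantities
    \<open>e\<close> and \<open>gram_det (H t y) ?b\<close>.\<close>
  define \<delta> where "\<delta> = (\<lambda>y. det_form (map (fr y) ?b))"
  have \<delta>: "\<delta> y \<noteq> 0" if y: "y \<in> U0" for y
  proof -
    have "span (set (map (fr y) ?b)) = fr y ` span (set ?b)"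
      using linear_span_image[OF lfr[OF y]] by simp
    also have "\<dots> = range (fr y)" by (simp add: basis_list)
    also have "\<dots> = UNIV" by (rule surjI[of "fr y" "to y"]) (rule to(1)[OF y])
    finally have "span (set (map (fr y) ?b)) = UNIV" .
    from alternating_nonzero_of_spanning[OF alternating_det_form length_basis_list _ _ this]
    show ?thesis by (simp add: \<delta>_def)
  qed
  have \<delta>': "det_form (map (fr y) vs) = det_form vs * \<delta> y" if "y \<in> U0" "length vs = DIM('s)" for y vs
    unfolding \<delta>_def using alternating_eq_det_form[OF alternating_map[OF lfr[OF that(1)] alternating_det_form] that(2)] .

  define e where "e = (\<lambda>y. \<eta> (cinv c y) (map (fr y) ?b))"
  have e: "e y = \<delta> y * \<eta> (cinv c y) ?b" if "y \<in> U0" for y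
    unfolding e_def \<delta>_def by (rule orientation_eq[OF C emb q(1)[OF that] n \<eta>]) simp
  have enz: "e y \<noteq> 0" if "y \<in> U0" for y
    using e[OF that] \<delta>[OF that] orientation_nonzero[OF C emb q(1)[OF that] n \<eta>] by simp
  have "\<forall>ws. length ws = DIM('s) \<longrightarrow>
      smooth_on (cmap c ` cdom c) (\<lambda>x. \<eta> (cinv c x) (map (from_coords B c (cinv c x)) ws))"
    using \<eta> c by (simp add: orientation_form_def smooth_form_def)
  from this[rule_format, OF length_basis_list] have "continuous_on U0 e"
    unfolding e_def fr_def by (rule smooth_on_continuous_on[OF smooth_on_subset[OF _ U0c]])
  then have ce: "continuous_on U0 (\<lambda>y. e y * e y0)" by (intro continuous_intros)
  \<comment> \<open>Shrinks \<open>U0\<close> so that the coefficient \<open>e\<close> of the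
    orientation keeps the sign it has at \<open>y0\<close>; this constant sign can then go into the
    factor \<open>k\<close> of \<open>divergence_chart\<close>.\<close>
  define U where "U = U0 \<inter> (\<lambda>y. e y * e y0) -` {0<..}"
  have oU: "open U" unfolding U_def by (rule continuous_open_preimage[OF ce oU0 open_greaterThan])
  have "e y0 * e y0 > 0" using enz[OF y0U0] not_real_square_gt_zero[of "e y0"] by blast
  then have y0U: "y0 \<in> U" using y0U0 by (simp add: U_def)
  have UU0: "y \<in> U0" if "y \<in> U" for y using that by (simp add: U_def)
  have sg: "sgn (e y) = sgn (e y0)" if "y \<in> U" for y
    using that by (auto simp: U_def sgn_real_def zero_less_mult_iff)

  define H where "H = (\<lambda>t y u v. hyp_metric A \<omega> g B t (cinv c y) (fr y u) (fr y v))"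
  define \<tau> where "\<tau> = (\<lambda>y v. hyp_form A \<omega> B (cinv c y) (fr y v))"
  have U1: "U \<subseteq> U1" by (auto simp: U_def U0_def)
  have sH: "smooth_on U (\<lambda>y. H t y u v)" and s\<tau>: "smooth_on U (\<lambda>y. \<tau> y v)" for t u v
    unfolding H_def \<tau>_def fr_def
    using hyp_metric_smooth[OF C emb c(1) a(1)] hyp_form_smooth[OF C emb c(1) a(1)] U1
    unfolding U1_def by (blast intro: smooth_on_subset)+
  let ?h = "\<lambda>t y. hyp_metric A \<omega> g B t (cinv c y)"
  have lh: "linear (?h t y u)" "linear (\<lambda>u. ?h t y u v)" if "y \<in> U0" for t y u v
    using hyp_metric_linear_right[OF C emb q(1)[OF that]] hyp_metric_linear_left[OF C emb q(1)[OF that]] by auto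
  have gH: "gram_det (?h t y) (map (fr y) vs) = gram_det (?h t y) ?b * (det_form vs * \<delta> y)\<^sup>2"
    if "y \<in> U0" "length vs = DIM('s)" for t y vs
    using gram_det_eq_det_form[OF lh[OF that(1)], of "map (fr y) vs" t] that(2) \<delta>'[OF that] by simp
  have gHb: "gram_det (H t y) ?b = gram_det (?h t y) ?b * (\<delta> y)\<^sup>2" if "y \<in> U0" for t y
    using gH[OF that, of ?b t] by (simp add: gram_det_map H_def)

  \<comment> \<open>The \<open>s A + D\<close> of the overview in the coordinates of
    \<open>c\<close>; its root is the density \<rho>.\<close>
  define r2 where "r2 = (\<lambda>z. fst z * gram_det (H 0 (snd z)) ?b + (gram_det (H 1 (snd z)) ?b - gram_det (H 0 (snd z)) ?b))"
  have r2_pos: "r2 (s, y) > 0" if "s \<ge> 0" "y \<in> U" for s y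
    using gram_hyp_metric_0_nonneg[OF C emb q(1)[OF UU0[OF that(2)]]]
      gram_hyp_metric_diff_pos[OF C emb q(1)[OF UU0[OF that(2)]]] \<delta>[OF UU0[OF that(2)]] that(1)
    by (simp add: r2_def gHb[OF UU0[OF that(2)]] left_diff_distrib[symmetric] add_nonneg_pos)
  define K where "K = (\<lambda>z. bordered_form (H 0 (snd z)) (\<tau> (snd z)) (fst z))"
  have K: "K (s, y) x x' = bordered_form (?h 0 y) (hyp_form A \<omega> B (cinv c y)) s (fr y (fst x), snd x) (fr y (fst x'), snd x')"
    for s y x x'
    by (simp add: K_def H_def \<tau>_def bordered_form_pullback)
  have lP: "linear (\<lambda>x. (fr y (fst x), snd x))" if "y \<in> U0" for y
    using lfr[OF that] by (auto simp: linear_iff)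
  have Kl: "linear (K z x)" "linear (\<lambda>x. K z x x')" if "snd z \<in> U0" for z x x'
  proof -
    obtain s y where z: "z = (s, y)" by force
    have y: "y \<in> U0" using that z by simp
    show "linear (K z x)" "linear (\<lambda>x. K z x x')"
      using linear_compose[OF lP[OF y] bordered_form_linear(1)[OF C emb q(1)[OF y], of s "(fr y (fst x), snd x)"]]
        linear_compose[OF lP[OF y] bordered_form_linear(2)[OF C emb q(1)[OF y], of s "(fr y (fst x'), snd x')"]]
      by (simp_all add: z K[abs_def] o_def)
  qed
  have Knd: "x = 0" if sy: "s \<ge> 0" "y \<in> U0" and z: "\<And>x'. K (s, y) x x' = 0" for s y x
  proof -
    have "bordered_form (?h 0 y) (hyp_form A \<omega> B (cinv c y)) s (fr y (fst x), snd x) x' = 0" for x'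
      using z[of "(to y (fst x'), snd x')"] to(1)[OF sy(2)] by (simp add: K)
    then have "(fr y (fst x), snd x) = 0"
      by (rule bordered_form_nondegenerate[OF C emb q(1)[OF sy(2)] sy(1)])
    then have "fr y (fst x) = 0" "snd x = 0" by (auto simp: zero_prod_def)
    moreover have "to y 0 = 0"
      unfolding to_def using linear_0[OF linear_to_coords[OF MB c(1) q(2)[OF sy(2)]]] .
    ultimately show ?thesis using to(2)[OF sy(2), of "fst x"] by (simp add: prod_eq_iff)
  qed

  define OU where "OU = (UNIV \<times> U :: (real \<times> 's) set)"
  have oOU: "open OU" unfolding OU_def using oU by (simp add: open_Times)
  have sfst: "smooth_on OU (\<lambda>z. fst z)"
    using smooth_on_bounded_linear[OF bounded_linear_fst oOU] by simp
  have sH': "smooth_on OU (\<lambda>z. H t (snd z) u v)" and s\<tau>': "smooth_on OU (\<lambda>z. \<tau> (snd z) v)" for t u v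
    unfolding OU_def using smooth_on_compose_snd[OF oU sH] smooth_on_compose_snd[OF oU s\<tau>] by blast+
  have sgH: "smooth_on OU (\<lambda>z. gram_det (H t (snd z)) ?b)" for t
    unfolding gram_det_eq by (rule smooth_on_gram[OF oOU sH'])
  have sr2: "smooth_on OU r2"
    unfolding r2_def by (intro smooth_on_add smooth_on_diff smooth_on_mult oOU sfst sgH)
  have sK: "smooth_on OU (\<lambda>z. K z x x')" for x x'
    unfolding K_def bordered_form_def
    by (intro smooth_on_add smooth_on_diff smooth_on_mult smooth_on_const oOU sfst sH' s\<tau>')
  have sgK: "smooth_on OU (\<lambda>z. gram_det (K z) ?bb)"
    unfolding gram_det_eq by (rule smooth_on_gram[OF oOU sK])
  \<comment> \<open>\<open>smooth_on\<close> is meant for open sets, but the values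
    \<open>s \<ge> 0\<close> are not open at 0. Nondegeneracy and positivity are open conditions, so
    they persist on an open set that contains \<open>{0..} \<times> U\<close>.\<close>
  define Dm where "Dm = (OU \<inter> (\<lambda>z. gram_det (K z) ?bb) -` (- {0})) \<inter> (OU \<inter> r2 -` {0<..})"
  have oO: "open Dm"
    unfolding Dm_def
    by (intro open_Int continuous_open_preimage[OF smooth_on_continuous_on oOU] sgK sr2) auto
  have DU: "Dm \<subseteq> OU" by (auto simp: Dm_def)
  have Dm: "snd z \<in> U" "snd z \<in> U0" "gram_det (K z) ?bb \<noteq> 0" "r2 z > 0" if "z \<in> Dm" for z
    using that UU0 by (auto simp: Dm_def OU_def)
  have in_O: "(s, y) \<in> Dm" if "s \<ge> 0" "y \<in> U" for s y
    using that r2_pos[OF that] gram_det_nondegenerate[of "K (s, y)", OF Kl[of "(s, y)"] Knd[OF that(1) UU0[OF that(2)]]] UU0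
    by (auto simp: Dm_def OU_def)

  define df where "df = (\<lambda>y. frechet_derivative (f \<circ> cinv c) (at y))"
  have sf: "smooth_on U (f \<circ> cinv c)"
  proof (rule smooth_on_subset)
    show "smooth_on (cmap c ` (?W \<inter> cdom c)) (f \<circ> cinv c)" using f c by (simp add: smooth_fun_def)
  qed (auto simp: U_def U0_def)
  have ldf: "linear (df y)" if "y \<in> U" for y
    unfolding df_def by (rule linear_frechet_derivative_smooth_on[OF sf that])
  have dfun: "dfun B f (cinv c y) (fr y v) = df y v" if "y \<in> U" for y v
    using dfun_from_coords[OF MB c(1) oW q(1,2)[OF UU0[OF that]] f, of v] q(3)[OF UU0[OF that]]
    by (simp add: fr_def df_def)
  have "\<exists>x. \<forall>x'. K z x x' = df (snd z) (fst x')" if "z \<in> Dm" for z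
  proof -
    have l: "linear (\<lambda>x'. df (snd z) (fst x'))"
      using ldf[OF Dm(1)[OF that]] by (auto simp: linear_iff)
    have nd: "x = 0" if "\<And>x'. K z x x' = 0" for x
      by (rule gram_det_imp_nondegenerate[of "K z", OF Kl(2)[OF Dm(2)[OF \<open>z \<in> Dm\<close>]] Dm(3)[OF \<open>z \<in> Dm\<close>] that])
    show ?thesis
      using nondegenerate_bij[of "K z", OF Kl[OF Dm(2)[OF that]] nd l] by blast
  qed
  \<comment> \<open>The first component is the gradient in the coordinates of \<open>c\<close>, the
    second the multiplier.\<close>
  then obtain sol where sol: "\<And>z x'. z \<in> Dm \<Longrightarrow> K z (sol z) x' = df (snd z) (fst x')" by metis
  have ssol: "smooth_on Dm sol"
  proof (rule smooth_on_linear_system[OF oO])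
    show "linear (\<lambda>u. K z u v)" if "z \<in> Dm" for z v using Kl(2)[OF Dm(2)[OF that]] .
    show "gram_det (K z) ?bb \<noteq> 0" if "z \<in> Dm" for z using Dm(3)[OF that] .
    show "smooth_on Dm (\<lambda>y. K y u v)" for u v using smooth_on_subset[OF sK DU] .
    show "smooth_on Dm (\<lambda>z. df (snd z) (fst v))" for v
      using smooth_on_subset[OF smooth_on_compose_snd[OF oU smooth_on_frechet_derivative[OF sf]]] DU
      unfolding df_def OU_def by blast
    show "K y (sol y) v = df (snd y) (fst v)" if "y \<in> Dm" for y v using sol[OF that] .
  qed
  define \<rho> where "\<rho> = (\<lambda>z. sqrt (r2 z))"
  define F where "F = (\<lambda>z. \<rho> z *\<^sub>R fst (sol z))"
  have s\<rho>: "smooth_on Dm \<rho>"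
    unfolding \<rho>_def by (rule smooth_on_sqrt[OF oO smooth_on_subset[OF sr2 DU] Dm(4)])
  have sF: "smooth_on Dm F"
    unfolding F_def
    by (intro smooth_on_scaleR oO s\<rho> smooth_on_linear_compose[OF oO bounded_linear_fst ssol])
  \<comment> \<open>Only the directions \<open>(0, b)\<close> enter: the divergence differentiates
    in space, with \<open>s\<close> fixed.\<close>
  define R where "R = (\<lambda>z. (\<Sum>b\<in>Basis. frechet_derivative F (at z) (0, b) \<bullet> b) / \<rho> z)"
  have \<rho>_pos: "\<rho> z > 0" if "z \<in> Dm" for z using Dm(4)[OF that] by (simp add: \<rho>_def)
  have "smooth_on Dm R"
    unfolding R_def
    by (intro smooth_on_divide[OF oO _ s\<rho>] smooth_on_sum smooth_on_inner_left smooth_on_frechet_derivative oO sF)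
      (use \<rho>_pos in force)
  then have "continuous_on Dm R" by (rule smooth_on_continuous_on)
  then have contR: "continuous_on ({0..} \<times> U) R"
    by (rule continuous_on_subset) (use in_O in auto)

  have grad: "bordered_form (?h 0 y) (hyp_form A \<omega> B (cinv c y)) s (fr y (fst (sol (s, y))), snd (sol (s, y))) x' =
      dfun B f (cinv c y) (fst x')" if sy: "s \<ge> 0" "y \<in> U" for s y x'
    using sol[OF in_O[OF sy], of "(to y (fst x'), snd x')"] to(1)[OF UU0[OF sy(2)]] dfun[OF sy(2), of "to y (fst x')"]
    by (simp add: K)
  \<comment> \<open>One computation serves both operators: in coordinates their volume forms differ
    from \<open>\<rho> (s, y) * det_form vs\<close> by a constant \<open>k\<close> only.\<close>
  have div_lap: "divergence B \<mu> V (cinv c y) = R (s, y)"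
    if sy: "s \<ge> 0" "y \<in> U" and k: "k \<noteq> 0"
      and vol: "\<And>y vs. y \<in> U \<Longrightarrow> length vs = DIM('s) \<Longrightarrow>
        \<mu> (cinv c y) (map (from_coords B c (cinv c y)) vs) = k * \<rho> (s, y) * det_form vs"
      and vf: "\<And>y. y \<in> U \<Longrightarrow> V (cinv c y) = from_coords B c (cinv c y) (fst (sol (s, y)))"
    for s y k \<mu> V
  proof -
    have "((\<lambda>y. (s, y)) has_derivative (\<lambda>h. (0, h))) (at y)"
      by (auto intro!: derivative_eq_intros)
    from has_derivative_compose[where g = F, OF this smooth_on_has_derivative[OF sF in_O[OF sy]]]
    have "((\<lambda>y. \<rho> (s, y) *\<^sub>R fst (sol (s, y))) has_derivative (\<lambda>h. frechet_derivative F (at (s, y)) (0, h))) (at y)"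
      by (simp add: F_def)
    from divergence_chart[where \<rho> = "\<lambda>y. \<rho> (s, y)" and Z = "\<lambda>y. fst (sol (s, y))" and V = V and \<mu> = \<mu>,
        OF MB c(1) oU _ sy(2) vol vf this k]
    show ?thesis using U0c UU0 \<rho>_pos[OF in_O[OF sy]] by (force simp: R_def)
  qed
  have ldfun: "linear (dfun B f (cinv c y))" if "y \<in> U" for y
    using linear_dfun[OF MB oW q(1)[OF UU0[OF that]] f] .
  have lap: "lap s (cinv c y) = R (s, y)" if sy: "s \<ge> 0" "y \<in> U" for s y
  proof (cases "s = 0")
    case True
    have "divergence B (hyp_volume A n \<omega> g B \<eta>) (horizontal_gradient A \<omega> g B f) (cinv c y) = R (s, y)"
    proof (rule div_lap[OF sy, of "fact n * sgn (e y0)"])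
      show "fact n * sgn (e y0) \<noteq> 0" using enz[OF y0U0] by (simp add: sgn_zero_iff)
    next
      fix y assume y: "y \<in> U"
      show "horizontal_gradient A \<omega> g B f (cinv c y) = from_coords B c (cinv c y) (fst (sol (s, y)))"
        using horizontal_gradient_bordered[OF C emb q(1)[OF UU0[OF y]] grad[OF order_refl y] ldfun[OF y]] True
        by (simp add: fr_def)
      fix vs :: "'s list" assume vs: "length vs = DIM('s)"
      note y0' = UU0[OF y]
      let ?D = "gram_det (?h 1 y) ?b - gram_det (?h 0 y) ?b"
      have "hyp_volume A n \<omega> g B \<eta> (cinv c y) (map (fr y) vs) =
          det_form (map (fr y) vs) * hyp_volume A n \<omega> g B \<eta> (cinv c y) ?b"
        by (rule alternating_eq_det_form[OF alternating_hyp_volume[OF C emb q(1)[OF y0'] n \<eta>]]) (simp add: vs)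
      also have "\<dots> = det_form vs * \<delta> y * (fact n * (sgn (\<eta> (cinv c y) ?b) * sqrt ?D))"
        by (simp only: \<delta>'[OF y0' vs] hyp_volume_basis[OF C emb q(1)[OF y0'] n \<eta>])
      \<comment> \<open>The sign of \<delta> joins that of \<eta> to give the constant
        \<open>sgn (e y0)\<close>, while its absolute value turns \<open>sqrt ?D\<close> into
        \<rho>.\<close>
      also have "\<delta> y = sgn (\<delta> y) * \<bar>\<delta> y\<bar>" by (simp add: sgn_mult_abs)
      also have "det_form vs * (sgn (\<delta> y) * \<bar>\<delta> y\<bar>) * (fact n * (sgn (\<eta> (cinv c y) ?b) * sqrt ?D)) =
          fact n * (sgn (\<delta> y) * sgn (\<eta> (cinv c y) ?b)) * (\<bar>\<delta> y\<bar> * sqrt ?D) * det_form vs"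
        by (simp only: mult_ac)
      also have "sgn (\<delta> y) * sgn (\<eta> (cinv c y) ?b) = sgn (e y0)"
        using sg[OF y] e[OF y0'] by (simp add: sgn_mult)
      also have "\<bar>\<delta> y\<bar> * sqrt ?D = \<rho> (s, y)"
        using True by (simp add: \<rho>_def r2_def gHb[OF y0'] left_diff_distrib[symmetric] real_sqrt_mult)
      finally show "hyp_volume A n \<omega> g B \<eta> (cinv c y) (map (from_coords B c (cinv c y)) vs) =
          fact n * sgn (e y0) * \<rho> (s, y) * det_form vs" by (simp add: fr_def)
    qed
    then show ?thesis using True by (simp add: lap_def sub_laplacian_def)
  next
    case False
    then have s: "s > 0" using sy by simp
    let ?I = "induced_metric A B (riem_approx A \<omega> g (sqrt s))"
    have I: "?I (cinv c y) = ?h (1 / s) y" if "y \<in> U" for y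
      using induced_metric_eq[OF C emb, of "cinv c y" "sqrt s"] q(1)[OF UU0[OF that]] s by simp
    have "divergence B (volume_form ?I \<eta>) (riem_gradient B ?I f) (cinv c y) = R (s, y)"
    proof (rule div_lap[OF sy, of "sgn (e y0) / sqrt s"])
      show "sgn (e y0) / sqrt s \<noteq> 0" using enz[OF y0U0] s by (simp add: sgn_zero_iff)
    next
      fix y assume y: "y \<in> U"
      have "riem_gradient B ?I f (cinv c y) = riem_gradient B (hyp_metric A \<omega> g B (1 / s)) f (cinv c y)"
        by (simp add: riem_gradient_def I[OF y])
      then show "riem_gradient B ?I f (cinv c y) = from_coords B c (cinv c y) (fst (sol (s, y)))"
        using riem_gradient_bordered[OF C emb q(1)[OF UU0[OF y]] s grad[OF sy(1) y] ldfun[OF y]]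
        by (simp add: fr_def)
      fix vs :: "'s list" assume vs: "length vs = DIM('s)"
      note y0' = UU0[OF y]
      \<comment> \<open>\<open>A + D / s = (s A + D) / s\<close>, which is the source of the factor
        \<open>1 / sqrt s\<close>.\<close>
      have "gram_det (?h (1 / s) y) ?b * (\<delta> y)\<^sup>2 = r2 (s, y) / s"
        unfolding gram_hyp_metric_affine[OF C emb q(1)[OF y0'], of "1 / s"] using s
        by (simp add: r2_def gHb[OF y0'] field_simps)
      then have "gram_det (?h (1 / s) y) (map (fr y) vs) = r2 (s, y) / s * (det_form vs)\<^sup>2"
        unfolding gH[OF y0' vs] by (simp add: power_mult_distrib mult.assoc mult.commute)
      then have sq: "sqrt (gram_det (?h (1 / s) y) (map (fr y) vs)) = \<rho> (s, y) / sqrt s * \<bar>det_form vs\<bar>"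
        by (simp add: real_sqrt_mult real_sqrt_divide \<rho>_def)
      have "\<eta> (cinv c y) (map (fr y) vs) = det_form vs * e y"
        unfolding e[OF y0'] using orientation_eq[OF C emb q(1)[OF y0'] n \<eta>, of "map (fr y) vs"] vs \<delta>'[OF y0' vs]
        by simp
      then have "sgn (\<eta> (cinv c y) (map (fr y) vs)) = sgn (det_form vs) * sgn (e y0)"
        using sg[OF y] by (simp add: sgn_mult)
      then have "volume_form ?I \<eta> (cinv c y) (map (fr y) vs) =
          sgn (e y0) / sqrt s * \<rho> (s, y) * (sgn (det_form vs) * \<bar>det_form vs\<bar>)"
        unfolding volume_form_def I[OF y] sq by simp
      then show "volume_form ?I \<eta> (cinv c y) (map (from_coords B c (cinv c y)) vs) =
          sgn (e y0) / sqrt s * \<rho> (s, y) * det_form vs" by (simp add: fr_def sgn_mult_abs)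
    qed
    then show ?thesis using False by (simp add: lap_def laplace_beltrami_def)
  qed
  \<comment> \<open>The differential of \<open>f\<close> vanishes on \<open>V\<close>, so
    nondegeneracy makes \<open>sol\<close> zero on the open set
    \<open>Dm \<inter> (UNIV \<times> V)\<close>, and with it the derivative of
    \<open>F\<close>.\<close>
  have zero: "R (s, y) = 0" if s: "s \<ge> 0" and V: "open V" "y \<in> V" "V \<subseteq> U" and f0: "\<And>z. z \<in> V \<Longrightarrow> f (cinv c z) = 0" for s y V
  proof -
    have df0: "df z = (\<lambda>v. 0)" if "z \<in> V" for z
      unfolding df_def
      by (rule frechet_derivative_cong_open[OF V(1) that, where f = "\<lambda>_. 0"]) (use f0 in auto)
    have sol0: "sol z = 0" if "z \<in> Dm" "snd z \<in> V" for z
      by (rule gram_det_imp_nondegenerate[of "K z", OF Kl(2)[OF Dm(2)[OF that(1)]] Dm(3)[OF that(1)]])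
        (simp add: sol[OF that(1)] df0[OF that(2)])
    have "open (Dm \<inter> (UNIV \<times> V))" using oO V(1) by (simp add: open_Times open_Int)
    then have "frechet_derivative F (at (s, y)) = (\<lambda>v. 0)"
      by (rule frechet_derivative_cong_open[where f = "\<lambda>_. 0"])
        (use in_O[OF s] V sol0 in \<open>auto simp: F_def\<close>)
    then show ?thesis by (simp add: R_def)
  qed
  have "U \<subseteq> cmap c ` (?W \<inter> cdom c)" unfolding U_def U0_def by blast
  with c oU y0U[unfolded y0_def] show thesis
    by (rule that[OF _ _ _ _ _ contR lap zero])
qed

section \<open>Uniformity on the noncharacteristic set\<close>

text \<open>Finitely many neighbourhoods obtained from \<open>lap_local\<close> cover
  \<open>K\<close> and give a common bound for \<open>s\<close>. Each point outside \<open>K\<close>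
  has a neighbourhood on which \<open>f\<close> vanishes, so there \<open>lap s\<close> is zero for
  all \<open>s \<ge> 0\<close> and no bound is required.\<close>

lemma lap_uniform_limit:
  assumes K: "compact K" "K \<subseteq> S - characteristic_points A \<omega> S B"
    and supp: "\<And>p. p \<in> S - characteristic_points A \<omega> S B \<Longrightarrow> p \<notin> K \<Longrightarrow> \<exists>T. open T \<and> p \<in> T \<and> (\<forall>x\<in>T \<inter> (S - characteristic_points A \<omega> S B). f x = 0)"
  shows "uniform_limit (S - characteristic_points A \<omega> S B) (\<lambda>\<epsilon>. lap (\<epsilon>\<^sup>2)) (lap 0) (at_right 0)"
proof (rule uniform_limitI)
  fix e :: real assume e: "e > 0"
  let ?W = "S - characteristic_points A \<omega> S B"
  note MA = contact_manifold[OF C]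
  note MB = hyp_manifold[OF MA emb]
  have "\<exists>T d. open T \<and> p \<in> T \<and> d > 0 \<and> (\<forall>q\<in>T \<inter> ?W. \<forall>s. 0 \<le> s \<and> s < d \<longrightarrow> dist (lap s q) (lap 0 q) < e)"
    if p: "p \<in> ?W" for p
  proof -
    obtain c U R where c: "c \<in> B" "p \<in> cdom c" and U: "open U" "cmap c p \<in> U"
      "U \<subseteq> cmap c ` (?W \<inter> cdom c)" and R: "continuous_on ({0..} \<times> U) R"
      and lap: "\<And>s y. s \<ge> 0 \<Longrightarrow> y \<in> U \<Longrightarrow> lap s (cinv c y) = R (s, y)"
      by (rule lap_local[OF p]) blast
    \<comment> \<open>Continuity at the single point \<open>(0, cmap c p)\<close> is used twice, for
      \<open>(s, y)\<close> and for \<open>(0, y)\<close>; hence \<open>e / 2\<close>.\<close>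
    have "\<exists>d>0. \<forall>z\<in>{0..} \<times> U. dist z (0, cmap c p) < d \<longrightarrow> dist (R z) (R (0, cmap c p)) < e / 2"
      using R U(2) e unfolding continuous_on_iff by (metis atLeast_iff half_gt_zero mem_Sigma_iff order_refl)
    then obtain d where d: "d > 0" "\<And>s y. s \<ge> 0 \<Longrightarrow> y \<in> U \<Longrightarrow> dist (s, y) (0, cmap c p) < d \<Longrightarrow>
        dist (R (s, y)) (R (0, cmap c p)) < e / 2" by auto
    define N where "N = U \<inter> ball (cmap c p) (d / 2)"
    have Nc: "N \<subseteq> cmap c ` cdom c" using U(3) by (auto simp: N_def)
    have "openin (top_of_set (cmap c ` cdom c)) N"
      using Nc U(1) by (simp add: N_def open_subset open_Int)
    then have "openin (top_of_set (cdom c)) (cinv c ` N)"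
      by (rule homeomorphism_imp_open_map[OF homeomorphism_symD[OF chart_homeo[OF MB c(1)]]])
    then have "openin (top_of_set S) (cinv c ` N)"
      using chart_openin[OF MB c(1)] openin_trans by blast
    then obtain T where T: "open T" "cinv c ` N = S \<inter> T" by (auto simp: openin_open)
    have "cmap c p \<in> N" using U(2) d(1) by (simp add: N_def)
    then have "p \<in> cinv c ` N" using cinv_cmap[OF MB c] by (metis image_eqI)
    then have "p \<in> T" using T by blast
    moreover have "dist (lap s q) (lap 0 q) < e" if q: "q \<in> T \<inter> ?W" and s: "0 \<le> s" "s < d / 2" for q s
    proof -
      obtain y where y: "y \<in> N" "q = cinv c y" using q T(2) by blast
      then have yU: "y \<in> U" and yd: "dist y (cmap c p) < d / 2" by (auto simp: N_def dist_commute)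
      have near: "dist (R (t, y)) (R (0, cmap c p)) < e / 2" if "0 \<le> t" "t < d / 2" for t
      proof (rule d(2)[OF that(1) yU])
        have "dist (t, y) (0, cmap c p) \<le> \<bar>dist t 0\<bar> + \<bar>dist y (cmap c p)\<bar>"
          unfolding dist_Pair_Pair by (rule sqrt_sum_squares_le_sum_abs)
        also have "\<dots> < d" using that yd by (simp add: dist_real_def)
        finally show "dist (t, y) (0, cmap c p) < d" .
      qed
      have "dist (R (s, y)) (R (0, y)) < e"
        using dist_triangle_half_l[OF near[OF s] near[of 0]] d(1) by simp
      then show ?thesis using lap[OF s(1) yU] lap[of 0 y] yU y(2) by simp
    qed
    ultimately show ?thesis using T(1) d(1) by (intro exI[of _ T] exI[of _ "d / 2"]) auto
  qed
  then obtain T d where Td: "\<And>p. p \<in> ?W \<Longrightarrow> open (T p) \<and> p \<in> T p \<and> d p > 0 \<and>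
      (\<forall>q\<in>T p \<inter> ?W. \<forall>s. 0 \<le> s \<and> s < d p \<longrightarrow> dist (lap s q) (lap 0 q) < e)" by metis
  obtain P where P: "P \<subseteq> K" "finite P" "K \<subseteq> (\<Union>p\<in>P. T p)"
    using compactE_image[OF K(1), of K T] Td K(2) by (metis (no_types, lifting) UN_I subsetD subsetI)
  \<comment> \<open>The element 1 keeps the minimum meaningful when \<open>P\<close> is
    empty.\<close>
  define d0 where "d0 = Min (insert 1 (d ` P))"
  have d0: "d0 > 0" unfolding d0_def using P K(2) Td by (subst Min_gr_iff) auto
  have d0P: "d0 \<le> d p" if "p \<in> P" for p unfolding d0_def using P(2) that by (intro Min_le) auto
  have main: "dist (lap s q) (lap 0 q) < e" if s: "0 \<le> s" "s < d0" and q: "q \<in> ?W" for s q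
  proof (cases "q \<in> K")
    case True
    then obtain p where p: "p \<in> P" "q \<in> T p" using P(3) by blast
    then show ?thesis using Td[of p] P(1) K(2) q s d0P[OF p(1)] by auto
  next
    case False
    then obtain T' where T': "open T'" "q \<in> T'" "\<And>x. x \<in> T' \<inter> ?W \<Longrightarrow> f x = 0"
      using supp[OF q] by blast
    obtain c U R where c: "c \<in> B" "q \<in> cdom c" and U: "open U" "cmap c q \<in> U"
      "U \<subseteq> cmap c ` (?W \<inter> cdom c)"
      and lap: "\<And>s y. s \<ge> 0 \<Longrightarrow> y \<in> U \<Longrightarrow> lap s (cinv c y) = R (s, y)"
      and z: "\<And>s y V. s \<ge> 0 \<Longrightarrow> open V \<Longrightarrow> y \<in> V \<Longrightarrow> V \<subseteq> U \<Longrightarrow> (\<And>z. z \<in> V \<Longrightarrow> f (cinv c z) = 0) \<Longrightarrow> R (s, y) = (0::real)"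
      by (rule lap_local[OF q]) blast
    define V where "V = U \<inter> cmap c ` (S \<inter> T' \<inter> cdom c)"
    have oV: "open V"
      unfolding V_def using U(1) chart_image_open[OF MB c(1), of "S \<inter> T'"] T'(1) by (simp add: openin_open_Int open_Int)
    have qV: "cmap c q \<in> V" using U(2) c T'(2) q by (auto simp: V_def)
    have f0: "f (cinv c y) = 0" if y: "y \<in> V" for y
    proof (rule T'(3))
      obtain x where x: "x \<in> ?W" "x \<in> cdom c" "y = cmap c x" using y U(3) unfolding V_def by blast
      obtain x' where x': "x' \<in> T'" "x' \<in> cdom c" "y = cmap c x'" using y unfolding V_def by blast
      have "cinv c y = x" "cinv c y = x'"
        using cinv_cmap[OF MB c(1) x(2)] cinv_cmap[OF MB c(1) x'(2)] x(3) x'(3) by metis+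
      then show "cinv c y \<in> T' \<inter> ?W" using x x' by simp
    qed
    have "lap t q = 0" if "t \<ge> 0" for t
      using lap[OF that U(2)] z[OF that oV qV _ f0] cinv_cmap[OF MB c] by (auto simp: V_def)
    then show ?thesis using s e by simp
  qed
  show "\<forall>\<^sub>F \<epsilon> in at_right 0. \<forall>q\<in>?W. dist (lap (\<epsilon>\<^sup>2) q) (lap 0 q) < e"
    unfolding eventually_at_right_field
  proof (intro exI conjI allI impI ballI)
    show "0 < sqrt d0" using d0 by simp
    fix \<epsilon> q assume \<epsilon>: "0 < \<epsilon>" "\<epsilon> < sqrt d0" and q: "q \<in> ?W"
    have "\<epsilon>\<^sup>2 < (sqrt d0)\<^sup>2" using \<epsilon> by (intro power_strict_mono) auto
    then show "dist (lap (\<epsilon>\<^sup>2) q) (lap 0 q) < e" using main[of "\<epsilon>\<^sup>2" q] q d0 by simp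
  qed
qed

end

theorem theorem5:
  fixes M S :: "'m::{t2_space,second_countable_topology} set"
    and A :: "('m, 'e::euclidean_space) chart set"
    and B :: "('m, 's::euclidean_space) chart set"
    and n :: nat
    and \<omega> :: "('m, 'e) form"
    and g :: "'m \<Rightarrow> 'e \<Rightarrow> 'e \<Rightarrow> real"
    and \<eta> :: "('m, 's) form"
    and f :: "'m \<Rightarrow> real"
  assumes "n \<ge> 1"
    and "contact_sub_riemannian M A n \<omega> g"
    and "embedded_hypersurface M A S B"
    and "orientation_form S B \<eta>"
    and "smooth_compact_support B S (S - characteristic_points A \<omega> S B) f"
  shows "uniform_limit (S - characteristic_points A \<omega> S B)
           (\<lambda>\<epsilon>::real. laplace_beltrami B \<eta> (induced_metric A B (riem_approx A \<omega> g \<epsilon>)) f)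
           (sub_laplacian A n \<omega> g B \<eta> f)
           (at_right 0)"
proof -
  let ?W = "S - characteristic_points A \<omega> S B"
  let ?L = "lap A B n \<omega> g \<eta> f"
  let ?K = "?W \<inter> closure {x \<in> ?W. f x \<noteq> 0}"
  have f: "smooth_fun B ?W f" and K: "compact ?K"
    using assms(5) by (auto simp: smooth_compact_support_def)
  note ctx = assms(2,3,1,4) f
  have 1: "uniform_limit ?W (\<lambda>\<epsilon>. ?L (\<epsilon>\<^sup>2)) (?L 0) (at_right 0)"
  proof (rule lap_uniform_limit[OF ctx K])
    fix p assume p: "p \<in> ?W" "p \<notin> ?K"
    \<comment> \<open>The compact set is the closure cut with \<open>?W\<close>, so a point of
      \<open>?W\<close> outside it lies off the closure itself.\<close>
    let ?T = "- closure {x \<in> ?W. f x \<noteq> 0}"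
    have "\<forall>x\<in>?T \<inter> ?W. f x = 0" using closure_subset[of "{x \<in> ?W. f x \<noteq> 0}"] by blast
    moreover have "open ?T" by (simp add: open_Compl)
    moreover have "p \<in> ?T" using p by blast
    ultimately show "\<exists>T. open T \<and> p \<in> T \<and> (\<forall>x\<in>T \<inter> ?W. f x = 0)" by blast
  qed blast
  \<comment> \<open>For positive \<epsilon> the parameter is nonzero and its root is \<epsilon>
    itself.\<close>
  have 2: "\<forall>\<^sub>F \<epsilon> in at_right (0::real). \<forall>p\<in>?W. ?L (\<epsilon>\<^sup>2) p =
      laplace_beltrami B \<eta> (induced_metric A B (riem_approx A \<omega> g \<epsilon>)) f p"
    using eventually_at_right_less[of "0::real"]
    by eventually_elim (simp add: lap_def[OF ctx])
  have 3: "?L 0 p = sub_laplacian A n \<omega> g B \<eta> f p" for p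
    by (simp add: lap_def[OF ctx])
  show ?thesis by (rule uniform_limit_cong[OF 2 3, THEN iffD1, OF 1])
qed

end
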